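(* With respect to the inner products $\langle\cdot,\cdot\rangle_{X_0}$ and $\langle\cdot,\cdot\rangle_{X_1}$, $d$ is the adjoint of $d^*$: for all square-summable signed measures $\nu_0$ on $X_0$ and $\nu_1$ on $X_1$, $$\langle \nu_1, d^*\nu_0\rangle_{X_1}=\langle d\,\nu_1,\nu_0\rangle_{X_0}.$$ Equivalently, for any $G\in X_0$ and $H\in X_1$, $$\mu_0(G)\,\mathbb{P}(G\xrightarrow{d^*}H)=\mu_1(H)\,\mathbb{P}(H\xrightarrow{d}G).$$
   Context: Fix a prime $p$. $X_0$ is the set of isomorphism classes of finite abelian $p$-groups; $X_1$ is the set of isomorphism classes of finitely generated $\mathbb{Z}_p$-modules of $\mathbb{Q}_p$-rank $1$. The random operator $d$ from $X_1$ to $X_0$: $d(H)$ is the quotient of $H$ by (the submodule generated by) a Haar-random element of $H$ (almost surely finite). The random operator $d^*$ from $X_0$ to $X_1$: $d^*(G)$ is the middle term of the extension $0\to\mathbb{Z}_p\to H\to G\to 0$ corresponding to a uniformly random element of the finite group $\mathrm{Ext}(G,\mathbb{Z}_p)$. $\mathbb{P}(x\xrightarrow{T}y)$ denotes the probability that the random operator $T$ takes $x$ to (an object isomorphic to) $y$, and $T$ acts linearly on signed measures by $(T\nu)(y)=\sum_x\nu(x)\,\mathbb{P}(x\xrightarrow{T}y)$. $\mu_0(G)=c_0/|\mathrm{Aut}(G)|$ on $X_0$, with $c_0=\prod_{i\ge1}(1-p^{-i})$; $\mu_1(H)=c_1/(|H_{tors}||\mathrm{Aut}(H_{tors})|)$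 on $X_1$, with $c_1=\prod_{i\ge2}(1-p^{-i})$ and $H_{tors}$ the torsion submodule of $H$. Both are probability measures. For $j=0,1$, $\langle\nu,\nu'\rangle_{X_j}=\sum_{x\in X_j}\nu(x)\nu'(x)/\mu_j(x)$; a signed measure $\nu$ on $X_j$ is square-summable if $\langle\nu,\nu\rangle_{X_j}<\infty$. *)

theory Defs
  imports "HOL-Probability.Probability" "HOL-Algebra.Module" "HOL-Algebra.Coset" "HOL-Algebra.Bij"
begin

section \<open>The ring of p-adic integers\<close>

text \<open>
  A p-adic integer is a coherent sequence of residues: \<open>x n\<close> is the representative in
  \<open>{0..<p^n}\<close> of its class modulo \<open>p^n\<close>. The record also carries the scalar multiplication of
  the ring on itself, so \<open>Zp p\<close> serves both as the ring of scalars and as the free module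
  of rank one.
\<close>

type_synonym padic = "nat \<Rightarrow> int"

definition Zp :: "nat \<Rightarrow> (padic, padic) module" where
  "Zp p =
    \<lparr>carrier = {x. \<forall>n. x n \<in> {0..<int p ^ n} \<and> x (Suc n) mod int p ^ n = x n},
     monoid.mult = (\<lambda>x y n. (x n * y n) mod int p ^ n),
     one = (\<lambda>n. 1 mod int p ^ n),
     zero = (\<lambda>n. 0),
     add = (\<lambda>x y n. (x n + y n) mod int p ^ n),
     smult = (\<lambda>x y n. (x n * y n) mod int p ^ n)\<rparr>"


section \<open>Modules\<close>

definition mod_hom ::
    "('r, 'k) ring_scheme \<Rightarrow> ('r, 'a, 'm) module_scheme \<Rightarrow> ('r, 'b, 'n) module_scheme \<Rightarrow> ('a \<Rightarrow> 'b) set"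
  where "mod_hom R M N =
    {f \<in> carrier M \<rightarrow> carrier N.
       (\<forall>x\<in>carrier M. \<forall>y\<in>carrier M. f (x \<oplus>\<^bsub>M\<^esub> y) = f x \<oplus>\<^bsub>N\<^esub> f y) \<and>
       (\<forall>a\<in>carrier R. \<forall>x\<in>carrier M. f (a \<odot>\<^bsub>M\<^esub> x) = a \<odot>\<^bsub>N\<^esub> f x)}"

definition mod_isomorphic ::
    "('r, 'k) ring_scheme \<Rightarrow> ('r, 'a, 'm) module_scheme \<Rightarrow> ('r, 'b, 'n) module_scheme \<Rightarrow> bool"
  where "mod_isomorphic R M N \<longleftrightarrow>
    (\<exists>f\<in>mod_hom R M N. bij_betw f (carrier M) (carrier N))"

definition submodule_generated ::
    "('r, 'k) ring_scheme \<Rightarrow> ('r, 'a, 'm) module_scheme \<Rightarrow> 'a set \<Rightarrow> 'a set"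
  where "submodule_generated R M S = \<Inter>{N. submodule N R M \<and> S \<subseteq> N}"

definition finitely_generated_module ::
    "('r, 'k) ring_scheme \<Rightarrow> ('r, 'a, 'm) module_scheme \<Rightarrow> bool"
  where "finitely_generated_module R M \<longleftrightarrow>
    (\<exists>S. finite S \<and> S \<subseteq> carrier M \<and> submodule_generated R M S = carrier M)"

definition lin_independent ::
    "('r, 'k) ring_scheme \<Rightarrow> ('r, 'a, 'm) module_scheme \<Rightarrow> 'a set \<Rightarrow> bool"
  where "lin_independent R M S \<longleftrightarrow>
    finite S \<and> S \<subseteq> carrier M \<and>
    (\<forall>c\<in>S \<rightarrow> carrier R.
       finsum M (\<lambda>s. c s \<odot>\<^bsub>M\<^esub> s) S = \<zero>\<^bsub>M\<^esub> \<longrightarrow> (\<forall>s\<in>S. c s = \<zero>\<^bsub>R\<^esub>))"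

text \<open>
  The rank of a module over a domain is the maximal number of linearly independent elements,
  i.e. the dimension of the vector space obtained by extending scalars to the fraction field.
\<close>

definition has_rank ::
    "('r, 'k) ring_scheme \<Rightarrow> ('r, 'a, 'm) module_scheme \<Rightarrow> nat \<Rightarrow> bool"
  where "has_rank R M n \<longleftrightarrow>
    (\<exists>S. lin_independent R M S \<and> card S = n) \<and>
    (\<forall>S. lin_independent R M S \<longrightarrow> card S \<le> n)"

definition torsion_submodule ::
    "('r, 'k) ring_scheme \<Rightarrow> ('r, 'a, 'm) module_scheme \<Rightarrow> 'a set"
  where "torsion_submodule R M =
    {x \<in> carrier M. \<exists>a\<in>carrier R - {\<zero>\<^bsub>R\<^esub>}. a \<odot>\<^bsub>M\<^esub> x = \<zero>\<^bsub>M\<^esub>}"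


section \<open>The objects and the sets of isomorphism classes\<close>

definition finite_abelian_p_group :: "nat \<Rightarrow> 'a monoid \<Rightarrow> bool"
  where "finite_abelian_p_group p G \<longleftrightarrow>
    comm_group G \<and> finite (carrier G) \<and> (\<exists>k. order G = p ^ k)"

definition fg_Zp_module_rank1 :: "nat \<Rightarrow> (padic, 'a) module \<Rightarrow> bool"
  where "fg_Zp_module_rank1 p H \<longleftrightarrow>
    Module.module (Zp p) H \<and> finitely_generated_module (Zp p) H \<and> has_rank (Zp p) H 1"

text \<open>
  Isomorphism classes are formed among the structures whose elements are drawn from one
  sufficiently large type: every finite group has an isomorphic copy with elements in
  \<^typ>\<open>nat\<close>, and every finitely generated module over the p-adic integers has at most the
  cardinality of the continuum, hence an isomorphic copy with elements in \<^typ>\<open>padic\<close>.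
\<close>

definition X0 :: "nat \<Rightarrow> nat monoid set set"
  where "X0 p = {G. finite_abelian_p_group p G} //
    {(G, G'). finite_abelian_p_group p G \<and> finite_abelian_p_group p G' \<and> G \<cong> G'}"

definition X1 :: "nat \<Rightarrow> (padic, padic) module set set"
  where "X1 p = {H. fg_Zp_module_rank1 p H} //
    {(H, H'). fg_Zp_module_rank1 p H \<and> fg_Zp_module_rank1 p H' \<and> mod_isomorphic (Zp p) H H'}"

definition rep :: "'s set \<Rightarrow> 's"
  where "rep x = (SOME s. s \<in> x)"


section \<open>The random operator from X1 to X0\<close>

definition padic_topology :: "nat \<Rightarrow> (padic, 'a) module \<Rightarrow> 'a topology"
  where "padic_topology p H = topology_generated_by
    {{x \<oplus>\<^bsub>H\<^esub> add_pow H (p ^ n) y | y. y \<in> carrier H} | x n. x \<in> carrier H}"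

definition is_haar_measure :: "nat \<Rightarrow> (padic, 'a) module \<Rightarrow> 'a measure \<Rightarrow> bool"
  where "is_haar_measure p H M \<longleftrightarrow>
    prob_space M \<and> space M = carrier H \<and>
    sets M = sigma_sets (carrier H) {U. openin (padic_topology p H) U} \<and>
    (\<forall>x\<in>carrier H. \<forall>A\<in>sets M. emeasure M ((\<lambda>a. x \<oplus>\<^bsub>H\<^esub> a) ` A) = emeasure M A)"

definition haar :: "nat \<Rightarrow> (padic, 'a) module \<Rightarrow> 'a measure"
  where "haar p H = (THE M. is_haar_measure p H M)"

definition prob_d :: "nat \<Rightarrow> (padic, 'a) module \<Rightarrow> 'b monoid \<Rightarrow> real"
  where "prob_d p H G =
    measure (haar p H)
      {h \<in> carrier H. (add_monoid H Mod submodule_generated (Zp p) H {h}) \<cong> G}"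


section \<open>The random operator from X0 to X1\<close>

text \<open>
  A finite abelian p-group of order \<open>p^k\<close> is annihilated by \<open>p^k\<close>, so it is canonically a
  module over the p-adic integers, on which a scalar acts through its residue modulo \<open>p^k\<close>.
  The fields \<open>mult\<close> and \<open>one\<close> of a module record play no role.
\<close>

definition p_group_module :: "nat \<Rightarrow> 'a monoid \<Rightarrow> (padic, 'a) module"
  where "p_group_module p G =
    \<lparr>carrier = carrier G, monoid.mult = undefined, one = undefined,
     zero = \<one>\<^bsub>G\<^esub>, add = (\<otimes>\<^bsub>G\<^esub>),
     smult = (\<lambda>z g. g [^]\<^bsub>G\<^esub> z (multiplicity p (order G)))\<rparr>"

text \<open>
  Extensions \<open>0 \<rightarrow> Zp \<rightarrow> E \<rightarrow> G \<rightarrow> 0\<close>, given as \<open>(E, i, q)\<close>. Choosing a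
  set-theoretic section of \<open>q\<close> identifies \<open>E\<close> with \<open>Zp \<times> G\<close> as a set, so restricting the
  elements of \<open>E\<close> to the type \<^typ>\<open>padic \<times> 'a\<close> loses no equivalence class.
\<close>

type_synonym 'a extension =
  "(padic, padic \<times> 'a) module \<times> (padic \<Rightarrow> padic \<times> 'a) \<times> (padic \<times> 'a \<Rightarrow> 'a)"

definition extensions :: "nat \<Rightarrow> 'a monoid \<Rightarrow> 'a extension set"
  where "extensions p G =
    {(E, i, q). Module.module (Zp p) E \<and>
       i \<in> mod_hom (Zp p) (Zp p) E \<and> inj_on i (carrier (Zp p)) \<and>
       q \<in> mod_hom (Zp p) E (p_group_module p G) \<and> q ` carrier E = carrier G \<and>
       i ` carrier (Zp p) = {e \<in> carrier E. q e = \<one>\<^bsub>G\<^esub>}}"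

definition extension_equiv :: "nat \<Rightarrow> 'a monoid \<Rightarrow> ('a extension \<times> 'a extension) set"
  where "extension_equiv p G =
    {((E, i, q), (E', i', q')).
       (E, i, q) \<in> extensions p G \<and> (E', i', q') \<in> extensions p G \<and>
       (\<exists>f\<in>mod_hom (Zp p) E E'. bij_betw f (carrier E) (carrier E') \<and>
          (\<forall>z\<in>carrier (Zp p). f (i z) = i' z) \<and> (\<forall>e\<in>carrier E. q' (f e) = q e))}"

definition Ext :: "nat \<Rightarrow> 'a monoid \<Rightarrow> 'a extension set set"
  where "Ext p G = extensions p G // extension_equiv p G"

definition prob_dstar :: "nat \<Rightarrow> 'a monoid \<Rightarrow> (padic, 'b) module \<Rightarrow> real"
  where "prob_dstar p G H =
    measure_pmf.prob (pmf_of_set (Ext p G))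
      {c \<in> Ext p G. \<exists>(E, i, q)\<in>c. mod_isomorphic (Zp p) E H}"


section \<open>The measures and inner products\<close>

definition c0 :: "nat \<Rightarrow> real"
  where "c0 p = prodinf (\<lambda>i. 1 - 1 / real p ^ (i + 1))"

definition c1 :: "nat \<Rightarrow> real"
  where "c1 p = prodinf (\<lambda>i. 1 - 1 / real p ^ (i + 2))"

text \<open>
  \<^term>\<open>auto G\<close> is the set of automorphisms of the group \<open>G\<close>, extended by \<^term>\<open>undefined\<close>
  outside the carrier; so its cardinality is the order of the automorphism group.
\<close>

definition mu0 :: "nat \<Rightarrow> 'a monoid \<Rightarrow> real"
  where "mu0 p G = c0 p / real (card (auto G))"

definition mu1 :: "nat \<Rightarrow> (padic, 'a) module \<Rightarrow> real"
  where "mu1 p H =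
    (let T = torsion_submodule (Zp p) H
     in c1 p / (real (card T) * real (card (auto ((add_monoid H)\<lparr>carrier := T\<rparr>)))))"

text \<open>
  A finite signed measure on a countable discrete set \<open>X\<close> is identified with its mass function,
  an absolutely summable real function on \<open>X\<close>. (For real-valued functions \<open>summable_on\<close> means
  absolute summability.)
\<close>

definition signed_measure_on :: "'x set \<Rightarrow> ('x \<Rightarrow> real) \<Rightarrow> bool"
  where "signed_measure_on X \<nu> \<longleftrightarrow> \<nu> summable_on X"

definition inner_on :: "'x set \<Rightarrow> ('x \<Rightarrow> real) \<Rightarrow> ('x \<Rightarrow> real) \<Rightarrow> ('x \<Rightarrow> real) \<Rightarrow> real"
  where "inner_on X \<mu> \<nu> \<nu>' = (\<Sum>\<^sub>\<infinity>x\<in>X. \<nu> x * \<nu>' x / \<mu> x)"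

definition square_summable_on :: "'x set \<Rightarrow> ('x \<Rightarrow> real) \<Rightarrow> ('x \<Rightarrow> real) \<Rightarrow> bool"
  where "square_summable_on X \<mu> \<nu> \<longleftrightarrow> (\<lambda>x. \<nu> x * \<nu> x / \<mu> x) summable_on X"

definition apply_operator :: "'x set \<Rightarrow> ('x \<Rightarrow> 'y \<Rightarrow> real) \<Rightarrow> ('x \<Rightarrow> real) \<Rightarrow> 'y \<Rightarrow> real"
  where "apply_operator X P \<nu> y = (\<Sum>\<^sub>\<infinity>x\<in>X. \<nu> x * P x y)"

definition mu0_class :: "nat \<Rightarrow> nat monoid set \<Rightarrow> real"
  where "mu0_class p x = mu0 p (rep x)"

definition mu1_class :: "nat \<Rightarrow> (padic, padic) module set \<Rightarrow> real"
  where "mu1_class p y = mu1 p (rep y)"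

definition d_op :: "nat \<Rightarrow> ((padic, padic) module set \<Rightarrow> real) \<Rightarrow> nat monoid set \<Rightarrow> real"
  where "d_op p = apply_operator (X1 p) (\<lambda>y x. prob_d p (rep y) (rep x))"

definition dstar_op :: "nat \<Rightarrow> (nat monoid set \<Rightarrow> real) \<Rightarrow> (padic, padic) module set \<Rightarrow> real"
  where "dstar_op p = apply_operator (X0 p) (\<lambda>x y. prob_dstar p (rep x) (rep y))"

end

theory Submission
  imports Defs "HOL-Number_Theory.Cong" "HOL-Algebra.Multiplicative_Group"
begin

text \<open>
  Write \<open>|G| = p^k\<close>. An extension \<open>0 \<rightarrow> Zp \<rightarrow> E \<rightarrow> G \<rightarrow> 0\<close> is classified by the character \<open>\<xi> : G \<rightarrow> Z/p^k\<close>
  sending \<open>q e\<close> to \<open>z mod p^k\<close> where \<open>p^k e = i z\<close>, so \<open>Ext(G, Zp)\<close> has \<open>|G|\<close> elements, and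
  \<open>P(G \<rightarrow> H)\<close> is the proportion of characters realized by extensions with middle term \<open>H\<close>.

  Write \<open>H = Zp g \<oplus> T\<close> with \<open>T\<close> finite. Scaling by a unit, a realized character comes from an extension
  with \<open>i 1 = p^v g + s\<close>, \<open>s \<in> T\<close>, where \<open>p^v |T| = |G|\<close>. The automorphisms of \<open>H\<close> fixing \<open>g\<close> modulo
  \<open>T\<close> act simply transitively on the normalized extensions with a given character, and there are
  \<open>|T| |Aut T|\<close> of them; on the other hand the surjections onto \<open>G\<close> with kernel \<open>Zp (p^v g + s)\<close> form
  an \<open>Aut G\<close>-torsor or the empty set. So the number of realized characters times \<open>|T| |Aut T|\<close>
  is \<open>|Aut G|\<close> times the number of \<open>s\<close> for which \<open>H / (p^v g + s) \<cong> G\<close>. Since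
  \<open>H / (u h) = H / (h)\<close> for units \<open>u\<close>, this last number is also
  \<open>P(H \<rightarrow> G) |T| p^v / (1 - 1/p)\<close>, and detailed balance follows from
  \<open>c0 = (1 - 1/p) c1\<close>. Adjointness is then Fubini's theorem for a double series dominated, by
  AM-GM and detailed balance, by the two square sums.
\<close>

section \<open>Arithmetic of the p-adic integers\<close>

text \<open>The character is a complete invariant because p^k kills G while Zp h is torsion-free, h
  being the image of 1: an element e of a middle term is pinned down by q e together with p^k e in
  Zp h. Existence of equivalences comes from this, and so does their uniqueness, which makes the
  action of the automorphisms in the count free. The complement Zp g of T is not canonical.
  Automorphisms fixing g modulo T are the right group because an isomorphism carrying p^v g + s to
  p^v g + s' must be one of them. The factor 1 - 1/p is the Haar measure of the units: an h with
  quotient G determines both u and s in h = u (p^v g + s). The equation p^v |T| = |G| fixes v; when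
  it has no solution, both probabilities are 0. Haar measure is given by a definite description, so
  existence and uniqueness both have to be established. It is tested on cosets of p^n H with n so
  large that p^n kills T; there the torsion part is frozen and only the coefficient of g is blurred.
  The domination before Fubini rests on row sums at most 1 for both operators, which come from
  disjoint sets of characters and from disjoint events.\<close>

lemma Zp_carrier_iff:
  "x \<in> carrier (Zp p) \<longleftrightarrow> (\<forall>n. 0 \<le> x n \<and> x n < int p ^ n \<and> x (Suc n) mod int p ^ n = x n)"
  by (auto simp: Zp_def)

lemma Zp_simps:
  "\<zero>\<^bsub>Zp p\<^esub> = (\<lambda>n. 0)"
  "\<one>\<^bsub>Zp p\<^esub> = (\<lambda>n. 1 mod int p ^ n)"
  "x \<oplus>\<^bsub>Zp p\<^esub> y = (\<lambda>n. (x n + y n) mod int p ^ n)"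
  "x \<otimes>\<^bsub>Zp p\<^esub> y = (\<lambda>n. (x n * y n) mod int p ^ n)"
  "x \<odot>\<^bsub>Zp p\<^esub> y = (\<lambda>n. (x n * y n) mod int p ^ n)"
  by (simp_all add: Zp_def)

lemma (in abelian_group) minus_zeroD:
  assumes "x \<in> carrier G" "y \<in> carrier G" "x \<ominus> y = \<zero>"
  shows "x = y"
  using assms by (metis a_minus_def add.inv_solve_right l_zero zero_closed)

lemma (in abelian_group) minus_eqD:
  assumes "x \<in> carrier G" "y \<in> carrier G" "x \<ominus> y = z"
  shows "x = y \<oplus> z"
  using assms by (metis a_minus_def a_comm add.inv_solve_right minus_closed)

definition padic_of_int :: "nat \<Rightarrow> int \<Rightarrow> padic"
  where "padic_of_int p a = (\<lambda>n. a mod int p ^ n)"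

lemma Zp_nth_mod:
  assumes "x \<in> carrier (Zp p)" "n \<le> m"
  shows "x m mod int p ^ n = x n"
  using assms(2)
proof (induction m rule: dec_induct)
  case base
  show ?case using assms(1) by (simp add: Zp_carrier_iff)
next
  case (step m)
  have "x (Suc m) mod int p ^ n = x (Suc m) mod int p ^ m mod int p ^ n"
    using step(1) by (simp add: mod_mod_cancel le_imp_power_dvd)
  also have "\<dots> = x n"
    using step assms(1) by (simp add: Zp_carrier_iff)
  finally show ?case .
qed

lemma Zp_nth_mod_self [simp]:
  assumes "x \<in> carrier (Zp p)"
  shows "x n mod int p ^ n = x n"
  using Zp_nth_mod[OF assms order_refl] .

locale padic_prime =
  fixes p :: nat
  assumes prime: "prime p"
begin

abbreviation Zp_add :: "padic \<Rightarrow> padic \<Rightarrow> padic" (infixl \<open>\<boxplus>\<close> 65)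
  where "x \<boxplus> y \<equiv> x \<oplus>\<^bsub>Zp p\<^esub> y"

abbreviation Zp_mult :: "padic \<Rightarrow> padic \<Rightarrow> padic" (infixl \<open>\<boxtimes>\<close> 70)
  where "x \<boxtimes> y \<equiv> x \<otimes>\<^bsub>Zp p\<^esub> y"

lemma p_gt_1: "p > 1" 
  using prime prime_gt_1_nat by blast

lemma q_pos [simp]: "int p ^ n > 0"
  using p_gt_1 by simp

lemma q_mod_range [simp]: "0 \<le> a mod int p ^ n" "a mod int p ^ n < int p ^ n"
  by (rule pos_mod_sign pos_mod_bound, rule q_pos)+

lemma p_not_0 [simp]: "p \<noteq> 0"
  using p_gt_1 by simp

text \<open>Coherence only has to be checked as a congruence between unreduced entries, so that
  sums, products, negatives and inverses can be written down entrywise and reduced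
  afterwards.\<close>

lemma Zp_memI:
  assumes "\<And>n. y (Suc n) mod int p ^ n = y n mod int p ^ n"
  shows "(\<lambda>n. y n mod int p ^ n) \<in> carrier (Zp p)"
proof -
  have "y (Suc n) mod int p ^ Suc n mod int p ^ n = y n mod int p ^ n" for n
    using assms by (simp add: mod_mod_cancel)
  thus ?thesis by (simp add: Zp_carrier_iff del: power_Suc of_nat_power)
qed

lemma Zp_add_closed:
  assumes "x \<in> carrier (Zp p)" "y \<in> carrier (Zp p)"
  shows "x \<boxplus> y \<in> carrier (Zp p)"
  unfolding Zp_simps
proof (rule Zp_memI)
  fix n
  show "(x (Suc n) + y (Suc n)) mod int p ^ n = (x n + y n) mod int p ^ n"
    using assms by (metis mod_add_eq Zp_carrier_iff)
qed

lemma Zp_mult_closed: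
  assumes "x \<in> carrier (Zp p)" "y \<in> carrier (Zp p)"
  shows "x \<boxtimes> y \<in> carrier (Zp p)"
  unfolding Zp_simps
proof (rule Zp_memI)
  fix n
  show "(x (Suc n) * y (Suc n)) mod int p ^ n = (x n * y n) mod int p ^ n"
    using assms by (metis mod_mult_eq Zp_carrier_iff)
qed

lemma padic_of_int_closed [simp]: "padic_of_int p a \<in> carrier (Zp p)"
  unfolding padic_of_int_def by (rule Zp_memI) simp

lemma Zp_zero_conv: "\<zero>\<^bsub>Zp p\<^esub> = padic_of_int p 0"
  and Zp_one_conv: "\<one>\<^bsub>Zp p\<^esub> = padic_of_int p 1"
  by (simp_all add: Zp_simps padic_of_int_def)

lemma padic_of_int_add: "padic_of_int p (a + b) = padic_of_int p a \<boxplus> padic_of_int p b"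
  and padic_of_int_mult: "padic_of_int p (a * b) = padic_of_int p a \<boxtimes> padic_of_int p b"
  by (simp_all add: Zp_simps padic_of_int_def mod_simps)

lemma Zp_cring: "cring (Zp p)"
proof (rule cringI)
  show "abelian_group (Zp p)"
  proof (rule abelian_groupI)
    fix x assume x: "x \<in> carrier (Zp p)"
    define y where "y = (\<lambda>n. (- x n) mod int p ^ n)"
    have "y \<in> carrier (Zp p)"
      unfolding y_def
    proof (rule Zp_memI)
      fix n
      show "- x (Suc n) mod int p ^ n = - x n mod int p ^ n"
        using x by (metis mod_minus_eq Zp_carrier_iff)
    qed
    moreover have "y \<boxplus> x = \<zero>\<^bsub>Zp p\<^esub>"
      by (simp add: y_def Zp_simps mod_simps)
    ultimately show "\<exists>y\<in>carrier (Zp p). y \<boxplus> x = \<zero>\<^bsub>Zp p\<^esub>" by blast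
  qed (auto simp: Zp_add_closed Zp_zero_conv, auto simp: Zp_simps padic_of_int_def mod_simps add_ac)
  show "Group.comm_monoid (Zp p)"
    by (rule comm_monoidI)
      (auto simp: Zp_mult_closed Zp_one_conv, auto simp: Zp_simps padic_of_int_def mod_simps mult_ac)
qed (auto simp: Zp_simps mod_simps algebra_simps)

sublocale Zp: cring "Zp p" by (rule Zp_cring)

lemma padic_of_int_minus: "padic_of_int p (- a) = \<ominus>\<^bsub>Zp p\<^esub> padic_of_int p a"
proof -
  have "padic_of_int p (- a) \<boxplus> padic_of_int p a = \<zero>\<^bsub>Zp p\<^esub>"
    by (simp add: padic_of_int_add[symmetric] Zp_zero_conv)
  thus ?thesis using Zp.minus_equality by simp
qed

abbreviation pw :: "nat \<Rightarrow> padic" where "pw n \<equiv> padic_of_int p (int p ^ n)"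

lemma pw_add: "pw (m + n) = pw m \<boxtimes> pw n"
  by (simp add: power_add padic_of_int_mult)

lemma pw_0 [simp]: "pw 0 = \<one>\<^bsub>Zp p\<^esub>"
  by (simp add: Zp_one_conv)

lemma Zp_nth_pw_mult: "(pw n \<boxtimes> x) m = (int p ^ n * x m) mod int p ^ m"
  by (simp add: Zp_simps padic_of_int_def mod_simps)

text \<open>Vanishing modulo p^n makes every later entry divisible by p^n, and the quotient is read
  off n places further on: \<open>x (m + n) div int p ^ n\<close> is a residue modulo p^m.\<close>

lemma Zp_pw_dvd:
  assumes x: "x \<in> carrier (Zp p)" and "x n = 0"
  shows "\<exists>y\<in>carrier (Zp p). x = pw n \<boxtimes> y"
proof -
  define y where "y = (\<lambda>m. x (m + n) div int p ^ n)"
  have d: "x (m + n) = int p ^ n * y m" for m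
  proof -
    have "x (m + n) mod int p ^ n = 0" using Zp_nth_mod[OF x, of n "m + n"] assms by simp
    thus ?thesis unfolding y_def by auto
  qed
  have y_range: "0 \<le> y m \<and> y m < int p ^ m" for m
  proof -
    have "0 \<le> x (m+n)" "x (m + n) < int p ^ (m + n)" using x by (auto simp: Zp_carrier_iff)
    hence "0 \<le> int p ^ n * y m" "int p ^ n * y m < int p ^ n * int p ^ m"
      by (simp_all add: d power_add mult.commute)
    moreover have "0 \<le> y m" using \<open>0 \<le> int p ^ n * y m\<close> q_pos[of n] by (simp add: zero_le_mult_iff)
    ultimately show ?thesis using q_pos[of n] by (simp only: mult_less_cancel_left_pos)
  qed
  have "y (Suc m) mod int p ^ m = y m" for m
  proof -
    have "x (Suc (m + n)) mod int p ^ (m + n) = x (m + n)" using x by (simp add: Zp_carrier_iff)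
    hence "int p ^ n * y (Suc m) mod (int p ^ n * int p ^ m) = int p ^ n * y m"
      using d[of "Suc m"] d[of m] by (simp add: power_add mult.commute)
    thus ?thesis by (simp add: mult_mod_right[symmetric])
  qed
  hence "y \<in> carrier (Zp p)" using y_range by (simp add: Zp_carrier_iff)
  moreover have "x = pw n \<boxtimes> y"
  proof (rule ext)
    fix m
    have "(pw n \<boxtimes> y) m = (int p ^ n * y m) mod int p ^ m"
      by (rule Zp_nth_pw_mult)
    also have "\<dots> = x (m + n) mod int p ^ m" by (simp add: d)
    also have "\<dots> = x m" using Zp_nth_mod[OF x] by simp
    finally show "x m = (pw n \<boxtimes> y) m" ..
  qed
  ultimately show ?thesis by blast
qed

text \<open>The difference of x and its residue vanishes at level n, hence is divisible by p^n.
  Through this a scalar acts as an integer on anything that p^n kills, which later turns additive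
  maps into linear ones.\<close>

lemma Zp_pw_split:
  assumes x: "x \<in> carrier (Zp p)"
  shows "\<exists>y\<in>carrier (Zp p). x = padic_of_int p (x n) \<boxplus> pw n \<boxtimes> y"
proof -
  have "(x \<ominus>\<^bsub>Zp p\<^esub> padic_of_int p (x n)) n = 0"
  proof -
    have "(x \<ominus>\<^bsub>Zp p\<^esub> padic_of_int p (x n)) = x \<boxplus> padic_of_int p (- x n)"
      by (simp add: padic_of_int_minus a_minus_def)
    thus ?thesis by (simp add: Zp_simps padic_of_int_def mod_simps)
  qed
  then obtain y where "y \<in> carrier (Zp p)" "x \<ominus>\<^bsub>Zp p\<^esub> padic_of_int p (x n) = pw n \<boxtimes> y"
    using Zp_pw_dvd[of "x \<ominus>\<^bsub>Zp p\<^esub> padic_of_int p (x n)" n] x by auto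
  moreover have "x = padic_of_int p (x n) \<boxplus> (x \<ominus>\<^bsub>Zp p\<^esub> padic_of_int p (x n))"
    using x by (simp add: a_minus_def Zp.a_ac Zp.r_neg Zp.r_neg1)
  ultimately show ?thesis by metis
qed

lemma Zp_pw_mult_eq_0:
  assumes "x \<in> carrier (Zp p)" "pw n \<boxtimes> x = \<zero>\<^bsub>Zp p\<^esub>"
  shows "x = \<zero>\<^bsub>Zp p\<^esub>"
proof (rule ext)
  fix m
  \<comment> \<open>Multiplication by p^n loses n places, so level m of x becomes visible only at
    level n + m of the product.\<close>
  have "(pw n \<boxtimes> x) (n + m) = 0" using assms by (simp add: Zp_simps)
  hence "int p ^ n * x (n + m) mod (int p ^ n * int p ^ m) = 0"
    by (simp only: Zp_nth_pw_mult power_add)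
  hence "x (n + m) mod int p ^ m = 0" by (simp add: mult_mod_right[symmetric])
  thus "x m = \<zero>\<^bsub>Zp p\<^esub> m" using Zp_nth_mod[OF assms(1), of m "n + m"] by (simp add: Zp_simps)
qed

section \<open>Units, valuation and absence of zero divisors\<close>

definition punit :: "padic set"
  where "punit = {u \<in> carrier (Zp p). u 1 \<noteq> 0}"

lemma punit_carrier: "u \<in> punit \<Longrightarrow> u \<in> carrier (Zp p)"
  by (simp add: punit_def)

lemma nth_0 [simp]: "x \<in> carrier (Zp p) \<Longrightarrow> x 0 = 0"
  using Zp_nth_mod_self[of x p 0] by simp

lemma punit_coprime:
  assumes "u \<in> punit" shows "coprime (u n) (int p ^ n)"
proof (cases n)
  case (Suc m)
  have "u n mod int p = u 1" using assms Zp_nth_mod[of u p 1 n] Suc by (simp add: punit_def)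
  hence "\<not> int p dvd u n" using assms by (auto simp: punit_def dvd_eq_mod_eq_0)
  thus ?thesis using prime prime_imp_coprime[of "int p" "u n"]
    by (simp add: coprime_commute)
qed simp

text \<open>Invertibility is detected modulo p: \<open>u n\<close> is coprime to p^n, so an inverse
  \<open>y n\<close> exists at each level, and cancelling \<open>u n\<close> modulo p^n shows that
  these inverses are coherent.\<close>

lemma punit_inverse:
  assumes u: "u \<in> punit"
  obtains w where "w \<in> punit" "w \<boxtimes> u = \<one>\<^bsub>Zp p\<^esub>"
proof -
  have "\<exists>w. (u n * w) mod int p ^ n = 1 mod int p ^ n" for n
    using cong_solve_coprime_int[OF punit_coprime[OF u, of n]]
    by (auto simp: cong_def)
  then obtain y where y: "\<And>n. (u n * y n) mod int p ^ n = 1 mod int p ^ n" by metis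
  define w where "w = (\<lambda>n. y n mod int p ^ n)"
  have uc: "u \<in> carrier (Zp p)" using u by (rule punit_carrier)
  have w: "w \<in> carrier (Zp p)" unfolding w_def
  proof (rule Zp_memI)
    fix n
    have "(u (Suc n) * y (Suc n)) mod int p ^ n = 1 mod int p ^ n"
      using y[of "Suc n"] by (metis le_add2 le_imp_power_dvd mod_mod_cancel plus_1_eq_Suc)
    hence "(u n * y (Suc n)) mod int p ^ n = 1 mod int p ^ n"
      using uc by (metis Zp_carrier_iff mod_mult_left_eq)
    with y[of n] have "[u n * y (Suc n) = u n * y n] (mod int p ^ n)" by (simp add: cong_def)
    thus "y (Suc n) mod int p ^ n = y n mod int p ^ n"
      using punit_coprime[OF u, of n] cong_mult_lcancel unfolding cong_def by blast
  qed
  have wu: "w \<boxtimes> u = \<one>\<^bsub>Zp p\<^esub>"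
    by (rule ext) (simp add: Zp_simps w_def mod_simps y mult.commute[of _ "u _"])
  have "w 1 \<noteq> 0"
  proof
    assume "w 1 = 0"
    hence "(w \<boxtimes> u) 1 = 0" by (simp add: Zp_simps)
    moreover have "\<one>\<^bsub>Zp p\<^esub> 1 = 1" using p_gt_1 by (simp add: Zp_simps)
    ultimately show False using wu by simp
  qed
  thus ?thesis using that[of w] w wu by (simp add: punit_def)
qed

lemma Zp_decompose:
  assumes x: "x \<in> carrier (Zp p)" and "x \<noteq> \<zero>\<^bsub>Zp p\<^esub>"
  obtains v u where "u \<in> punit" "x = pw v \<boxtimes> u"
proof -
  have "\<exists>n. x n \<noteq> 0" using assms(2) by (auto simp: Zp_simps)
  define n where "n = (LEAST n. x n \<noteq> 0)"
  have n: "x n \<noteq> 0" "\<And>m. m < n \<Longrightarrow> x m = 0"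
    using LeastI_ex[OF \<open>\<exists>n. x n \<noteq> 0\<close>] not_less_Least[of _ "\<lambda>n. x n \<noteq> 0"]
    unfolding n_def by blast+
  \<comment> \<open>Level 0 always carries 0 (residues modulo 1), so n is positive. The valuation is
    n - 1, the last level at which x still vanishes.\<close>
  then obtain v where v: "n = Suc v" using x by (cases n) auto
  obtain u where u: "u \<in> carrier (Zp p)" "x = pw v \<boxtimes> u"
    using Zp_pw_dvd[OF x, of v] n v by auto
  have "u 1 \<noteq> 0"
  proof
    assume "u 1 = 0"
    then obtain y where "y \<in> carrier (Zp p)" "u = pw 1 \<boxtimes> y"
      using Zp_pw_dvd[OF u(1), of 1] by auto
    hence "x = pw n \<boxtimes> y"
      unfolding u(2) v using pw_add[of v 1] by (simp add: Zp.m_assoc)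
    hence "x n = 0" by (simp add: Zp_nth_pw_mult)
    thus False using n by simp
  qed
  thus ?thesis using that u by (simp add: punit_def)
qed

lemma punit_nonzero: "u \<in> punit \<Longrightarrow> u \<noteq> \<zero>\<^bsub>Zp p\<^esub>"
  by (auto simp: punit_def Zp_simps)

lemma pw_mult_cancel:
  assumes "x \<in> carrier (Zp p)" "y \<in> carrier (Zp p)" "pw n \<boxtimes> x = pw n \<boxtimes> y"
  shows "x = y"
proof -
  have "pw n \<boxtimes> (x \<ominus>\<^bsub>Zp p\<^esub> y) = \<zero>\<^bsub>Zp p\<^esub>"
    using assms by (simp add: a_minus_def Zp.r_distr Zp.r_minus Zp.r_neg)
  hence "x \<ominus>\<^bsub>Zp p\<^esub> y = \<zero>\<^bsub>Zp p\<^esub>"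
    using Zp_pw_mult_eq_0[OF Zp.minus_closed] assms by blast
  thus ?thesis using Zp.minus_zeroD assms by blast
qed

text \<open>Write y = p^v u: the unit u is inverted, and p^v is cancelled by
  \<open>Zp_pw_mult_eq_0\<close>.\<close>

lemma Zp_domain:
  assumes "x \<in> carrier (Zp p)" "y \<in> carrier (Zp p)" "x \<boxtimes> y = \<zero>\<^bsub>Zp p\<^esub>"
  shows "x = \<zero>\<^bsub>Zp p\<^esub> \<or> y = \<zero>\<^bsub>Zp p\<^esub>"
proof (rule disjCI)
  assume "y \<noteq> \<zero>\<^bsub>Zp p\<^esub>"
  then obtain v u where u: "u \<in> punit" "y = pw v \<boxtimes> u" using assms Zp_decompose by metis
  obtain w where w: "w \<in> punit" "w \<boxtimes> u = \<one>\<^bsub>Zp p\<^esub>" using u punit_inverse by metis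
  have "pw v \<boxtimes> x = (x \<boxtimes> y) \<boxtimes> w"
    using u w assms punit_carrier[OF u(1)] punit_carrier[OF w(1)]
    by (metis (no_types, lifting) padic_of_int_closed Zp.m_assoc Zp.m_comm Zp.r_one Zp.m_closed)
  hence "pw v \<boxtimes> x = \<zero>\<^bsub>Zp p\<^esub>" using assms punit_carrier[OF w(1)] by simp
  thus "x = \<zero>\<^bsub>Zp p\<^esub>" using assms Zp_pw_mult_eq_0 by blast
qed

lemma pw_nonzero: "pw n \<noteq> \<zero>\<^bsub>Zp p\<^esub>"
proof
  assume "pw n = \<zero>\<^bsub>Zp p\<^esub>"
  hence "pw n (Suc n) = 0" by (simp add: Zp_simps)
  thus False using p_gt_1 by (simp add: padic_of_int_def)
qed

end

section \<open>Modules of rank one\<close>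

lemma (in padic_prime) Zp_one_neq_zero: "\<one>\<^bsub>Zp p\<^esub> \<noteq> \<zero>\<^bsub>Zp p\<^esub>"
  using pw_nonzero[of 0] Zp_one_conv by simp

lemma (in padic_prime) one_punit: "\<one>\<^bsub>Zp p\<^esub> \<in> punit"
proof -
  have "\<one>\<^bsub>Zp p\<^esub> 1 = 1" using p_gt_1 by (simp add: Zp_simps)
  thus ?thesis by (simp add: punit_def)
qed

locale Zp_module = padic_prime p + module "Zp p" M for p and M :: "(padic, 'a) module" (structure)
begin

lemma smult_comm: "a \<in> carrier (Zp p) \<Longrightarrow> b \<in> carrier (Zp p) \<Longrightarrow> x \<in> carrier M \<Longrightarrow> a \<odot> (b \<odot> x) = b \<odot> (a \<odot> x)"
  using smult_assoc1 Zp.m_comm by metis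

lemma smult_l_diff: "a \<in> carrier (Zp p) \<Longrightarrow> b \<in> carrier (Zp p) \<Longrightarrow> x \<in> carrier M \<Longrightarrow> (a \<ominus>\<^bsub>Zp p\<^esub> b) \<odot> x
    = a \<odot> x \<ominus> b \<odot> x"
  by (simp add: a_minus_def smult_l_distr smult_l_minus)

lemma smult_r_diff: "a \<in> carrier (Zp p) \<Longrightarrow> x \<in> carrier M \<Longrightarrow> y \<in> carrier M \<Longrightarrow> a \<odot> (x \<ominus> y) = a \<odot> x \<ominus> a \<odot> y"
  by (simp add: a_minus_def smult_r_distr smult_r_minus)

lemma add_pow_eq_smult: "x \<in> carrier M \<Longrightarrow> add_pow M (k::nat) x = padic_of_int p (int k) \<odot> x"
proof (induction k)
  case 0
  thus ?case using smult_l_null[of x] Zp_zero_conv by simp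
next
  case (Suc k)
  have "padic_of_int p (int (Suc k)) = padic_of_int p (int k) \<boxplus> \<one>\<^bsub>Zp p\<^esub>"
    by (simp add: Zp_one_conv padic_of_int_add[symmetric] add.commute)
  thus ?case using Suc by (simp add: smult_l_distr)
qed

text \<open>Torsion sees a scalar only modulo p^n. This makes Zp t finite in
  \<open>finite_tors\<close>, additive automorphisms of the torsion linear in
  \<open>auto_tors_smult\<close>, and b s dependent on a residue of b only in
  \<open>smult_tors_eq\<close>.\<close>

lemma smult_killed:
  assumes "x \<in> carrier M" "z \<in> carrier (Zp p)" "pw n \<odot> x = \<zero>"
  shows "z \<odot> x = padic_of_int p (z n) \<odot> x"
proof -
  obtain y where "y \<in> carrier (Zp p)" "z = padic_of_int p (z n) \<boxplus> pw n \<boxtimes> y"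
    using Zp_pw_split[OF assms(2)] by blast
  hence "z \<odot> x = padic_of_int p (z n) \<odot> x \<oplus> y \<odot> (pw n \<odot> x)"
    using assms by (metis smult_l_distr smult_assoc1 padic_of_int_closed Zp.m_closed Zp.m_comm)
  thus ?thesis using assms \<open>y \<in> carrier (Zp p)\<close> by simp
qed

definition cyc :: "'a \<Rightarrow> 'a set" where "cyc h = {z \<odot> h |z. z \<in> carrier (Zp p)}"

lemma cyc_submodule: "h \<in> carrier M \<Longrightarrow> submodule (cyc h) (Zp p) M"
proof (rule submoduleI)
  assume h: "h \<in> carrier M"
  show "cyc h \<subseteq> carrier M" using h by (auto simp: cyc_def)
  show "\<zero> \<in> cyc h" using h smult_l_null[OF h] unfolding cyc_def by (auto intro!: exI[of _ "\<zero>\<^bsub>Zp p\<^esub>"])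
  show "\<ominus> a \<in> cyc h" if "a \<in> cyc h" for a
    using that h smult_l_minus[OF _ h] Zp.a_inv_closed unfolding cyc_def by (smt (verit) mem_Collect_eq)
  show "a \<oplus> b \<in> cyc h" if "a \<in> cyc h" "b \<in> cyc h" for a b
    using that h smult_l_distr[OF _ _ h] Zp.a_closed unfolding cyc_def by (smt (verit) mem_Collect_eq)
  show "a \<odot> b \<in> cyc h" if "a \<in> carrier (Zp p)" "b \<in> cyc h" for a b
    using that h smult_assoc1[OF _ _ h] Zp.m_closed unfolding cyc_def by (smt (verit) mem_Collect_eq)
qed

lemma submodule_generated_singleton:
  assumes "h \<in> carrier M"
  shows "submodule_generated (Zp p) M {h} = cyc h"
proof
  have "h \<in> cyc h" using smult_one[OF assms] unfolding cyc_def by (auto intro!: exI[of _ "\<one>\<^bsub>Zp p\<^esub>"])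
  thus "submodule_generated (Zp p) M {h} \<subseteq> cyc h"
    unfolding submodule_generated_def using cyc_submodule[OF assms] by blast
  show "cyc h \<subseteq> submodule_generated (Zp p) M {h}"
    unfolding submodule_generated_def cyc_def using submoduleE(4) by blast
qed

definition nontorsion :: "'a \<Rightarrow> bool"
  where "nontorsion h \<longleftrightarrow> h \<in> carrier M \<and> (\<forall>z\<in>carrier (Zp p). z \<odot> h = \<zero> \<longrightarrow> z = \<zero>\<^bsub>Zp p\<^esub>)"

lemma nontorsion_cancel:
  assumes "nontorsion h" "a \<in> carrier (Zp p)" "b \<in> carrier (Zp p)" "a \<odot> h = b \<odot> h"
  shows "a = b"
proof -
  have "h \<in> carrier M" using assms by (simp add: nontorsion_def)
  have "(a \<ominus>\<^bsub>Zp p\<^esub> b) \<odot> h = a \<odot> h \<ominus> b \<odot> h" using \<open>h \<in> carrier M\<close> assms by (intro smult_l_diff)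
  also have "\<dots> = \<zero>" using \<open>h \<in> carrier M\<close> assms by (simp add: a_minus_def M.r_neg)
  finally have "(a \<ominus>\<^bsub>Zp p\<^esub> b) \<odot> h = \<zero>" .
  hence "a \<ominus>\<^bsub>Zp p\<^esub> b = \<zero>\<^bsub>Zp p\<^esub>" using assms Zp.minus_closed by (simp add: nontorsion_def)
  thus ?thesis using Zp.minus_zeroD assms by blast
qed

abbreviation tors :: "'a set" where "tors \<equiv> torsion_submodule (Zp p) M"

lemma tors_carrier: "t \<in> tors \<Longrightarrow> t \<in> carrier M"
  by (simp add: torsion_submodule_def)

lemma torsI:
  assumes "x \<in> carrier M" "pw n \<odot> x = \<zero>"
  shows "x \<in> tors"
proof -
  have "pw n \<in> carrier (Zp p) - {\<zero>\<^bsub>Zp p\<^esub>}" using pw_nonzero by simp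
  thus ?thesis using assms unfolding torsion_submodule_def by blast
qed

lemma tors_submodule: "submodule tors (Zp p) M"
proof (rule submoduleI)
  show "tors \<subseteq> carrier M" using tors_carrier by blast
  have "\<one>\<^bsub>Zp p\<^esub> \<odot> \<zero> = \<zero>" "\<one>\<^bsub>Zp p\<^esub> \<noteq> \<zero>\<^bsub>Zp p\<^esub>" using Zp_one_neq_zero by auto
  thus "\<zero> \<in> tors" by (auto simp: torsion_submodule_def)
  show "\<ominus> x \<in> tors" if "x \<in> tors" for x
    using that by (auto simp: torsion_submodule_def smult_r_minus)
  show "x \<oplus> y \<in> tors" if xy: "x \<in> tors" "y \<in> tors" for x y
  proof -
    obtain a b where a: "a \<in> carrier (Zp p)" "a \<noteq> \<zero>\<^bsub>Zp p\<^esub>" "a \<odot> x = \<zero>" and b: "b \<in> carrier (Zp p)"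
        "b \<noteq> \<zero>\<^bsub>Zp p\<^esub>" "b \<odot> y = \<zero>"
      using xy by (auto simp: torsion_submodule_def)
    have c: "x \<in> carrier M" "y \<in> carrier M" using xy tors_carrier by auto
    have "(a \<boxtimes> b) \<odot> (x \<oplus> y) = b \<odot> (a \<odot> x) \<oplus> a \<odot> (b \<odot> y)"
      using a(1) b(1) c by (simp add: smult_r_distr smult_assoc1 smult_comm[of a b x])
    hence "(a \<boxtimes> b) \<odot> (x \<oplus> y) = \<zero>" using a b by simp
    moreover have "a \<boxtimes> b \<noteq> \<zero>\<^bsub>Zp p\<^esub>" using Zp_domain a b by blast
    ultimately show ?thesis using a b c Zp_mult_closed by (auto simp: torsion_submodule_def)
  qed
  show "z \<odot> x \<in> tors" if z: "z \<in> carrier (Zp p)" and x: "x \<in> tors" for z x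
  proof -
    obtain a where "a \<in> carrier (Zp p)" "a \<noteq> \<zero>\<^bsub>Zp p\<^esub>" "a \<odot> x = \<zero>"
      using x by (auto simp: torsion_submodule_def)
    moreover have "x \<in> carrier M" using x by (rule tors_carrier)
    ultimately have "a \<odot> (z \<odot> x) = \<zero>" using z by (simp add: smult_comm[of a z])
    thus ?thesis using \<open>a \<in> carrier (Zp p)\<close> \<open>a \<noteq> \<zero>\<^bsub>Zp p\<^esub>\<close> \<open>x \<in> carrier M\<close> z
      by (auto simp: torsion_submodule_def)
  qed
qed

text \<open>The source of uniqueness for decompositions c g + t: the difference of two of them puts
  a multiple of g into the torsion.\<close>

lemma nontorsion_smult_tors:
  assumes "nontorsion h" "c \<in> carrier (Zp p)" "c \<odot> h \<in> tors"
  shows "c = \<zero>\<^bsub>Zp p\<^esub>"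
proof -
  have h: "h \<in> carrier M" using assms by (simp add: nontorsion_def)
  obtain a where a: "a \<in> carrier (Zp p)" "a \<noteq> \<zero>\<^bsub>Zp p\<^esub>" "a \<odot> (c \<odot> h) = \<zero>"
    using assms(3) by (auto simp: torsion_submodule_def)
  hence "(a \<boxtimes> c) \<odot> h = \<zero>" using h assms by (simp add: smult_assoc1)
  hence "a \<boxtimes> c = \<zero>\<^bsub>Zp p\<^esub>" using assms a Zp_mult_closed by (simp add: nontorsion_def)
  thus ?thesis using Zp_domain a assms by blast
qed

lemma fg_submodule_eq:
  assumes "submodule_generated (Zp p) M S = carrier M" "submodule P (Zp p) M" "S \<subseteq> P"
  shows "P = carrier M"
  using assms submoduleE(1) unfolding submodule_generated_def by blast

text \<open>Applied in \<open>finite_tors\<close> in two roles: with a torsion element for h, to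
  enlarge a finite torsion submodule, and with g for h, to exhaust the whole module.\<close>

lemma multiples_submodule:
  assumes "h \<in> carrier M" "K \<subseteq> carrier M" "submodule K (Zp p) M"
  shows "submodule {c \<odot> h \<oplus> k |c k. c \<in> carrier (Zp p) \<and> k \<in> K} (Zp p) M"
proof (rule submoduleI)
  note K = submoduleE[OF assms(3)]
  have Kz: "\<zero> \<in> K" using assms(3) subgroup.one_closed submodule.axioms(1) by fastforce
  show "{c \<odot> h \<oplus> k |c k. c \<in> carrier (Zp p) \<and> k \<in> K} \<subseteq> carrier M" using assms by auto
  show "\<zero> \<in> {c \<odot> h \<oplus> k |c k. c \<in> carrier (Zp p) \<and> k \<in> K}"
    using Kz assms by (auto intro!: exI[of _ "\<zero>\<^bsub>Zp p\<^esub>"] exI[of _ "\<zero>"])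
  show "\<ominus> x \<in> {c \<odot> h \<oplus> k |c k. c \<in> carrier (Zp p) \<and> k \<in> K}"
      if x: "x \<in> {c \<odot> h \<oplus> k |c k. c \<in> carrier (Zp p) \<and> k \<in> K}" for x
  proof -
    obtain c k where ck: "x = c \<odot> h \<oplus> k" "c \<in> carrier (Zp p)" "k \<in> K" using x by blast
    hence "\<ominus> x = (\<ominus>\<^bsub>Zp p\<^esub> c) \<odot> h \<oplus> (\<ominus> k)" using assms by (auto simp: smult_l_minus M.minus_add)
    thus ?thesis using ck K(3) Zp.a_inv_closed by blast
  qed
  show "x \<oplus> y \<in> {c \<odot> h \<oplus> k |c k. c \<in> carrier (Zp p) \<and> k \<in> K}"
    if x: "x \<in> {c \<odot> h \<oplus> k |c k. c \<in> carrier (Zp p) \<and> k \<in> K}"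
        and y: "y \<in> {c \<odot> h \<oplus> k |c k. c \<in> carrier (Zp p) \<and> k \<in> K}" for x y
  proof -
    obtain c k where ck: "x = c \<odot> h \<oplus> k" "c \<in> carrier (Zp p)" "k \<in> K" using x by blast
    obtain d l where dl: "y = d \<odot> h \<oplus> l" "d \<in> carrier (Zp p)" "l \<in> K" using y by blast
    have "k \<in> carrier M" "l \<in> carrier M" using ck dl assms by auto
    hence "x \<oplus> y = (c \<boxplus> d) \<odot> h \<oplus> (k \<oplus> l)"
      using assms(1) ck(1,2) dl(1,2) by (simp add: smult_l_distr M.a_ac)
    thus ?thesis using ck dl K(5) Zp.a_closed by blast
  qed
  show "z \<odot> x \<in> {c \<odot> h \<oplus> k |c k. c \<in> carrier (Zp p) \<and> k \<in> K}"
    if z: "z \<in> carrier (Zp p)" and x: "x \<in> {c \<odot> h \<oplus> k |c k. c \<in> carrier (Zp p) \<and> k \<in> K}" for z x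
  proof -
    obtain c k where ck: "x = c \<odot> h \<oplus> k" "c \<in> carrier (Zp p)" "k \<in> K" using x by blast
    have "k \<in> carrier M" using ck assms by auto
    hence "z \<odot> x = (z \<boxtimes> c) \<odot> h \<oplus> (z \<odot> k)"
      using assms(1) ck(1,2) z by (simp add: smult_r_distr smult_assoc1)
    thus ?thesis using ck z K(4) Zp.m_closed by blast
  qed
qed

text \<open>In rank one, x and h satisfy a nontrivial relation, in which the coefficient of x is
  nonzero because h is nontorsion. Stripping the unit from that coefficient leaves a power of p as
  the only denominator of x over h.\<close>

lemma rank1_nontorsion:
  assumes "has_rank (Zp p) M 1"
  obtains h where "nontorsion h" "\<And>x. x \<in> carrier M \<Longrightarrow> \<exists>n. \<exists>b\<in>carrier (Zp p). pw n \<odot> x = b \<odot> h"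
proof -
  obtain S where "lin_independent (Zp p) M S" "card S = 1"
    using assms by (auto simp: has_rank_def)
  then obtain h where S: "lin_independent (Zp p) M {h}"
    by (metis card_1_singletonE)
  hence h: "h \<in> carrier M" by (simp add: lin_independent_def)
  have nt: "nontorsion h"
    unfolding nontorsion_def
  proof (intro conjI ballI impI)
    fix z assume z: "z \<in> carrier (Zp p)" "z \<odot> h = \<zero>"
    hence "finsum M (\<lambda>s. z \<odot> s) {h} = \<zero>" using h by (simp add: M.finsum_insert)
    moreover have "(\<lambda>_. z) \<in> {h} \<rightarrow> carrier (Zp p)" using z by simp
    ultimately have "\<forall>s\<in>{h}. (\<lambda>_. z) s = \<zero>\<^bsub>Zp p\<^esub>"
      using S bspec[of "{h} \<rightarrow> carrier (Zp p)" _ "\<lambda>_. z"] unfolding lin_independent_def by fastforce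
    thus "z = \<zero>\<^bsub>Zp p\<^esub>" by simp
  qed (use h in simp)
  have "\<exists>n. \<exists>b\<in>carrier (Zp p). pw n \<odot> x = b \<odot> h" if x: "x \<in> carrier M" for x
  \<comment> \<open>For x = h the set \<open>{x, h}\<close> is a singleton, and the rank bound
    yields no relation.\<close>
  proof (cases "x = h")
    case True
    show ?thesis unfolding True by (intro exI[of _ 0] bexI[of _ "pw 0"] refl padic_of_int_closed)
  next
    case False
    hence "card {x, h} = 2" by simp
    hence "\<not> lin_independent (Zp p) M {x, h}" using assms unfolding has_rank_def by fastforce
    then obtain c where c: "c \<in> {x, h} \<rightarrow> carrier (Zp p)" "finsum M (\<lambda>s. c s \<odot> s) {x, h} = \<zero>"
      "\<exists>s\<in>{x, h}. c s \<noteq> \<zero>\<^bsub>Zp p\<^esub>"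
      using x h unfolding lin_independent_def by auto
    have cc: "c x \<in> carrier (Zp p)" "c h \<in> carrier (Zp p)" using c(1) by auto
    have eq: "c x \<odot> x \<oplus> c h \<odot> h = \<zero>" using c(2) x h False cc by (simp add: M.finsum_insert)
    have cx: "c x \<noteq> \<zero>\<^bsub>Zp p\<^esub>"
    proof
      assume "c x = \<zero>\<^bsub>Zp p\<^esub>"
      hence "c h = \<zero>\<^bsub>Zp p\<^esub>" using eq x h cc nt by (simp add: nontorsion_def)
      thus False using c(3) \<open>c x = \<zero>\<^bsub>Zp p\<^esub>\<close> by simp
    qed
    have eq': "c x \<odot> x = (\<ominus>\<^bsub>Zp p\<^esub> c h) \<odot> h"
      using eq x h cc by (simp add: smult_l_minus M.minus_equality[symmetric])
    obtain v u where u: "u \<in> punit" "c x = pw v \<boxtimes> u" using cc cx Zp_decompose by metis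
    obtain w where w: "w \<in> punit" "w \<boxtimes> u = \<one>\<^bsub>Zp p\<^esub>" using u punit_inverse by metis
    note uw = punit_carrier[OF u(1)] punit_carrier[OF w(1)]
    have "pw v = w \<boxtimes> c x"
      unfolding u(2) using uw w Zp.m_lcomm[of w "pw v" u] by simp
    hence "pw v \<odot> x = w \<odot> (c x \<odot> x)" using uw cc x by (simp add: smult_assoc1)
    also have "\<dots> = (w \<boxtimes> \<ominus>\<^bsub>Zp p\<^esub> c h) \<odot> h" using uw cc h eq' by (simp only: smult_assoc1 Zp.a_inv_closed)
    finally show ?thesis using uw cc by (intro exI[of _ v] bexI[of _ "w \<boxtimes> \<ominus>\<^bsub>Zp p\<^esub> c h"]) auto
  qed
  thus ?thesis using that nt by blast
qed

lemma pw_smult_mono: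
  assumes "x \<in> carrier M" "h \<in> carrier M" "b \<in> carrier (Zp p)" "pw n \<odot> x = b \<odot> h" "n \<le> m"
  shows "\<exists>b\<in>carrier (Zp p). pw m \<odot> x = b \<odot> h"
proof -
  have "pw m \<odot> x = pw (m - n) \<odot> (pw n \<odot> x)"
    using assms pw_add[of "m - n" n] smult_assoc1[of "pw (m - n)" "pw n" x] by simp
  also have "\<dots> = (pw (m - n) \<boxtimes> b) \<odot> h" using assms by (simp add: smult_assoc1)
  finally show ?thesis using assms by (intro bexI[of _ "pw (m - n) \<boxtimes> b"]) auto
qed

text \<open>Carries a common denominator p^n from finitely many generators to the whole
  module.\<close>

lemma killed_submodule:
  assumes "h \<in> carrier M"
  shows "submodule {x \<in> carrier M. \<exists>b\<in>carrier (Zp p). pw n \<odot> x = b \<odot> h} (Zp p) M"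
proof (rule submoduleI)
  show "\<zero> \<in> {x \<in> carrier M. \<exists>b\<in>carrier (Zp p). pw n \<odot> x = b \<odot> h}"
    using assms by (auto intro!: bexI[of _ "\<zero>\<^bsub>Zp p\<^esub>"])
  show "\<ominus> x \<in> {x \<in> carrier M. \<exists>b\<in>carrier (Zp p). pw n \<odot> x = b \<odot> h}"
      if x: "x \<in> {x \<in> carrier M. \<exists>b\<in>carrier (Zp p). pw n \<odot> x = b \<odot> h}" for x
  proof -
    obtain b where b: "b \<in> carrier (Zp p)" "pw n \<odot> x = b \<odot> h" "x \<in> carrier M" using x by blast
    hence "pw n \<odot> (\<ominus> x) = (\<ominus>\<^bsub>Zp p\<^esub> b) \<odot> h" using assms by (simp add: smult_r_minus smult_l_minus)
    thus ?thesis using b by auto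
  qed
  show "x \<oplus> y \<in> {x \<in> carrier M. \<exists>b\<in>carrier (Zp p). pw n \<odot> x = b \<odot> h}"
    if x: "x \<in> {x \<in> carrier M. \<exists>b\<in>carrier (Zp p). pw n \<odot> x = b \<odot> h}"
        and y: "y \<in> {x \<in> carrier M. \<exists>b\<in>carrier (Zp p). pw n \<odot> x = b \<odot> h}" for x y
  proof -
    obtain b where b: "b \<in> carrier (Zp p)" "pw n \<odot> x = b \<odot> h" "x \<in> carrier M" using x by blast
    obtain c where c: "c \<in> carrier (Zp p)" "pw n \<odot> y = c \<odot> h" "y \<in> carrier M" using y by blast
    have "pw n \<odot> (x \<oplus> y) = (b \<boxplus> c) \<odot> h" using b c assms by (simp add: smult_r_distr smult_l_distr)
    thus ?thesis using b c Zp.a_closed by auto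
  qed
  show "z \<odot> x \<in> {x \<in> carrier M. \<exists>b\<in>carrier (Zp p). pw n \<odot> x = b \<odot> h}"
    if z: "z \<in> carrier (Zp p)" and x: "x \<in> {x \<in> carrier M. \<exists>b\<in>carrier (Zp p). pw n \<odot> x = b \<odot> h}" for z x
  proof -
    obtain b where b: "b \<in> carrier (Zp p)" "pw n \<odot> x = b \<odot> h" "x \<in> carrier M" using x by blast
    have "pw n \<odot> (z \<odot> x) = (z \<boxtimes> b) \<odot> h" using b z assms by (simp add: smult_comm[of _ z] smult_assoc1)
    thus ?thesis using b z Zp.m_closed by auto
  qed
qed auto

end

text \<open>Models H = Zp g + T; directness of the sum is derived in \<open>split_unique\<close>. N
  is an exponent of the torsion: from level N on, p^n H is just Zp p^n g, which gives its cosets the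
  simple form used for Haar measure.\<close>

locale split_module = Zp_module p M for p and M :: "(padic, 'a) module" (structure) +
  fixes g :: 'a and N :: nat
  assumes g: "nontorsion g"
    and tors_finite: "finite tors"
    and tors_killed: "\<And>t. t \<in> tors \<Longrightarrow> pw N \<odot>\<^bsub>M\<^esub> t = \<zero>\<^bsub>M\<^esub>"
    and split: "\<And>x. x \<in> carrier M \<Longrightarrow> \<exists>c\<in>carrier (Zp p). \<exists>t\<in>tors. x = c \<odot>\<^bsub>M\<^esub> g \<oplus>\<^bsub>M\<^esub> t"

section \<open>Finite torsion and the splitting of rank one modules\<close>

context Zp_module
begin

text \<open>Any finite set lies in some Zp g + K with K a finite torsion submodule. For a generating
  set this sum is the whole module, and since a torsion element has no g-part, the torsion lies in
  K.\<close>

lemma finite_tors: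
  assumes fg: "finitely_generated_module (Zp p) M" and g: "nontorsion g"
    and killed: "\<And>t. t \<in> tors \<Longrightarrow> pw n \<odot> t = \<zero>"
    and split: "\<And>x. x \<in> carrier M \<Longrightarrow> \<exists>c\<in>carrier (Zp p). \<exists>t\<in>tors. x = c \<odot> g \<oplus> t"
  shows "finite tors"
proof -
  have gM: "g \<in> carrier M" using g by (simp add: nontorsion_def)
  note T = submoduleE[OF tors_submodule]
  have ex: "finite S \<Longrightarrow> S \<subseteq> carrier M \<Longrightarrow> \<exists>K. finite K \<and> K \<subseteq> tors \<and> submodule K (Zp p) M \<and>
      S \<subseteq> {c \<odot> g \<oplus> k |c k. c \<in> carrier (Zp p) \<and> k \<in> K}" for S
  proof (induction S rule: finite_induct)
    case empty
    have "submodule {\<zero>} (Zp p) M" by (rule submoduleI) auto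
    moreover have "\<zero> \<in> tors" using tors_submodule subgroup.one_closed submodule.axioms(1) by fastforce
    ultimately show ?case by (intro exI[of _ "{\<zero>}"]) auto
  next
    case (insert s S)
    then obtain K where K: "finite K" "K \<subseteq> tors" "submodule K (Zp p) M"
      "S \<subseteq> {c \<odot> g \<oplus> k |c k. c \<in> carrier (Zp p) \<and> k \<in> K}" by auto
    obtain c t where ct: "c \<in> carrier (Zp p)" "t \<in> tors" "s = c \<odot> g \<oplus> t"
      using split[of s] insert.prems by blast
    have tM: "t \<in> carrier M" and KM: "K \<subseteq> carrier M" using ct K tors_carrier by auto
    have K0: "\<zero> \<in> K" using K(3) subgroup.one_closed submodule.axioms(1) by fastforce
    \<comment> \<open>Adding Zp t to K keeps it finite: p^n t = 0, so z t takes at most p^n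
      values.\<close>
    define K' where "K' = {z \<odot> t \<oplus> k |z k. z \<in> carrier (Zp p) \<and> k \<in> K}"
    have sub: "submodule K' (Zp p) M"
      unfolding K'_def by (rule multiples_submodule) (use tM KM K in auto)
    have "K' \<subseteq> (\<lambda>(a, k). padic_of_int p a \<odot> t \<oplus> k) ` ({0..<int p ^ n} \<times> K)"
    proof
      fix x assume "x \<in> K'"
      then obtain z k where zk: "z \<in> carrier (Zp p)" "k \<in> K" "x = z \<odot> t \<oplus> k" by (auto simp: K'_def)
      have "z \<odot> t = padic_of_int p (z n) \<odot> t" using smult_killed[OF tM zk(1)] killed ct by blast
      moreover have "z n \<in> {0..<int p ^ n}" using zk(1) by (simp add: Zp_carrier_iff)
      ultimately show "x \<in> (\<lambda>(a, k). padic_of_int p a \<odot> t \<oplus> k) ` ({0..<int p ^ n} \<times> K)"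
        using zk by force
    qed
    hence "finite K'" by (rule finite_subset) (use K in simp)
    moreover have "K' \<subseteq> tors" unfolding K'_def using ct K T(4,5) by blast
    moreover have KK': "k \<in> K'" if "k \<in> K" for k
      unfolding K'_def using that KM tM by (auto intro!: exI[of _ "\<zero>\<^bsub>Zp p\<^esub>"] exI[of _ k])
    hence "S \<subseteq> {c \<odot> g \<oplus> k |c k. c \<in> carrier (Zp p) \<and> k \<in> K'}" using K(4) by blast
    moreover have "t \<in> K'"
      unfolding K'_def using K0 tM by (auto intro!: exI[of _ "\<one>\<^bsub>Zp p\<^esub>"] exI[of _ "\<zero>"])
    hence "s \<in> {c \<odot> g \<oplus> k |c k. c \<in> carrier (Zp p) \<and> k \<in> K'}" using ct by blast
    ultimately show ?case using sub by blast
  qed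
  obtain S where S: "finite S" "S \<subseteq> carrier M" "submodule_generated (Zp p) M S = carrier M"
    using fg by (auto simp: finitely_generated_module_def)
  obtain K where K: "finite K" "K \<subseteq> tors" "submodule K (Zp p) M"
    "S \<subseteq> {c \<odot> g \<oplus> k |c k. c \<in> carrier (Zp p) \<and> k \<in> K}" using ex[OF S(1,2)] by blast
  have KM: "K \<subseteq> carrier M" using K tors_carrier by auto
  have eq: "{c \<odot> g \<oplus> k |c k. c \<in> carrier (Zp p) \<and> k \<in> K} = carrier M"
    by (rule fg_submodule_eq[OF S(3) multiples_submodule[OF gM KM K(3)] K(4)])
  have "tors \<subseteq> K"
  proof
    fix t assume t: "t \<in> tors"
    then obtain c k where ck: "c \<in> carrier (Zp p)" "k \<in> K" "t = c \<odot> g \<oplus> k"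
      using eq tors_carrier by blast
    have kM: "k \<in> carrier M" using ck KM by auto
    have "c \<odot> g = t \<oplus> (\<ominus> k)" unfolding ck(3) using ck(1) kM gM by (simp add: M.a_assoc M.r_neg)
    hence "c \<odot> g \<in> tors" using T(5)[OF t T(3)[of k]] ck(2) K(2) by (metis subsetD)
    hence "c = \<zero>\<^bsub>Zp p\<^esub>" using nontorsion_smult_tors[OF g ck(1)] by blast
    thus "t \<in> K" using ck kM gM by simp
  qed
  thus ?thesis using K(1) finite_subset by blast
qed

text \<open>For a common exponent n, multiplication by p^n maps M into Zp h, with image p^v Zp h for
  some v. An element g with p^n g = p^v h splits this map onto its image, and the kernel consists of
  torsion. The same n then kills all torsion.\<close>

lemma rank1_split:
  assumes "finitely_generated_module (Zp p) M" "has_rank (Zp p) M 1"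
  shows "\<exists>g n. split_module p M g n"
proof -
  obtain h where h: "nontorsion h" "\<And>x. x \<in> carrier M \<Longrightarrow> \<exists>n. \<exists>b\<in>carrier (Zp p). pw n \<odot> x = b \<odot> h"
    using rank1_nontorsion[OF assms(2)] by blast
  have hM: "h \<in> carrier M" using h by (simp add: nontorsion_def)
  obtain S where S: "finite S" "S \<subseteq> carrier M" "submodule_generated (Zp p) M S = carrier M"
    using assms by (auto simp: finitely_generated_module_def)
  obtain e where e: "\<And>x. x \<in> carrier M \<Longrightarrow> \<exists>b\<in>carrier (Zp p). pw (e x) \<odot> x = b \<odot> h" using h(2) by metis
  define n where "n = Max (insert 0 (e ` S))"
  have "e x \<le> n" if "x \<in> S" for x unfolding n_def using S that by (intro Max_ge) auto
  hence "S \<subseteq> {x \<in> carrier M. \<exists>b\<in>carrier (Zp p). pw n \<odot> x = b \<odot> h}"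
    using e S(2) pw_smult_mono[OF _ hM] by blast
  hence eq: "{x \<in> carrier M. \<exists>b\<in>carrier (Zp p). pw n \<odot> x = b \<odot> h} = carrier M"
    by (rule fg_submodule_eq[OF S(3) killed_submodule[OF hM]])
  have all: "\<exists>b\<in>carrier (Zp p). pw n \<odot> x = b \<odot> h" if "x \<in> carrier M" for x using eq that by blast
  \<comment> \<open>\<open>P v\<close> says that p^n M contains a unit multiple of p^v h.
    \<open>P n\<close> holds because of h itself; the least such v gives a generator of p^n
    M.\<close>
  define P where "P v \<longleftrightarrow> (\<exists>x\<in>carrier M. \<exists>u\<in>punit. pw n \<odot> x = (pw v \<boxtimes> u) \<odot> h)" for v
  have "P n" unfolding P_def using hM one_punit by (auto intro!: bexI[of _ h] bexI[of _ "\<one>\<^bsub>Zp p\<^esub>"])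
  define v where "v = (LEAST v. P v)"
  have "P v" unfolding v_def using \<open>P n\<close> by (rule LeastI)
  then obtain x u where xu: "x \<in> carrier M" "u \<in> punit" "pw n \<odot> x = (pw v \<boxtimes> u) \<odot> h"
    by (auto simp: P_def)
  obtain w where w: "w \<in> punit" "w \<boxtimes> u = \<one>\<^bsub>Zp p\<^esub>" using xu punit_inverse by metis
  note uw = punit_carrier[OF xu(2)] punit_carrier[OF w(1)]
  define g where "g = w \<odot> x"
  have gM: "g \<in> carrier M" using uw xu by (simp add: g_def)
  have ng: "pw n \<odot> g = pw v \<odot> h"
  proof -
    have "pw n \<odot> g = w \<odot> ((pw v \<boxtimes> u) \<odot> h)" unfolding g_def using uw xu by (simp add: smult_comm[of _ w])
    also have "\<dots> = (w \<boxtimes> (pw v \<boxtimes> u)) \<odot> h" using uw hM by (simp add: smult_assoc1)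
    also have "w \<boxtimes> (pw v \<boxtimes> u) = pw v" using uw w Zp.m_lcomm[of w "pw v" u] by simp
    finally show ?thesis .
  qed
  have nt: "nontorsion g"
    unfolding nontorsion_def
  proof (intro conjI ballI impI)
    fix z assume z: "z \<in> carrier (Zp p)" "z \<odot> g = \<zero>"
    have "(z \<boxtimes> pw v) \<odot> h = z \<odot> (pw n \<odot> g)" using z hM ng by (simp add: smult_assoc1)
    also have "\<dots> = pw n \<odot> (z \<odot> g)" using z gM by (simp add: smult_comm[of z])
    also have "\<dots> = \<zero>" using z by simp
    finally have "z \<boxtimes> pw v = \<zero>\<^bsub>Zp p\<^esub>" using h(1) z Zp_mult_closed by (simp add: nontorsion_def)
    thus "z = \<zero>\<^bsub>Zp p\<^esub>" using Zp_domain[OF z(1) padic_of_int_closed] pw_nonzero by blast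
  qed (rule gM)
  \<comment> \<open>By minimality of v, the coefficient b in p^n y = b h is divisible by p^v, so
    subtracting a suitable multiple of g from y lands in the kernel of p^n.\<close>
  have sp: "\<exists>c\<in>carrier (Zp p). pw n \<odot> (y \<ominus> c \<odot> g) = \<zero>" if y: "y \<in> carrier M" for y
  proof -
    obtain b where b: "b \<in> carrier (Zp p)" "pw n \<odot> y = b \<odot> h" using all y by blast
    have "\<exists>c\<in>carrier (Zp p). b = pw v \<boxtimes> c"
    proof (cases "b = \<zero>\<^bsub>Zp p\<^esub>")
      case True
      thus ?thesis by (intro bexI[of _ "\<zero>\<^bsub>Zp p\<^esub>"]) auto
    next
      case False
      then obtain v' u' where u': "u' \<in> punit" "b = pw v' \<boxtimes> u'" using Zp_decompose[OF b(1)] by metis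
      hence "P v'" unfolding P_def using y b by blast
      hence "v \<le> v'" unfolding v_def by (rule Least_le)
      hence "b = pw v \<boxtimes> (pw (v' - v) \<boxtimes> u')"
        using u' pw_add[of v "v' - v"] punit_carrier[OF u'(1)] by (simp add: Zp.m_assoc)
      thus ?thesis using punit_carrier[OF u'(1)] by (intro bexI[of _ "pw (v' - v) \<boxtimes> u'"]) auto
    qed
    then obtain c where c: "c \<in> carrier (Zp p)" "b = pw v \<boxtimes> c" by blast
    have "b \<odot> h = c \<odot> (pw v \<odot> h)" using c hM by (simp add: smult_assoc1 smult_comm[of "pw v" c])
    hence "pw n \<odot> y = pw n \<odot> (c \<odot> g)" using b c gM ng smult_comm[of "pw n" c g] by simp
    moreover have "pw n \<odot> (y \<ominus> c \<odot> g) = pw n \<odot> y \<ominus> pw n \<odot> (c \<odot> g)"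
      using y c gM by (intro smult_r_diff) auto
    ultimately have "pw n \<odot> (y \<ominus> c \<odot> g) = \<zero>" using c gM by (simp add: a_minus_def M.r_neg)
    thus ?thesis using c by blast
  qed
  have split: "\<exists>c\<in>carrier (Zp p). \<exists>t. t \<in> carrier M \<and> pw n \<odot> t = \<zero> \<and> y = c \<odot> g \<oplus> t"
      if y: "y \<in> carrier M" for y
  proof -
    obtain c where c: "c \<in> carrier (Zp p)" "pw n \<odot> (y \<ominus> c \<odot> g) = \<zero>" using sp[OF y] by blast
    moreover have "y = c \<odot> g \<oplus> (y \<ominus> c \<odot> g)" using M.minus_eqD[OF y _ refl] c gM by simp
    moreover have "y \<ominus> c \<odot> g \<in> carrier M" using y c gM by simp
    ultimately show ?thesis by blast
  qed
  \<comment> \<open>A torsion element has g-part 0 in the decomposition just found, hence equals its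
    part in the kernel of p^n.\<close>
  have killed: "pw n \<odot> t = \<zero>" if t: "t \<in> tors" for t
  proof -
    have tM: "t \<in> carrier M" using t by (rule tors_carrier)
    obtain c s where cs: "c \<in> carrier (Zp p)" "s \<in> carrier M" "pw n \<odot> s = \<zero>" "t = c \<odot> g \<oplus> s"
      using split[OF tM] by blast
    have "s \<in> tors" using cs torsI by blast
    have "c \<odot> g = t \<oplus> (\<ominus> s)" unfolding cs(4) using cs gM by (simp add: M.a_assoc M.r_neg)
    hence "c \<odot> g \<in> tors" using submoduleE(5)[OF tors_submodule t submoduleE(3)[OF tors_submodule \<open>s
        \<in> tors\<close>]] by (rule ssubst)
    hence "c = \<zero>\<^bsub>Zp p\<^esub>" using nontorsion_smult_tors[OF nt cs(1)] by blast
    thus ?thesis using cs gM by simp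
  qed
  have split': "\<exists>c\<in>carrier (Zp p). \<exists>t\<in>tors. y = c \<odot> g \<oplus> t" if y: "y \<in> carrier M" for y
  proof -
    obtain c s where cs: "c \<in> carrier (Zp p)" "s \<in> carrier M" "pw n \<odot> s = \<zero>" "y = c \<odot> g \<oplus> s"
      using split[OF y] by blast
    have "s \<in> tors" using cs torsI by blast
    thus ?thesis using cs by blast
  qed
  have "split_module p M g n"
    using nt killed split' finite_tors[OF assms(1) nt killed split'] by unfold_locales auto
  thus ?thesis by blast
qed

end

section \<open>Characters of finite abelian groups\<close>

text \<open>Homomorphisms from K to Z/n, with residues taken in \<open>{0..<n}\<close> and functions
  extensional, so that for finite K they form a finite set that can be counted.\<close>

definition chars :: "('g, 'm) monoid_scheme \<Rightarrow> 'g set \<Rightarrow> int \<Rightarrow> ('g \<Rightarrow> int) set"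
  where "chars G K n = {\<xi> \<in> K \<rightarrow>\<^sub>E {0..<n}. \<forall>x\<in>K. \<forall>y\<in>K. \<xi> (x \<otimes>\<^bsub>G\<^esub> y) = (\<xi> x + \<xi> y) mod n}"

text \<open>One solution per period of length m. This counts the values an extended character may
  take at the new element, the solutions of r c = r e modulo r m.\<close>

lemma card_residue_class:
  fixes r m e :: int
  assumes "r > 0" "m > 0"
  shows "card {c \<in> {0..<r * m}. c mod m = e mod m} = nat r"
proof -
  have "bij_betw (\<lambda>i. e mod m + i * m) {0..<r} {c \<in> {0..<r * m}. c mod m = e mod m}"
  proof (rule bij_betwI[of _ _ _ "\<lambda>c. c div m"])
    show "(\<lambda>i. e mod m + i * m) \<in> {0..<r} \<rightarrow> {c \<in> {0..<r * m}. c mod m = e mod m}"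
    proof
      fix i assume i: "i \<in> {0..<r}"
      have "e mod m + i * m < m + i * m" using assms by simp
      also have "\<dots> = (i + 1) * m" by (simp add: algebra_simps)
      also have "\<dots> \<le> r * m" using i assms by (intro mult_right_mono) auto
      finally show "e mod m + i * m \<in> {c \<in> {0..<r * m}. c mod m = e mod m}" using i assms by simp
    qed
    show "(\<lambda>c. c div m) \<in> {c \<in> {0..<r * m}. c mod m = e mod m} \<rightarrow> {0..<r}"
    proof
      fix c assume c: "c \<in> {c \<in> {0..<r * m}. c mod m = e mod m}"
      have "c div m * m \<le> c" using assms by (simp add: pos_mod_sign minus_mod_eq_div_mult[symmetric])
      also have "c < r * m" using c by simp
      finally have "c div m < r" using assms by simp
      thus "c div m \<in> {0..<r}" using c assms by (simp add: pos_imp_zdiv_nonneg_iff)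
    qed
    show "(e mod m + i * m) div m = i" if "i \<in> {0..<r}" for i
      using assms by simp
    show "e mod m + (c div m) * m = c" if "c \<in> {c \<in> {0..<r * m}. c mod m = e mod m}" for c
      using that by (metis (mono_tags, lifting) mem_Collect_eq mod_div_mult_eq)
  qed
  hence "card {0..<r} = card {c \<in> {0..<r * m}. c mod m = e mod m}" by (rule bij_betw_same_card)
  thus ?thesis by simp
qed

context comm_group
begin

lemma chars_one:
  assumes "subgroup K G" "\<xi> \<in> chars G K n"
  shows "\<xi> \<one> = 0"
proof -
  have one: "\<one> \<in> K" using assms(1) by (rule subgroup.one_closed)
  have r: "0 \<le> \<xi> \<one>" "\<xi> \<one> < n" using assms(2) one by (auto simp: chars_def)
  have "\<xi> (\<one> \<otimes> \<one>) = (\<xi> \<one> + \<xi> \<one>) mod n" using assms(2) one unfolding chars_def by blast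
  hence "\<xi> \<one> mod n = (\<xi> \<one> + \<xi> \<one>) mod n" using r by simp
  hence "n dvd \<xi> \<one>" by (simp add: mod_eq_dvd_iff)
  thus ?thesis using r by (metis mod_pos_pos_trivial dvd_eq_mod_eq_0)
qed

lemma chars_pow:
  assumes "subgroup K G" "\<xi> \<in> chars G K n" "x \<in> K"
  shows "\<xi> (x [^] (m::nat)) = (int m * \<xi> x) mod n"
proof (induction m)
  case 0
  show ?case using chars_one[OF assms(1,2)] by simp
next
  case (Suc m)
  interpret K: subgroup K G by fact
  have "x [^] m \<in> K" using assms(3) by (induction m) auto
  hence "\<xi> (x [^] m \<otimes> x) = (\<xi> (x [^] m) + \<xi> x) mod n" using assms unfolding chars_def by blast
  thus ?case using Suc by (simp add: mod_simps algebra_simps)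
qed

text \<open>
  If \<open>r\<close> is the order of \<open>x\<close> modulo \<open>K\<close>, then \<open>K\<close> has index \<open>r\<close> in the subgroup generated
    by \<open>K\<close> and \<open>x\<close>,
  and a character of \<open>K\<close> extends to it in \<open>r\<close> ways, namely
    by the solutions \<open>c\<close> of \<open>r c = \<xi> (x^r)\<close> modulo \<open>n\<close>.
\<close>

lemma card_chars_extend:
  assumes fin: "finite (carrier G)" and K: "subgroup K G" and x: "x \<in> carrier G" "x \<notin> K"
    and n: "n > 0" "\<And>y. y \<in> carrier G \<Longrightarrow> y [^] n = \<one>"
    and IH: "card (chars G K (int n)) = card K"
  shows "\<exists>K'. subgroup K' G \<and> card K < card K' \<and> card (chars G K' (int n)) = card K'"
proof -
  interpret K: subgroup K G by fact
  have KG: "a \<in> carrier G" if "a \<in> K" for a using that K.subset by blast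
  define r where "r = (LEAST r::nat. r > 0 \<and> x [^] r \<in> K)"
  have "n > 0 \<and> x [^] n \<in> K" using n x by simp
  hence r: "r > 0 \<and> x [^] r \<in> K" unfolding r_def by (rule LeastI)
  have r_least: "r \<le> m" if "m > 0" "x [^] m \<in> K" for m
    unfolding r_def using that by (intro Least_le) simp
  have Kpow: "a [^] (m::nat) \<in> K" if "a \<in> K" for a m using that by (induction m) auto
  have r_dvd: "r dvd m" if "x [^] m \<in> K" for m :: nat
  proof -
    have "x [^] m = (x [^] r) [^] (m div r) \<otimes> x [^] (m mod r)"
      using x by (simp add: nat_pow_pow nat_pow_mult)
    hence "x [^] (m mod r) = inv ((x [^] r) [^] (m div r)) \<otimes> x [^] m"
      using x by (metis inv_solve_left nat_pow_closed)
    also have "\<dots> \<in> K" using that Kpow r by (intro K.m_closed K.m_inv_closed) auto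
    finally have "m mod r = 0" using r_least[of "m mod r"] r mod_less_divisor[of r m] by linarith
    thus ?thesis by auto
  qed
  define K' where "K' = {a \<otimes> x [^] j |a j. a \<in> K \<and> j \<in> (UNIV :: nat set)}"
  have K'_I: "a \<otimes> x [^] j \<in> K'" if "a \<in> K" for a and j :: nat unfolding K'_def using that by blast
  have prod: "(a \<otimes> x [^] i) \<otimes> (b \<otimes> x [^] j) = (a \<otimes> b) \<otimes> x [^] (i + j)"
    if "a \<in> K" "b \<in> K" for a b and i j :: nat
    using that x KG by (simp add: nat_pow_mult[symmetric] m_ac)
  have K'_G: "K' \<subseteq> carrier G" using x KG by (auto simp: K'_def)
  have K'_mult: "y \<otimes> z \<in> K'" if "y \<in> K'" "z \<in> K'" for y z
    using that prod K'_I K.m_closed unfolding K'_def by (smt (verit) mem_Collect_eq UNIV_I)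
  have sub: "subgroup K' G"
  proof (rule subgroupI)
    show "K' \<subseteq> carrier G" by fact
    show "K' \<noteq> {}" using K'_I[OF K.one_closed] by blast
    show "y \<otimes> z \<in> K'" if "y \<in> K'" "z \<in> K'" for y z using that by (rule K'_mult)
    show "inv y \<in> K'" if y: "y \<in> K'" for y
    proof -
      have yG: "y \<in> carrier G" using y K'_G by blast
      have *: "y [^] m \<in> K'" for m :: nat
      proof (induction m)
        case 0
        show ?case using K'_I[OF K.one_closed, of 0] by simp
      next
        case (Suc m)
        thus ?case using K'_mult y by simp
      qed
      have "y [^] (n - 1) \<otimes> y = \<one>" using n yG nat_pow_Suc[of y "n - 1"] by simp
      hence "inv y = y [^] (n - 1)" using yG by (intro inv_equality) auto
      thus ?thesis using *[of "n - 1"] by simp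
    qed
  qed
  have KK': "K \<subseteq> K'"
  proof
    fix a assume "a \<in> K"
    thus "a \<in> K'" using K'_I[of a 0] KG by simp
  qed
  have xK': "x \<in> K'" using K'_I[OF K.one_closed, of 1] x by simp
  have finK': "finite K'" using K'_G fin finite_subset by blast
  have finK: "finite K" using KK' finK' finite_subset by blast

  \<comment> \<open>Two expressions of one element have exponents differing by a multiple of r, and
    the surplus power of x lies in K. This serves both the injectivity of the parametrization of K'
    and the consistency of an extended character.\<close>
  have eqD: "\<exists>m. j = i + r * m \<and> a = b \<otimes> (x [^] r) [^] m"
    if "a \<in> K" "b \<in> K" "a \<otimes> x [^] i = b \<otimes> x [^] j" "i \<le> j" for a b and i j :: nat
  proof -
    have "a \<otimes> x [^] i = b \<otimes> x [^] (j - i) \<otimes> x [^] i"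
      using that x KG by (simp add: m_assoc nat_pow_mult)
    hence eq: "a = b \<otimes> x [^] (j - i)"
      using that(1,2) x KG using right_cancel[of "x [^] i" a "b \<otimes> x [^] (j - i)"] by simp
    hence "x [^] (j - i) = inv b \<otimes> a" using that(1,2) x KG by (metis inv_solve_left nat_pow_closed)
    hence "x [^] (j - i) \<in> K" using that by simp
    hence "r dvd j - i" by (rule r_dvd)
    then obtain m where "j - i = r * m" by blast
    thus ?thesis using eq that(4) x by (intro exI[of _ m]) (simp add: nat_pow_pow)
  qed

  have "bij_betw (\<lambda>(a, j). a \<otimes> x [^] j) (K \<times> {..<r}) K'"
    unfolding bij_betw_def
  proof
    have inj: "a = b \<and> i = j"
      if ab: "a \<in> K" "b \<in> K" "a \<otimes> x [^] i = b \<otimes> x [^] j" "i \<le> j" and jr: "j < r" for a b and i j :: nat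
    proof -
      obtain m where m: "j = i + r * m" "a = b \<otimes> (x [^] r) [^] m" using eqD[OF ab] by blast
      hence "m = 0" using jr by (cases m) auto
      thus ?thesis using m KG ab by simp
    qed
    show "inj_on (\<lambda>(a, j). a \<otimes> x [^] j) (K \<times> {..<r})"
    proof (rule inj_onI, clarify)
      fix a b and i j :: nat
      assume "a \<in> K" "b \<in> K" "i < r" "j < r" "a \<otimes> x [^] i = b \<otimes> x [^] j"
      thus "a = b \<and> i = j" using inj[of a b i j] inj[of b a j i] by (cases "i \<le> j") auto
    qed
    have "y \<in> (\<lambda>(a, j). a \<otimes> x [^] j) ` (K \<times> {..<r})" if "y \<in> K'" for y
    proof -
      obtain a and j :: nat where y: "y = a \<otimes> x [^] j" "a \<in> K" using \<open>y \<in> K'\<close> unfolding K'_def by blast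
      have "x [^] j = (x [^] r) [^] (j div r) \<otimes> x [^] (j mod r)"
        using x by (simp add: nat_pow_pow nat_pow_mult)
      hence "y = (a \<otimes> (x [^] r) [^] (j div r)) \<otimes> x [^] (j mod r)"
        using y x KG by (simp add: m_assoc)
      moreover have "a \<otimes> (x [^] r) [^] (j div r) \<in> K" using y r Kpow by simp
      moreover have "j mod r < r" using r by simp
      ultimately show ?thesis by force
    qed
    thus "(\<lambda>(a, j). a \<otimes> x [^] j) ` (K \<times> {..<r}) = K'" using K'_I by auto
  qed
  hence "card (K \<times> {..<r}) = card K'" by (rule bij_betw_same_card)
  hence cardK': "card K' = card K * r" by (simp add: card_cartesian_product)

  obtain m where m: "n = r * m" using r_dvd[of n] n x by auto
  have m_pos: "m > 0" using m n by (cases m) auto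
  define S where "S \<xi> = {c \<in> {0..<int n}. (int r * c) mod int n = \<xi> (x [^] r)}" for \<xi>
  have cardS: "card (S \<xi>) = r" if \<xi>: "\<xi> \<in> chars G K (int n)" for \<xi>
  proof -
    define d where "d = \<xi> (x [^] r)"
    have d: "0 \<le> d" "d < int n" using \<xi> r by (auto simp: d_def chars_def)
    have "\<xi> ((x [^] r) [^] m) = (int m * d) mod int n"
      unfolding d_def using r by (intro chars_pow[OF K \<xi>]) auto
    moreover have "(x [^] r) [^] m = \<one>" using x n(2)[OF x(1)] by (simp add: nat_pow_pow m)
    \<comment> \<open>Since x^(r m) = 1, the prescribed value d = \<xi>(x^r) must be divisible by r;
      this is the solvability of r c = d modulo r m.\<close>
    ultimately have "(int m * d) mod int n = 0" using chars_one[OF K \<xi>] by simp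
    hence "int m * int r dvd int m * d" using m by (simp add: mult.commute dvd_eq_mod_eq_0)
    hence "int r dvd d" using m_pos by simp
    then obtain e where e: "d = int r * e" by blast
    have "(int r * c) mod int n = d \<longleftrightarrow> c mod int m = e mod int m" for c
    proof -
      have "(int r * c) mod int n = d \<longleftrightarrow> (int r * c) mod (int r * int m)
          = (int r * e) mod (int r * int m)"
        using d e m by simp
      also have "\<dots> \<longleftrightarrow> c mod int m = e mod int m" using r by (simp add: mult_mod_right[symmetric])
      finally show ?thesis .
    qed
    hence "S \<xi> = {c \<in> {0..<int r * int m}. c mod int m = e mod int m}"
      unfolding S_def d_def[symmetric] by (auto simp: m)
    thus ?thesis using card_residue_class[of "int r" "int m" e] r m_pos by simp
  qed

  have "bij_betw (\<lambda>\<xi>. (restrict \<xi> K, \<xi> x)) (chars G K' (int n)) (Sigma (chars G K (int n)) S)"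
    unfolding bij_betw_def
  proof
    have val: "\<xi> (a \<otimes> x [^] j) = (\<xi> a + int j * \<xi> x) mod int n"
      if \<xi>: "\<xi> \<in> chars G K' (int n)" and a: "a \<in> K" for \<xi> a and j :: nat
    proof -
      have "x [^] j \<in> K'" using K'_I[OF K.one_closed, of j] x by simp
      hence "\<xi> (a \<otimes> x [^] j) = (\<xi> a + \<xi> (x [^] j)) mod int n"
        using \<xi> KK' a unfolding chars_def by blast
      thus ?thesis using chars_pow[OF sub \<xi> xK', of j] by (simp add: mod_simps)
    qed
    show "inj_on (\<lambda>\<xi>. (restrict \<xi> K, \<xi> x)) (chars G K' (int n))"
    proof (rule inj_onI)
      fix \<xi> \<psi> assume \<xi>: "\<xi> \<in> chars G K' (int n)" and \<psi>: "\<psi> \<in> chars G K' (int n)"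
        and eq: "(restrict \<xi> K, \<xi> x) = (restrict \<psi> K, \<psi> x)"
      have "\<xi> y = \<psi> y" if y: "y \<in> K'" for y
      proof -
        obtain a and j :: nat where aj: "y = a \<otimes> x [^] j" "a \<in> K" using y unfolding K'_def by blast
        have "\<xi> a = \<psi> a" using eq aj(2) by (metis prod.inject restrict_apply')
        thus ?thesis using val[OF \<xi> aj(2), of j] val[OF \<psi> aj(2), of j] eq aj by simp
      qed
      moreover have "\<xi> \<in> extensional K'" "\<psi> \<in> extensional K'"
        using \<xi> \<psi> by (auto simp: chars_def PiE_def)
      ultimately show "\<xi> = \<psi>" by (metis extensionalityI)
    qed
    show "(\<lambda>\<xi>. (restrict \<xi> K, \<xi> x)) ` chars G K' (int n) = Sigma (chars G K (int n)) S"
    proof (intro equalityI subsetI)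
      fix y assume "y \<in> (\<lambda>\<xi>. (restrict \<xi> K, \<xi> x)) ` chars G K' (int n)"
      then obtain \<xi> where \<xi>: "\<xi> \<in> chars G K' (int n)" "y = (restrict \<xi> K, \<xi> x)" by blast
      have "restrict \<xi> K \<in> chars G K (int n)"
        using \<xi>(1) KK' unfolding chars_def by (auto simp: PiE_def Pi_def)
      moreover have "\<xi> x \<in> S (restrict \<xi> K)"
        using \<xi>(1) xK' chars_pow[OF sub \<xi>(1) xK', of r] r unfolding S_def chars_def by auto
      ultimately show "y \<in> Sigma (chars G K (int n)) S" using \<xi> by simp
    next
      fix y assume "y \<in> Sigma (chars G K (int n)) S"
      then obtain \<xi> c where y: "y = (\<xi>, c)" and \<xi>: "\<xi> \<in> chars G K (int n)" and c: "c \<in> S \<xi>" by blast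
      have c': "0 \<le> c" "c < int n" "(int r * c) mod int n = \<xi> (x [^] r)" using c by (auto simp: S_def)
      have \<xi>K: "0 \<le> \<xi> a \<and> \<xi> a < int n" if "a \<in> K" for a using \<xi> that by (auto simp: chars_def)
      have \<xi>m: "\<xi> (a \<otimes> b) = (\<xi> a + \<xi> b) mod int n" if "a \<in> K" "b \<in> K" for a b
        using \<xi> that by (auto simp: chars_def)
      have wd1: "(\<xi> a + int i * c) mod int n = (\<xi> b + int j * c) mod int n"
        if ab: "a \<in> K" "b \<in> K" "a \<otimes> x [^] i = b \<otimes> x [^] j" "i \<le> j" for a b and i j :: nat
      proof -
        obtain l where l: "j = i + r * l" "a = b \<otimes> (x [^] r) [^] l" using eqD[OF ab] by blast
        have "\<xi> a = (\<xi> b + \<xi> ((x [^] r) [^] l)) mod int n"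
          unfolding l(2) using ab r Kpow by (intro \<xi>m) auto
        also have "\<xi> ((x [^] r) [^] l) = (int l * ((int r * c) mod int n)) mod int n"
          using chars_pow[OF K \<xi>] r c'(3) by simp
        finally have "\<xi> a = (\<xi> b + int l * (int r * c)) mod int n" by (simp add: mod_simps)
        thus ?thesis unfolding l(1) by (simp add: mod_simps algebra_simps)
      qed
      have wd: "(\<xi> a + int i * c) mod int n = (\<xi> b + int j * c) mod int n"
        if "a \<in> K" "b \<in> K" "a \<otimes> x [^] i = b \<otimes> x [^] j" for a b and i j :: nat
        using wd1[of a b i j] wd1[of b a j i] that by (cases "i \<le> j") auto
      \<comment> \<open>An arbitrary representation of y is chosen; \<open>wd\<close> makes the
        value independent of the choice.\<close>
      define \<psi> where "\<psi> = (\<lambda>y\<in>K'. case (SOME (a, j). a \<in> K \<and> y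
          = a \<otimes> x [^] j) of (a, j) \<Rightarrow> (\<xi> a + int (j::nat) * c) mod int n)"
      have \<psi>: "\<psi> (a \<otimes> x [^] j) = (\<xi> a + int j * c) mod int n" if a: "a \<in> K" for a and j :: nat
      proof -
        define w where "w = (SOME (b, i). b \<in> K \<and> a \<otimes> x [^] j = b \<otimes> x [^] (i::nat))"
        have "case w of (b, i) \<Rightarrow> b \<in> K \<and> a \<otimes> x [^] j = b \<otimes> x [^] (i::nat)"
          unfolding w_def by (rule someI[of _ "(a, j)"]) (use a in simp)
        then obtain b i where w: "w = (b, i)" "b \<in> K" "a \<otimes> x [^] j = b \<otimes> x [^] (i::nat)" by auto
        have "\<psi> (a \<otimes> x [^] j) = (\<xi> b + int i * c) mod int n"
          unfolding \<psi>_def using K'_I[OF a] w(1) unfolding w_def by simp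
        thus ?thesis using wd[OF a w(2,3)] by simp
      qed
      have "\<psi> \<in> chars G K' (int n)"
        unfolding chars_def
      proof (intro CollectI conjI ballI)
        have "\<psi> y \<in> {0..<int n}" if "y \<in> K'" for y
          using that \<psi> n unfolding K'_def by auto
        thus "\<psi> \<in> K' \<rightarrow>\<^sub>E {0..<int n}" by (auto simp: \<psi>_def)
        fix y z assume "y \<in> K'" "z \<in> K'"
        then obtain a i b j where *: "y = a \<otimes> x [^] (i::nat)" "a \<in> K" "z = b \<otimes> x [^] (j::nat)" "b \<in> K"
          unfolding K'_def by blast
        hence "\<psi> (y \<otimes> z) = (\<xi> (a \<otimes> b) + int (i + j) * c) mod int n" using prod[of a b i j] \<psi> by simp
        also have "\<dots> = (\<xi> a + \<xi> b + int (i + j) * c) mod int n" using * \<xi>m by (simp add: mod_simps)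
        also have "\<dots> = ((\<xi> a + int i * c) + (\<xi> b + int j * c)) mod int n" by (simp add: algebra_simps)
        also have "\<dots> = (\<psi> y + \<psi> z) mod int n" using * \<psi> by (simp add: mod_simps)
        finally show "\<psi> (y \<otimes> z) = (\<psi> y + \<psi> z) mod int n" .
      qed
      moreover have "restrict \<psi> K = \<xi>"
      proof (rule extensionalityI[of _ K])
        show "\<xi> \<in> extensional K" using \<xi> by (auto simp: chars_def PiE_def)
        fix a assume a: "a \<in> K"
        show "restrict \<psi> K a = \<xi> a" using \<psi>[OF a, of 0] a KG \<xi>K[OF a] by simp
      qed simp
      moreover have "\<psi> x = c" using \<psi>[OF K.one_closed, of 1] x c' chars_one[OF K \<xi>] by simp
      ultimately show "y \<in> (\<lambda>\<xi>. (restrict \<xi> K, \<xi> x)) ` chars G K' (int n)" unfolding y by force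
    qed
  qed
  hence "card (chars G K' (int n)) = card (Sigma (chars G K (int n)) S)" by (rule bij_betw_same_card)
  also have "\<dots> = (\<Sum>\<xi>\<in>chars G K (int n). card (S \<xi>))"
  proof (rule card_SigmaI)
    have "chars G K (int n) \<subseteq> K \<rightarrow>\<^sub>E {0..<int n}" by (auto simp: chars_def)
    thus "finite (chars G K (int n))" by (rule finite_subset) (simp add: finite_PiE finK)
    show "\<forall>\<xi>\<in>chars G K (int n). finite (S \<xi>)"
      unfolding S_def by (intro ballI finite_subset[OF Collect_restrict] finite_atLeastLessThan_int)
  qed
  also have "\<dots> = card K'" using cardS IH cardK' by simp
  finally have "card (chars G K' (int n)) = card K'" .
  moreover have "card K < card K'" using KK' xK' x(2) finK' by (intro psubset_card_mono) auto
  ultimately show ?thesis using sub by blast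
qed

text \<open>Among the subgroups with as many characters as elements, the trivial one being an
  example, a largest must be G, since \<open>card_chars_extend\<close> enlarges any proper
  one.\<close>

theorem card_chars:
  assumes fin: "finite (carrier G)" and n: "n > 0" "\<And>y. y \<in> carrier G \<Longrightarrow> y [^] n = \<one>"
  shows "card (chars G (carrier G) (int n)) = order G"
proof -
  define P where "P K \<longleftrightarrow> subgroup K G \<and> card (chars G K (int n)) = card K" for K
  have "chars G {\<one>} (int n) = {\<lambda>x\<in>{\<one>}. 0}"
  proof
    show "chars G {\<one>} (int n) \<subseteq> {\<lambda>x\<in>{\<one>}. 0}"
    proof
      fix \<xi> assume \<xi>: "\<xi> \<in> chars G {\<one>} (int n)"
      have "\<xi> = (\<lambda>x\<in>{\<one>}. 0)"
        by (rule extensionalityI[of _ "{\<one>}"])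
          (use \<xi> chars_one[OF triv_subgroup \<xi>] in \<open>auto simp: chars_def PiE_def\<close>)
      thus "\<xi> \<in> {\<lambda>x\<in>{\<one>}. 0}" by simp
    qed
    show "{\<lambda>x\<in>{\<one>}. 0} \<subseteq> chars G {\<one>} (int n)" using n by (auto simp: chars_def)
  qed
  hence "P {\<one>}" unfolding P_def using triv_subgroup by simp
  moreover have "\<forall>K. P K \<longrightarrow> card K < Suc (order G)"
    unfolding P_def order_def using fin subgroup.subset card_mono by (metis less_Suc_eq_le)
  ultimately obtain K where K: "P K" "\<And>K'. P K' \<Longrightarrow> card K' \<le> card K"
    using ex_has_greatest_nat[of P "{\<one>}" card "Suc (order G)"] by (metis less_imp_le)
  have "K = carrier G"
  proof (rule ccontr)
    assume "K \<noteq> carrier G"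
    moreover have sub: "subgroup K G" using K by (simp add: P_def)
    ultimately obtain x where "x \<in> carrier G" "x \<notin> K" using subgroup.subset by blast
    then obtain K' where "subgroup K' G" "card K < card K'" "card (chars G K' (int n)) = card K'"
      using card_chars_extend[OF fin sub _ _ n] K(1) unfolding P_def by metis
    thus False using K(2)[of K'] unfolding P_def by simp
  qed
  thus ?thesis using K(1) by (simp add: P_def order_def)
qed

end

section \<open>Extensions and characters\<close>

text \<open>
  The extension with inclusion \<open>z \<mapsto> z h\<close> and projection \<open>q\<close>. It is kept apart from
  \<^const>\<open>extensions\<close> so that the middle term may have elements of any type.
\<close>

definition ext_pair :: "nat \<Rightarrow> 'g monoid \<Rightarrow> (padic, 'a) module \<Rightarrow> 'a \<Rightarrow> ('a \<Rightarrow> 'g) \<Rightarrow> bool"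
  where "ext_pair p G M h q \<longleftrightarrow>
    h \<in> carrier M \<and> (\<forall>z\<in>carrier (Zp p). z \<odot>\<^bsub>M\<^esub> h = \<zero>\<^bsub>M\<^esub> \<longrightarrow> z = \<zero>\<^bsub>Zp p\<^esub>) \<and> q \<in> hom (add_monoid M) G
        \<and> q ` carrier M = carrier G \<and>
    (\<forall>e\<in>carrier M. q e = \<one>\<^bsub>G\<^esub> \<longleftrightarrow> (\<exists>z\<in>carrier (Zp p). e = z \<odot>\<^bsub>M\<^esub> h))"

text \<open>Every lift e and every z with p^k e = z h constrains \<xi>, no lift being chosen. The
  existence of such a \<xi> is therefore the independence of lifts.\<close>

definition is_char :: "nat \<Rightarrow> nat \<Rightarrow> (padic, 'a) module \<Rightarrow> 'a \<Rightarrow> ('a \<Rightarrow> 'g) \<Rightarrow> ('g \<Rightarrow> int) \<Rightarrow> bool"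
  where "is_char p k M h q \<xi> \<longleftrightarrow>
    (\<forall>e\<in>carrier M. \<forall>z\<in>carrier (Zp p). padic_of_int p (int p ^ k) \<odot>\<^bsub>M\<^esub> e = z \<odot>\<^bsub>M\<^esub> h \<longrightarrow> \<xi> (q e) = z k)"

text \<open>
  The graph of the unique equivalence of two extensions with the same character: in both middle terms
  an element is determined by its image in \<open>G\<close> and its multiple by \<open>p^k\<close>.
\<close>

definition ext_rel ::
    "nat \<Rightarrow> nat \<Rightarrow> (padic, 'a) module \<Rightarrow> 'a \<Rightarrow> ('a \<Rightarrow> 'g) \<Rightarrow> (padic, 'b) module \<Rightarrow> 'b \<Rightarrow> ('b \<Rightarrow> 'g) \<Rightarrow> 'a \<Rightarrow> 'b
        \<Rightarrow> bool"
  where "ext_rel p k M h q M' h' q' e e' \<longleftrightarrow>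
    e \<in> carrier M \<and> e' \<in> carrier M' \<and> q' e' = q e \<and>
    (\<exists>z\<in>carrier (Zp p). padic_of_int p (int p ^ k) \<odot>\<^bsub>M\<^esub> e = z \<odot>\<^bsub>M\<^esub> h \<and>
       padic_of_int p (int p ^ k) \<odot>\<^bsub>M'\<^esub> e' = z \<odot>\<^bsub>M'\<^esub> h')"

lemma ext_rel_sym: "ext_rel p k M h q M' h' q' e e' \<Longrightarrow> ext_rel p k M' h' q' M h q e' e"
  unfolding ext_rel_def by auto

section \<open>The character of an extension as a complete invariant\<close>

locale p_group = padic_prime p + G: comm_group G for p and G :: "'g monoid" +
  fixes k :: nat
  assumes finG: "finite (carrier G)" and ordG: "order G = p ^ k"
begin

lemma pow_pk: "y \<in> carrier G \<Longrightarrow> y [^]\<^bsub>G\<^esub> (p ^ k) = \<one>\<^bsub>G\<^esub>"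
  using G.pow_order_eq_1[of y] ordG by simp

lemma card_charsG: "card (chars G (carrier G) (int p ^ k)) = p ^ k"
  using G.card_chars[OF finG, of "p ^ k"] pow_pk ordG p_gt_1 by simp

context
  fixes M :: "(padic, 'a) module" and h q
  assumes M: "Zp_module p M" and ext: "ext_pair p G M h q"
begin

interpretation M: Zp_module p M by (rule M)

lemma ext_hM: "h \<in> carrier M" and ext_nontorsion: "M.nontorsion h"
  using ext by (auto simp: ext_pair_def M.nontorsion_def)

lemma ext_q_closed: "e \<in> carrier M \<Longrightarrow> q e \<in> carrier G"
  using ext by (auto simp: ext_pair_def)

lemma ext_q_add: "e \<in> carrier M \<Longrightarrow> f \<in> carrier M \<Longrightarrow> q (e \<oplus>\<^bsub>M\<^esub> f) = q e \<otimes>\<^bsub>G\<^esub> q f"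
  using ext by (auto simp: ext_pair_def hom_def)

lemma ext_q_surj:
  assumes "y \<in> carrier G"
  shows "\<exists>e\<in>carrier M. q e = y"
proof -
  have "y \<in> q ` carrier M" using ext assms by (simp add: ext_pair_def)
  thus ?thesis by blast
qed

lemma ext_q_ker: "e \<in> carrier M \<Longrightarrow> q e = \<one>\<^bsub>G\<^esub> \<longleftrightarrow> (\<exists>z\<in>carrier (Zp p). e = z \<odot>\<^bsub>M\<^esub> h)"
  using ext by (auto simp: ext_pair_def)

lemma ext_q_zero: "q \<zero>\<^bsub>M\<^esub> = \<one>\<^bsub>G\<^esub>"
  using ext_q_ker[of "\<zero>\<^bsub>M\<^esub>"] M.smult_l_null[OF ext_hM] by (metis M.zero_closed Zp.zero_closed)

lemma ext_q_nat_smult: "e \<in> carrier M \<Longrightarrow> q (padic_of_int p (int n) \<odot>\<^bsub>M\<^esub> e) = q e [^]\<^bsub>G\<^esub> n"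
proof (induction n)
  case 0
  thus ?case using M.smult_l_null[of e] Zp_zero_conv ext_q_zero by simp
next
  case (Suc n)
  have "padic_of_int p (int (Suc n)) \<odot>\<^bsub>M\<^esub> e = padic_of_int p (int n) \<odot>\<^bsub>M\<^esub> e \<oplus>\<^bsub>M\<^esub> e"
    using Suc.prems M.smult_l_distr[of "padic_of_int p (int n)" "padic_of_int p 1" e]
      M.smult_one[of e, unfolded Zp_one_conv]
    by (simp add: padic_of_int_add[symmetric] add.commute)
  thus ?case using Suc by (simp add: ext_q_add)
qed

text \<open>A scalar is an integer plus a multiple of p^k, and p^k kills G, so additivity of q
  already yields compatibility with scalars. Hence \<open>ext_pair\<close> asks only for a group
  homomorphism.\<close>

lemma ext_q_smult:
  assumes "e \<in> carrier M" "a \<in> carrier (Zp p)"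
  shows "q (a \<odot>\<^bsub>M\<^esub> e) = q e [^]\<^bsub>G\<^esub> nat (a k)"
proof -
  obtain b where b: "b \<in> carrier (Zp p)" "a = padic_of_int p (a k) \<boxplus> pw k \<boxtimes> b"
    using Zp_pw_split[OF assms(2)] by blast
  have "a \<odot>\<^bsub>M\<^esub> e = padic_of_int p (a k) \<odot>\<^bsub>M\<^esub> e \<oplus>\<^bsub>M\<^esub> pw k \<odot>\<^bsub>M\<^esub> (b \<odot>\<^bsub>M\<^esub> e)"
    using assms b(1) by (subst b(2)) (simp add: M.smult_l_distr M.smult_assoc1)
  moreover have "a k = int (nat (a k))" using assms by (simp add: Zp_carrier_iff)
  ultimately have "a \<odot>\<^bsub>M\<^esub> e
      = padic_of_int p (int (nat (a k))) \<odot>\<^bsub>M\<^esub> e \<oplus>\<^bsub>M\<^esub> padic_of_int p (int (p ^ k)) \<odot>\<^bsub>M\<^esub> (b \<odot>\<^bsub>M\<^esub> e)"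
    by simp
  hence "q (a \<odot>\<^bsub>M\<^esub> e) = q e [^]\<^bsub>G\<^esub> nat (a k) \<otimes>\<^bsub>G\<^esub> q (b \<odot>\<^bsub>M\<^esub> e) [^]\<^bsub>G\<^esub> (p ^ k)"
    using assms b(1) ext_q_nat_smult[of e "nat (a k)"] ext_q_nat_smult[of "b \<odot>\<^bsub>M\<^esub> e" "p ^ k"]
      ext_q_add[of "padic_of_int p (int (nat (a k))) \<odot>\<^bsub>M\<^esub> e" "padic_of_int p (int (p ^ k)) \<odot>\<^bsub>M\<^esub> (b \<odot>\<^bsub>M\<^esub> e)"]
    by (metis M.smult_closed padic_of_int_closed)
  thus ?thesis using pow_pk assms b(1) ext_q_closed by simp
qed

lemma ext_pw:
  assumes "e \<in> carrier M"
  shows "\<exists>z\<in>carrier (Zp p). pw k \<odot>\<^bsub>M\<^esub> e = z \<odot>\<^bsub>M\<^esub> h"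
proof -
  have "pw k k = 0" by (simp add: padic_of_int_def)
  hence "q (pw k \<odot>\<^bsub>M\<^esub> e) = \<one>\<^bsub>G\<^esub>" using ext_q_smult[OF assms, of "pw k"] by simp
  thus ?thesis using ext_q_ker[of "pw k \<odot>\<^bsub>M\<^esub> e"] assms by simp
qed

lemma ext_diff:
  assumes "e \<in> carrier M" "f \<in> carrier M" "q e = q f"
  shows "\<exists>w\<in>carrier (Zp p). e = f \<oplus>\<^bsub>M\<^esub> w \<odot>\<^bsub>M\<^esub> h"
proof -
  have e: "e = f \<oplus>\<^bsub>M\<^esub> (e \<ominus>\<^bsub>M\<^esub> f)" using M.minus_eqD[OF assms(1,2) refl] .
  hence "q f = q f \<otimes>\<^bsub>G\<^esub> q (e \<ominus>\<^bsub>M\<^esub> f)" using ext_q_add[of f "e \<ominus>\<^bsub>M\<^esub> f"] assms by simp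
  hence "q (e \<ominus>\<^bsub>M\<^esub> f) = \<one>\<^bsub>G\<^esub>" using assms ext_q_closed by simp
  thus ?thesis using ext_q_ker[of "e \<ominus>\<^bsub>M\<^esub> f"] assms e by auto
qed

lemma pw_smult_nth: "w \<in> carrier (Zp p) \<Longrightarrow> (pw k \<boxtimes> w) k = 0"
  by (simp add: Zp_nth_pw_mult)

text \<open>Two lifts of one element differ by some w h, which changes z by p^k w and leaves its
  residue modulo p^k alone.\<close>

lemma ext_char_unique_val:
  assumes "e \<in> carrier M" "f \<in> carrier M" "q e = q f" "z \<in> carrier (Zp p)" "z' \<in> carrier (Zp p)"
      "pw k \<odot>\<^bsub>M\<^esub> e = z \<odot>\<^bsub>M\<^esub> h" "pw k \<odot>\<^bsub>M\<^esub> f = z' \<odot>\<^bsub>M\<^esub> h"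
  shows "z k = z' k"
proof -
  obtain w where w: "w \<in> carrier (Zp p)" "e = f \<oplus>\<^bsub>M\<^esub> w \<odot>\<^bsub>M\<^esub> h" using ext_diff assms by blast
  have "z \<odot>\<^bsub>M\<^esub> h = pw k \<odot>\<^bsub>M\<^esub> f \<oplus>\<^bsub>M\<^esub> pw k \<odot>\<^bsub>M\<^esub> (w \<odot>\<^bsub>M\<^esub> h)"
    unfolding assms(6)[symmetric] w(2) using w(1) assms(2) ext_hM by (simp add: M.smult_r_distr)
  also have "\<dots> = (z' \<boxplus> pw k \<boxtimes> w) \<odot>\<^bsub>M\<^esub> h"
    using assms w(1) ext_hM by (simp add: M.smult_l_distr M.smult_assoc1)
  finally have "z = z' \<boxplus> pw k \<boxtimes> w"
    using assms w(1) by (intro M.nontorsion_cancel[OF ext_nontorsion]) auto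
  thus ?thesis using pw_smult_nth[OF w(1)] assms(5) by (simp add: Zp_simps(3))
qed

lemma ext_char_exists: "\<exists>\<xi>\<in>chars G (carrier G) (int p ^ k). is_char p k M h q \<xi>"
proof -
  have "\<exists>c. \<forall>e\<in>carrier M. \<forall>z\<in>carrier (Zp p). q e = y \<longrightarrow> pw k \<odot>\<^bsub>M\<^esub> e = z \<odot>\<^bsub>M\<^esub> h \<longrightarrow> z k = c"
      if y: "y \<in> carrier G" for y
  proof -
    obtain e where e: "e \<in> carrier M" "q e = y" using ext_q_surj[OF y] by blast
    obtain z where z: "z \<in> carrier (Zp p)" "pw k \<odot>\<^bsub>M\<^esub> e = z \<odot>\<^bsub>M\<^esub> h" using ext_pw e by blast
    show ?thesis using ext_char_unique_val[OF _ e(1) _ _ z(1) _ z(2)] e by metis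
  qed
  then obtain f where f: "\<And>y e z. y \<in> carrier G \<Longrightarrow> e \<in> carrier M \<Longrightarrow> z \<in> carrier (Zp p) \<Longrightarrow> q e = y
      \<Longrightarrow> pw k \<odot>\<^bsub>M\<^esub> e = z \<odot>\<^bsub>M\<^esub> h \<Longrightarrow> z k = f y"
    by metis
  define \<xi> where "\<xi> = restrict f (carrier G)"
  have \<xi>: "\<xi> (q e) = z k" if "e \<in> carrier M" "z \<in> carrier (Zp p)" "pw k \<odot>\<^bsub>M\<^esub> e = z \<odot>\<^bsub>M\<^esub> h" for e z
    using f[OF ext_q_closed that(1,2) refl that(3)] that ext_q_closed by (simp add: \<xi>_def)
  have "\<xi> \<in> chars G (carrier G) (int p ^ k)"
    unfolding chars_def
  proof (intro CollectI conjI ballI)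
    have "\<xi> y \<in> {0..<int p ^ k}" if y: "y \<in> carrier G" for y
    proof -
      obtain e where e: "e \<in> carrier M" "q e = y" using ext_q_surj[OF y] by blast
      obtain z where z: "z \<in> carrier (Zp p)" "pw k \<odot>\<^bsub>M\<^esub> e = z \<odot>\<^bsub>M\<^esub> h" using ext_pw e by blast
      show ?thesis using \<xi>[OF e(1) z] z e by (simp add: Zp_carrier_iff)
    qed
    thus "\<xi> \<in> carrier G \<rightarrow>\<^sub>E {0..<int p ^ k}" by (auto simp: \<xi>_def)
    fix x y assume "x \<in> carrier G" "y \<in> carrier G"
    then obtain e f where ef: "e \<in> carrier M" "q e = x" "f \<in> carrier M" "q f = y"
      using ext_q_surj by metis
    obtain z where z: "z \<in> carrier (Zp p)" "pw k \<odot>\<^bsub>M\<^esub> e = z \<odot>\<^bsub>M\<^esub> h" using ext_pw ef by blast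
    obtain w where w: "w \<in> carrier (Zp p)" "pw k \<odot>\<^bsub>M\<^esub> f = w \<odot>\<^bsub>M\<^esub> h" using ext_pw ef by blast
    have "pw k \<odot>\<^bsub>M\<^esub> (e \<oplus>\<^bsub>M\<^esub> f) = (z \<boxplus> w) \<odot>\<^bsub>M\<^esub> h"
      using z w ef ext_hM by (simp add: M.smult_r_distr M.smult_l_distr)
    hence "\<xi> (q (e \<oplus>\<^bsub>M\<^esub> f)) = (z \<boxplus> w) k" using z w ef by (intro \<xi>) auto
    thus "\<xi> (x \<otimes>\<^bsub>G\<^esub> y) = (\<xi> x + \<xi> y) mod int p ^ k"
      using ef \<xi>[OF ef(1) z] \<xi>[OF ef(3) w] by (simp add: ext_q_add Zp_simps(3))
  qed
  thus ?thesis using \<xi> unfolding is_char_def by blast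
qed

lemma ext_char_unique:
  assumes "\<xi> \<in> chars G (carrier G) (int p ^ k)" "\<xi>' \<in> chars G (carrier G) (int p ^ k)"
    "is_char p k M h q \<xi>" "is_char p k M h q \<xi>'"
  shows "\<xi> = \<xi>'"
proof (rule extensionalityI[of _ "carrier G"])
  show "\<xi> \<in> extensional (carrier G)" "\<xi>' \<in> extensional (carrier G)"
    using assms by (auto simp: chars_def PiE_def)
  fix y assume "y \<in> carrier G"
  then obtain e where e: "e \<in> carrier M" "q e = y" using ext_q_surj by blast
  obtain z where z: "z \<in> carrier (Zp p)" "pw k \<odot>\<^bsub>M\<^esub> e = z \<odot>\<^bsub>M\<^esub> h" using ext_pw e by blast
  show "\<xi> y = \<xi>' y" using assms(3,4) e z unfolding is_char_def by metis
qed

end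

text \<open>Existence: any lift f of q e has p^k f = z' h' with z' congruent to z modulo p^k,
  because the characters agree; adding w h' with z - z' = p^k w corrects f. Uniqueness: two
  candidates differ by some v h' with p^k v = 0.\<close>

lemma ext_rel_ex1:
  assumes M: "Zp_module p M" and M': "Zp_module p M'"
    and ext: "ext_pair p G M h q" and ext': "ext_pair p G M' h' q'"
    and ch: "is_char p k M h q \<xi>" "is_char p k M' h' q' \<xi>" and e: "e \<in> carrier M"
  shows "\<exists>!e'. ext_rel p k M h q M' h' q' e e'"
proof -
  interpret M: Zp_module p M by (rule M)
  interpret M': Zp_module p M' by (rule M')
  note E = M ext and E' = M' ext'
  obtain z where z: "z \<in> carrier (Zp p)" "pw k \<odot>\<^bsub>M\<^esub> e = z \<odot>\<^bsub>M\<^esub> h" using ext_pw[OF E e] by blast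
  obtain f where f: "f \<in> carrier M'" "q' f = q e" using ext_q_surj[OF E'] ext_q_closed[OF E e] by blast
  obtain z' where z': "z' \<in> carrier (Zp p)" "pw k \<odot>\<^bsub>M'\<^esub> f = z' \<odot>\<^bsub>M'\<^esub> h'" using ext_pw[OF E' f(1)] by blast
  have "z k = z' k" using ch z z' e f unfolding is_char_def by metis
  hence "(z \<ominus>\<^bsub>Zp p\<^esub> z') k = 0"
  proof -
    have "(z \<ominus>\<^bsub>Zp p\<^esub> z') \<boxplus> z' = z" using z(1) z'(1) by (simp add: a_minus_def Zp.a_assoc Zp.l_neg)
    hence "((z \<ominus>\<^bsub>Zp p\<^esub> z') \<boxplus> z') k = z k" by simp
    hence "((z \<ominus>\<^bsub>Zp p\<^esub> z') k + z' k) mod int p ^ k = (0 + z' k) mod int p ^ k"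
      using \<open>z k = z' k\<close> z'(1) by (simp add: Zp_simps(3))
    hence "((z \<ominus>\<^bsub>Zp p\<^esub> z') k) mod int p ^ k = 0" by (simp add: mod_eq_dvd_iff dvd_eq_mod_eq_0)
    moreover have "z \<ominus>\<^bsub>Zp p\<^esub> z' \<in> carrier (Zp p)" using z(1) z'(1) by simp
    ultimately show ?thesis using Zp_nth_mod_self by simp
  qed
  then obtain w where w: "w \<in> carrier (Zp p)" "z \<ominus>\<^bsub>Zp p\<^esub> z' = pw k \<boxtimes> w"
    using Zp_pw_dvd[of "z \<ominus>\<^bsub>Zp p\<^esub> z'" k] z(1) z'(1) Zp.minus_closed by blast
  have zz': "z = z' \<boxplus> pw k \<boxtimes> w" using Zp.minus_eqD[OF z(1) z'(1) w(2)] .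
  define e' where "e' = f \<oplus>\<^bsub>M'\<^esub> w \<odot>\<^bsub>M'\<^esub> h'"
  have h': "h' \<in> carrier M'" using ext_hM[OF E'] .
  have e': "e' \<in> carrier M'" using f w h' by (simp add: e'_def)
  have "q' (w \<odot>\<^bsub>M'\<^esub> h') = \<one>\<^bsub>G\<^esub>" using ext_q_ker[OF E', of "w \<odot>\<^bsub>M'\<^esub> h'"] w h' by auto
  hence q': "q' e' = q e" unfolding e'_def using f w h' ext_q_add[OF E'] ext_q_closed[OF E e] by simp
  have "pw k \<odot>\<^bsub>M'\<^esub> e' = z \<odot>\<^bsub>M'\<^esub> h'"
    unfolding e'_def zz' using f(1) w(1) h' z'
      by (simp add: M'.smult_r_distr M'.smult_l_distr M'.smult_assoc1)
  hence rel: "ext_rel p k M h q M' h' q' e e'"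
    unfolding ext_rel_def using e e' q' z by blast
  moreover have "x = y"
    if xy: "ext_rel p k M h q M' h' q' e x" "ext_rel p k M h q M' h' q' e y" for x y
  proof -
    obtain a where a: "a \<in> carrier (Zp p)" "pw k \<odot>\<^bsub>M\<^esub> e = a \<odot>\<^bsub>M\<^esub> h" "pw k \<odot>\<^bsub>M'\<^esub> x = a \<odot>\<^bsub>M'\<^esub> h'"
        "x \<in> carrier M'" "q' x = q e"
      using xy(1) unfolding ext_rel_def by blast
    obtain b where b: "b \<in> carrier (Zp p)" "pw k \<odot>\<^bsub>M\<^esub> e = b \<odot>\<^bsub>M\<^esub> h" "pw k \<odot>\<^bsub>M'\<^esub> y = b \<odot>\<^bsub>M'\<^esub> h'"
        "y \<in> carrier M'" "q' y = q e"
      using xy(2) unfolding ext_rel_def by blast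
    have ab: "a = b" using M.nontorsion_cancel[OF ext_nontorsion[OF E] a(1) b(1)] a b by simp
    obtain v where v: "v \<in> carrier (Zp p)" "x = y \<oplus>\<^bsub>M'\<^esub> v \<odot>\<^bsub>M'\<^esub> h'"
      using ext_diff[OF E' a(4) b(4)] a(5) b(5) by auto
    have *: "a \<odot>\<^bsub>M'\<^esub> h' = (a \<boxplus> pw k \<boxtimes> v) \<odot>\<^bsub>M'\<^esub> h'"
      unfolding a(3)[symmetric] v(2)
      using v(1) b h' ab by (simp add: M'.smult_r_distr M'.smult_l_distr M'.smult_assoc1)
    have "a = a \<boxplus> pw k \<boxtimes> v"
      by (rule M'.nontorsion_cancel[OF ext_nontorsion[OF E'] a(1) _ *]) (use a(1) v(1) in simp)
    hence "pw k \<boxtimes> v = \<zero>\<^bsub>Zp p\<^esub>" using a(1) v(1) Zp.add.r_cancel_one'[of "pw k \<boxtimes> v" a] Zp.a_comm by simp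
    hence "v = \<zero>\<^bsub>Zp p\<^esub>" using Zp_pw_mult_eq_0 v(1) by blast
    thus "x = y" using v(2) b(4) h' by simp
  qed
  ultimately show ?thesis by blast
qed

text \<open>The relation \<open>ext_rel\<close> is symmetric in the two extensions and compatible
  with sums and scalars, so unique existence in both directions makes it the graph of a bijective
  linear map.\<close>

lemma ext_iso:
  assumes M: "Zp_module p M" and M': "Zp_module p M'"
    and ext: "ext_pair p G M h q" and ext': "ext_pair p G M' h' q'"
    and ch: "is_char p k M h q \<xi>" "is_char p k M' h' q' \<xi>"
  shows "\<exists>f\<in>mod_hom (Zp p) M M'. bij_betw f (carrier M) (carrier M') \<and> f h = h'
      \<and> (\<forall>e\<in>carrier M. q' (f e) = q e)"
proof -
  interpret M: Zp_module p M by (rule M)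
  interpret M': Zp_module p M' by (rule M')
  let ?R = "ext_rel p k M h q M' h' q'"
  have ex1: "\<exists>!e'. ?R e e'" if "e \<in> carrier M" for e
    using ext_rel_ex1[OF M M' ext ext' ch that] .
  have ex1': "\<exists>!e. ?R e e'" if "e' \<in> carrier M'" for e'
    using ext_rel_ex1[OF M' M ext' ext ch(2,1) that] ext_rel_sym by metis
  define f where "f e = (THE e'. ?R e e')" for e
  have R: "?R e (f e)" if "e \<in> carrier M" for e unfolding f_def by (rule theI'[OF ex1[OF that]])
  have fI: "f e = e'" if "?R e e'" for e e'
    using ex1[of e] that R[of e] unfolding ext_rel_def by metis
  have fM: "f e \<in> carrier M'" "q' (f e) = q e" if "e \<in> carrier M" for e
    using R[OF that] by (auto simp: ext_rel_def)
  have hM: "h \<in> carrier M" "h' \<in> carrier M'" using ext_hM[OF M ext] ext_hM[OF M' ext'] by auto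
  have "f (x \<oplus>\<^bsub>M\<^esub> y) = f x \<oplus>\<^bsub>M'\<^esub> f y" if xy: "x \<in> carrier M" "y \<in> carrier M" for x y
  proof (rule fI)
    obtain a where a: "a \<in> carrier (Zp p)" "pw k \<odot>\<^bsub>M\<^esub> x = a \<odot>\<^bsub>M\<^esub> h" "pw k \<odot>\<^bsub>M'\<^esub> f x = a \<odot>\<^bsub>M'\<^esub> h'"
      using R[OF xy(1)] unfolding ext_rel_def by blast
    obtain b where b: "b \<in> carrier (Zp p)" "pw k \<odot>\<^bsub>M\<^esub> y = b \<odot>\<^bsub>M\<^esub> h" "pw k \<odot>\<^bsub>M'\<^esub> f y = b \<odot>\<^bsub>M'\<^esub> h'"
      using R[OF xy(2)] unfolding ext_rel_def by blast
    have "pw k \<odot>\<^bsub>M\<^esub> (x \<oplus>\<^bsub>M\<^esub> y) = (a \<boxplus> b) \<odot>\<^bsub>M\<^esub> h"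
      using a b xy hM by (simp add: M.smult_r_distr M.smult_l_distr)
    moreover have "pw k \<odot>\<^bsub>M'\<^esub> (f x \<oplus>\<^bsub>M'\<^esub> f y) = (a \<boxplus> b) \<odot>\<^bsub>M'\<^esub> h'"
      using a b xy hM fM by (simp add: M'.smult_r_distr M'.smult_l_distr)
    moreover have "q' (f x \<oplus>\<^bsub>M'\<^esub> f y) = q (x \<oplus>\<^bsub>M\<^esub> y)"
      using ext_q_add[OF M ext] ext_q_add[OF M' ext'] xy fM by simp
    moreover have "a \<boxplus> b \<in> carrier (Zp p)" using a(1) b(1) by simp
    ultimately show "?R (x \<oplus>\<^bsub>M\<^esub> y) (f x \<oplus>\<^bsub>M'\<^esub> f y)"
      unfolding ext_rel_def using xy fM by auto
  qed
  moreover have "f (c \<odot>\<^bsub>M\<^esub> x) = c \<odot>\<^bsub>M'\<^esub> f x" if c: "c \<in> carrier (Zp p)" and x: "x \<in> carrier M" for c x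
  proof (rule fI)
    obtain a where a: "a \<in> carrier (Zp p)" "pw k \<odot>\<^bsub>M\<^esub> x = a \<odot>\<^bsub>M\<^esub> h" "pw k \<odot>\<^bsub>M'\<^esub> f x = a \<odot>\<^bsub>M'\<^esub> h'"
      using R[OF x] unfolding ext_rel_def by blast
    have "pw k \<odot>\<^bsub>M\<^esub> (c \<odot>\<^bsub>M\<^esub> x) = (c \<boxtimes> a) \<odot>\<^bsub>M\<^esub> h"
      using a c x hM M.smult_comm[of "pw k" c x] by (simp add: M.smult_assoc1)
    moreover have "pw k \<odot>\<^bsub>M'\<^esub> (c \<odot>\<^bsub>M'\<^esub> f x) = (c \<boxtimes> a) \<odot>\<^bsub>M'\<^esub> h'"
      using a c x hM fM M'.smult_comm[of "pw k" c "f x"] by (simp add: M'.smult_assoc1)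
    moreover have "q' (c \<odot>\<^bsub>M'\<^esub> f x) = q (c \<odot>\<^bsub>M\<^esub> x)"
      using ext_q_smult[OF M ext] ext_q_smult[OF M' ext'] x c fM by simp
    moreover have "c \<boxtimes> a \<in> carrier (Zp p)" using a(1) c by simp
    ultimately show "?R (c \<odot>\<^bsub>M\<^esub> x) (c \<odot>\<^bsub>M'\<^esub> f x)"
      unfolding ext_rel_def using x c fM by auto
  qed
  ultimately have "f \<in> mod_hom (Zp p) M M'" using fM by (auto simp: mod_hom_def)
  moreover have "bij_betw f (carrier M) (carrier M')"
    unfolding bij_betw_def
  proof
    show "inj_on f (carrier M)"
    proof (rule inj_onI)
      fix x y assume xy: "x \<in> carrier M" "y \<in> carrier M" "f x = f y"
      thus "x = y" using R[OF xy(1)] R[OF xy(2)] ex1'[of "f x"] fM by metis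
    qed
    have "e' \<in> f ` carrier M" if e': "e' \<in> carrier M'" for e'
    proof -
      obtain e where "?R e e'" using ex1'[OF e'] by blast
      thus ?thesis using fI[of e e'] unfolding ext_rel_def by blast
    qed
    thus "f ` carrier M = carrier M'" using fM by auto
  qed
  moreover have "f h = h'"
  proof (rule fI)
    have "q h = \<one>\<^bsub>G\<^esub>" "q' h' = \<one>\<^bsub>G\<^esub>"
      using ext_q_ker[OF M ext hM(1)] ext_q_ker[OF M' ext' hM(2)]
        M.smult_one[OF hM(1)] M'.smult_one[OF hM(2)] Zp.one_closed by metis+
    thus "?R h h'" unfolding ext_rel_def using hM by auto
  qed
  ultimately show ?thesis using fM by blast
qed

text \<open>Pulls an extension structure back along an isomorphism. It is applied to isomorphisms
  with H, to multiplication by units, and to the automorphisms in \<open>shear\<close>.\<close>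

lemma ext_pair_transport:
  assumes M: "Zp_module p M" and M': "Zp_module p M'"
    and f: "f \<in> mod_hom (Zp p) M M'" "bij_betw f (carrier M) (carrier M')"
    and h: "h \<in> carrier M" and q: "\<And>e. e \<in> carrier M \<Longrightarrow> q' (f e) = q e"
    and ext': "ext_pair p G M' (f h) q'"
  shows "ext_pair p G M h q"
proof -
  interpret M: Zp_module p M by (rule M)
  interpret M': Zp_module p M' by (rule M')
  have f_add: "f (x \<oplus>\<^bsub>M\<^esub> y) = f x \<oplus>\<^bsub>M'\<^esub> f y" if "x \<in> carrier M" "y \<in> carrier M" for x y
    using f that by (auto simp: mod_hom_def)
  have f_smult: "f (c \<odot>\<^bsub>M\<^esub> x) = c \<odot>\<^bsub>M'\<^esub> f x" if "c \<in> carrier (Zp p)" "x \<in> carrier M" for x c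
    using f that by (auto simp: mod_hom_def)
  have f_closed: "f x \<in> carrier M'" if "x \<in> carrier M" for x using f that by (auto simp: mod_hom_def)
  have f_inj: "x = y" if "f x = f y" "x \<in> carrier M" "y \<in> carrier M" for x y
    using f(2) that by (auto simp: bij_betw_def inj_on_def)
  have f_surj: "f ` carrier M = carrier M'" using f(2) by (simp add: bij_betw_def)
  have f0: "f \<zero>\<^bsub>M\<^esub> = \<zero>\<^bsub>M'\<^esub>" using f_smult[of "\<zero>\<^bsub>Zp p\<^esub>" "\<zero>\<^bsub>M\<^esub>"] f_closed[of "\<zero>\<^bsub>M\<^esub>"] by simp
  show ?thesis
    unfolding ext_pair_def
  proof (intro conjI ballI impI)
    show "z = \<zero>\<^bsub>Zp p\<^esub>" if "z \<in> carrier (Zp p)" "z \<odot>\<^bsub>M\<^esub> h = \<zero>\<^bsub>M\<^esub>" for z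
      using ext' that f_smult[of z h] h f0 by (auto simp: ext_pair_def)
    show "q \<in> hom (add_monoid M) G"
    proof (rule homI)
      fix x y assume "x \<in> carrier (add_monoid M)" "y \<in> carrier (add_monoid M)"
      hence xy: "x \<in> carrier M" "y \<in> carrier M" by simp_all
      show "q x \<in> carrier G" using ext_q_closed[OF M' ext' f_closed[OF xy(1)]] q xy by simp
      have "q (x \<oplus>\<^bsub>M\<^esub> y) = q' (f x \<oplus>\<^bsub>M'\<^esub> f y)" using xy by (simp add: q[symmetric] f_add)
      thus "q (x \<otimes>\<^bsub>add_monoid M\<^esub> y) = q x \<otimes>\<^bsub>G\<^esub> q y"
        using ext_q_add[OF M' ext' f_closed[OF xy(1)] f_closed[OF xy(2)]] q xy by simp
    qed
    have "q ` carrier M = q' ` (f ` carrier M)" using q by (auto simp: image_iff)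
    thus "q ` carrier M = carrier G" using ext' f_surj by (simp add: ext_pair_def)
    fix e assume e: "e \<in> carrier M"
    have "q e = \<one>\<^bsub>G\<^esub> \<longleftrightarrow> (\<exists>z\<in>carrier (Zp p). f e = z \<odot>\<^bsub>M'\<^esub> f h)"
      using ext_q_ker[OF M' ext' f_closed[OF e]] q[OF e] by simp
    also have "\<dots> \<longleftrightarrow> (\<exists>z\<in>carrier (Zp p). f e = f (z \<odot>\<^bsub>M\<^esub> h))" using f_smult h by simp
    also have "\<dots> \<longleftrightarrow> (\<exists>z\<in>carrier (Zp p). e = z \<odot>\<^bsub>M\<^esub> h)" using f_inj e h by auto
    finally show "q e = \<one>\<^bsub>G\<^esub> \<longleftrightarrow> (\<exists>z\<in>carrier (Zp p). e = z \<odot>\<^bsub>M\<^esub> h)" .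
  qed (rule h)
qed

lemma is_char_transport:
  assumes f: "f \<in> mod_hom (Zp p) M M'" and h: "h \<in> carrier M"
      and q: "\<And>e. e \<in> carrier M \<Longrightarrow> q' (f e) = q e"
    and ch: "is_char p k M' (f h) q' \<xi>"
  shows "is_char p k M h q \<xi>"
  unfolding is_char_def
proof (intro ballI impI)
  fix e z assume *: "e \<in> carrier M" "z \<in> carrier (Zp p)" "pw k \<odot>\<^bsub>M\<^esub> e = z \<odot>\<^bsub>M\<^esub> h"
  have "c \<odot>\<^bsub>M'\<^esub> f x = f (c \<odot>\<^bsub>M\<^esub> x)" if "c \<in> carrier (Zp p)" "x \<in> carrier M" for c x
    using f that by (simp add: mod_hom_def)
  moreover have "f e \<in> carrier M'" using f * by (auto simp: mod_hom_def)
  ultimately have "pw k \<odot>\<^bsub>M'\<^esub> f e = f (pw k \<odot>\<^bsub>M\<^esub> e)" "z \<odot>\<^bsub>M'\<^esub> f h = f (z \<odot>\<^bsub>M\<^esub> h)" "f e \<in> carrier M'"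
    using h *(1,2) by auto
  hence "\<xi> (q' (f e)) = z k" using ch * unfolding is_char_def by metis
  thus "\<xi> (q e) = z k" using q * by simp
qed

end

lemma mod_hom_inv_into:
  assumes M: "Module.module R M" and f: "f \<in> mod_hom R M M'" "bij_betw f (carrier M) (carrier M')"
  shows "inv_into (carrier M) f \<in> mod_hom R M' M"
      "bij_betw (inv_into (carrier M) f) (carrier M') (carrier M)"
proof -
  interpret M: module R M by (rule M)
  let ?g = "inv_into (carrier M) f"
  show b: "bij_betw ?g (carrier M') (carrier M)" using f(2) by (rule bij_betw_inv_into)
  have g: "?g y \<in> carrier M" "f (?g y) = y" if "y \<in> carrier M'" for y
    using that f(2) by (auto simp: bij_betw_def inv_into_into f_inv_into_f)
  have gf: "?g (f x) = x" if "x \<in> carrier M" for x using that f(2) by (auto simp: bij_betw_def)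
  have "?g (x \<oplus>\<^bsub>M'\<^esub> y) = ?g x \<oplus>\<^bsub>M\<^esub> ?g y" if "x \<in> carrier M'" "y \<in> carrier M'" for x y
  proof -
    have "f (?g x \<oplus>\<^bsub>M\<^esub> ?g y) = x \<oplus>\<^bsub>M'\<^esub> y" using f(1) g that by (auto simp: mod_hom_def)
    thus ?thesis using gf[of "?g x \<oplus>\<^bsub>M\<^esub> ?g y"] g that by auto
  qed
  moreover have "?g (a \<odot>\<^bsub>M'\<^esub> x) = a \<odot>\<^bsub>M\<^esub> ?g x" if "a \<in> carrier R" "x \<in> carrier M'" for a x
  proof -
    have "f (a \<odot>\<^bsub>M\<^esub> ?g x) = a \<odot>\<^bsub>M'\<^esub> x" using f(1) g that by (auto simp: mod_hom_def)
    thus ?thesis using gf[of "a \<odot>\<^bsub>M\<^esub> ?g x"] g that by auto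
  qed
  ultimately show "?g \<in> mod_hom R M' M" using g by (auto simp: mod_hom_def)
qed

lemma filter_image: "{c \<in> h ` A. P c} = h ` {x \<in> A. P (h x)}"
  by blast

lemma quotient_kernel_bij:
  "bij_betw (\<lambda>v. {x\<in>X. f x = v}) (f ` X) (X // {(x, y). x \<in> X \<and> y \<in> X \<and> f x = f y})"
  unfolding bij_betw_def
proof
  show "inj_on (\<lambda>v. {x\<in>X. f x = v}) (f ` X)" by (rule inj_onI) blast
  show "(\<lambda>v. {x\<in>X. f x = v}) ` f ` X = X // {(x, y). x \<in> X \<and> y \<in> X \<and> f x = f y}"
  proof (intro equalityI subsetI)
    fix c assume "c \<in> (\<lambda>v. {x\<in>X. f x = v}) ` f ` X"
    then obtain x where x: "x \<in> X" "c = {y\<in>X. f y = f x}" by blast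
    hence "c = {(x, y). x \<in> X \<and> y \<in> X \<and> f x = f y} `` {x}" by auto
    thus "c \<in> X // {(x, y). x \<in> X \<and> y \<in> X \<and> f x = f y}" using x by (auto simp: quotient_def)
  next
    fix c assume "c \<in> X // {(x, y). x \<in> X \<and> y \<in> X \<and> f x = f y}"
    then obtain x where x: "x \<in> X" "c = {(x, y). x \<in> X \<and> y \<in> X \<and> f x = f y} `` {x}"
      by (auto simp: quotient_def)
    hence "c = {y\<in>X. f y = f x}" by auto
    thus "c \<in> (\<lambda>v. {x\<in>X. f x = v}) ` f ` X" using x(1) by blast
  qed
qed

lemma Zp_nth:
  "\<zero>\<^bsub>Zp p\<^esub> n = 0" "\<one>\<^bsub>Zp p\<^esub> n = 1 mod int p ^ n"
  "(x \<oplus>\<^bsub>Zp p\<^esub> y) n = (x n + y n) mod int p ^ n" "(x \<otimes>\<^bsub>Zp p\<^esub> y) n = (x n * y n) mod int p ^ n"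
  by (simp_all add: Zp_simps)

section \<open>The extension with a prescribed character, and Ext as the set of characters\<close>

context p_group
begin

abbreviation CH :: "('g \<Rightarrow> int) set" where "CH \<equiv> chars G (carrier G) (int p ^ k)"

lemma finite_CH: "finite CH"
  using card_charsG p_gt_1 by (intro card_ge_0_finite) simp

lemma CH_nonempty: "CH \<noteq> {}"
  using card_charsG p_gt_1 by (metis card.empty power_not_zero not_one_less_zero)

lemma pow_mod_pk: "y \<in> carrier G \<Longrightarrow> y [^]\<^bsub>G\<^esub> (m mod p ^ k) = y [^]\<^bsub>G\<^esub> (m::nat)"
proof -
  assume y: "y \<in> carrier G"
  have "y [^]\<^bsub>G\<^esub> m = y [^]\<^bsub>G\<^esub> (p ^ k * (m div p ^ k) + m mod p ^ k)" by simp
  also have "\<dots> = (y [^]\<^bsub>G\<^esub> (p ^ k)) [^]\<^bsub>G\<^esub> (m div p ^ k) \<otimes>\<^bsub>G\<^esub> y [^]\<^bsub>G\<^esub> (m mod p ^ k)"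
    using y by (simp only: G.nat_pow_mult[symmetric] G.nat_pow_pow)
  finally show ?thesis using pow_pk y by simp
qed

lemma pow_nat_mod:
  assumes "y \<in> carrier G" "a \<ge> 0"
  shows "y [^]\<^bsub>G\<^esub> nat (a mod int p ^ k) = y [^]\<^bsub>G\<^esub> nat a"
proof -
  have "nat (a mod int p ^ k) = nat a mod p ^ k"
    using assms by (simp add: nat_mod_distrib nat_power_eq)
  thus ?thesis using pow_mod_pk assms by simp
qed

text \<open>The inclusion is \<open>z \<mapsto> (p^k z, 1)\<close>, so that the character of the extension is \<open>\<xi>\<close>.\<close>

definition ext_module :: "('g \<Rightarrow> int) \<Rightarrow> (padic, padic \<times> 'g) module"
  where "ext_module \<xi> = \<lparr>carrier = {(z, y). z \<in> carrier (Zp p) \<and> y \<in> carrier G \<and> z k = \<xi> y},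
    monoid.mult = undefined, one = undefined, zero = (\<zero>\<^bsub>Zp p\<^esub>, \<one>\<^bsub>G\<^esub>),
    add = (\<lambda>(z, y) (w, x). (z \<boxplus> w, y \<otimes>\<^bsub>G\<^esub> x)),
    smult = (\<lambda>a (z, y). (a \<boxtimes> z, y [^]\<^bsub>G\<^esub> nat (a k)))\<rparr>"

lemma ext_module_simps:
  "e \<in> carrier (ext_module \<xi>) \<longleftrightarrow> fst e \<in> carrier (Zp p) \<and> snd e \<in> carrier G \<and> fst e k = \<xi> (snd e)"
  "\<zero>\<^bsub>ext_module \<xi>\<^esub> = (\<zero>\<^bsub>Zp p\<^esub>, \<one>\<^bsub>G\<^esub>)"
  "e \<oplus>\<^bsub>ext_module \<xi>\<^esub> f = (fst e \<boxplus> fst f, snd e \<otimes>\<^bsub>G\<^esub> snd f)"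
  "a \<odot>\<^bsub>ext_module \<xi>\<^esub> e = (a \<boxtimes> fst e, snd e [^]\<^bsub>G\<^esub> nat (a k))"
  by (auto simp: ext_module_def split: prod.splits)

context
  fixes \<xi> assumes \<xi>: "\<xi> \<in> CH"
begin

lemma char_mult: "x \<in> carrier G \<Longrightarrow> y \<in> carrier G \<Longrightarrow> \<xi> (x \<otimes>\<^bsub>G\<^esub> y) = (\<xi> x + \<xi> y) mod int p ^ k"
  using \<xi> by (simp add: chars_def)

lemma char_range: "x \<in> carrier G \<Longrightarrow> 0 \<le> \<xi> x \<and> \<xi> x < int p ^ k"
  using \<xi> by (auto simp: chars_def)

lemma char_one: "\<xi> \<one>\<^bsub>G\<^esub> = 0"
  using G.chars_one[OF G.subgroup_self \<xi>] .

lemma char_pow: "x \<in> carrier G \<Longrightarrow> \<xi> (x [^]\<^bsub>G\<^esub> (n::nat)) = (int n * \<xi> x) mod int p ^ k"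
  using G.chars_pow[OF G.subgroup_self \<xi>] .

text \<open>The carrier is the fibre product of Zp and G over Z/p^k, so closure expresses that \<xi>
  is a homomorphism. Scalars act on G through exponents reduced modulo p^k, and the scalar laws hold
  there because p^k kills G.\<close>

lemma ext_module_Zp_module: "Zp_module p (ext_module \<xi>)"
proof (rule Zp_module.intro[OF padic_prime_axioms moduleI])
  let ?E = "ext_module \<xi>"
  note S = ext_module_simps
  have nn: "0 \<le> a k" "a k < int p ^ k" if "a \<in> carrier (Zp p)" for a
    using that by (auto simp: Zp_carrier_iff)
  show "cring (Zp p)" by (rule Zp_cring)
  show "abelian_group ?E"
  proof (rule abelian_groupI)
    show "x \<oplus>\<^bsub>?E\<^esub> y \<in> carrier ?E" if "x \<in> carrier ?E" "y \<in> carrier ?E" for x y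
      using that by (simp add: S Zp_nth char_mult)
    show "\<zero>\<^bsub>?E\<^esub> \<in> carrier ?E" using char_one by (simp add: S Zp_nth)
    show "\<exists>y\<in>carrier ?E. y \<oplus>\<^bsub>?E\<^esub> x = \<zero>\<^bsub>?E\<^esub>" if x: "x \<in> carrier ?E" for x
    proof -
      define z y where "z = fst x" and "y = snd x"
      have zy: "z \<in> carrier (Zp p)" "y \<in> carrier G" "z k = \<xi> y" using x by (auto simp: S z_def y_def)
      have "\<ominus>\<^bsub>Zp p\<^esub> z \<boxplus> z = \<zero>\<^bsub>Zp p\<^esub>" using zy by (simp add: Zp.l_neg)
      hence "((\<ominus>\<^bsub>Zp p\<^esub> z) k + z k) mod int p ^ k = 0" by (metis Zp_nth(1,3))
      moreover have "(\<xi> (inv\<^bsub>G\<^esub> y) + \<xi> y) mod int p ^ k = 0"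
        using zy char_mult[of "inv\<^bsub>G\<^esub> y" y] char_one by simp
      ultimately have "((\<ominus>\<^bsub>Zp p\<^esub> z) k + z k) mod int p ^ k = (\<xi> (inv\<^bsub>G\<^esub> y) + z k) mod int p ^ k"
        using zy(3) by simp
      hence "(\<ominus>\<^bsub>Zp p\<^esub> z) k mod int p ^ k = \<xi> (inv\<^bsub>G\<^esub> y) mod int p ^ k"
        by (simp add: mod_eq_dvd_iff)
      hence "(\<ominus>\<^bsub>Zp p\<^esub> z) k = \<xi> (inv\<^bsub>G\<^esub> y)" using nn[of "\<ominus>\<^bsub>Zp p\<^esub> z"] zy char_range[of "inv\<^bsub>G\<^esub> y"] by simp
      thus ?thesis using zy
        by (intro bexI[of _ "(\<ominus>\<^bsub>Zp p\<^esub> z, inv\<^bsub>G\<^esub> y)"]) (simp_all add: S Zp.l_neg z_def[symmetric]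
            y_def[symmetric])
    qed
  qed (auto simp: S Zp.a_ac G.m_ac)
  show "a \<odot>\<^bsub>?E\<^esub> x \<in> carrier ?E" if "a \<in> carrier (Zp p)" "x \<in> carrier ?E" for a x
    using that nn[of a] char_pow[of "snd x" "nat (a k)"] by (simp add: S Zp_nth)
  show "(a \<boxplus> b) \<odot>\<^bsub>?E\<^esub> x = a \<odot>\<^bsub>?E\<^esub> x \<oplus>\<^bsub>?E\<^esub> b \<odot>\<^bsub>?E\<^esub> x" if ab: "a \<in> carrier (Zp p)" "b \<in> carrier (Zp p)"
      and "x \<in> carrier ?E" for a b x
  proof -
    have x: "fst x \<in> carrier (Zp p)" "snd x \<in> carrier G" using that by (auto simp: S)
    have "(a \<boxplus> b) k = (a k + b k) mod int p ^ k" by (simp add: Zp_nth)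
    hence "snd x [^]\<^bsub>G\<^esub> nat ((a \<boxplus> b) k) = snd x [^]\<^bsub>G\<^esub> nat (a k + b k)"
      using pow_nat_mod[OF x(2), of "a k + b k"] nn[OF ab(1)] nn[OF ab(2)] by simp
    also have "\<dots> = snd x [^]\<^bsub>G\<^esub> nat (a k) \<otimes>\<^bsub>G\<^esub> snd x [^]\<^bsub>G\<^esub> nat (b k)"
      using nn[OF ab(1)] nn[OF ab(2)] x by (simp only: nat_add_distrib G.nat_pow_mult)
    finally show ?thesis using x ab by (simp add: S Zp.l_distr)
  qed
  show "a \<odot>\<^bsub>?E\<^esub> (x \<oplus>\<^bsub>?E\<^esub> y) = a \<odot>\<^bsub>?E\<^esub> x \<oplus>\<^bsub>?E\<^esub> a \<odot>\<^bsub>?E\<^esub> y"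
    if "a \<in> carrier (Zp p)" "x \<in> carrier ?E" "y \<in> carrier ?E" for a x y
    using that by (simp add: S Zp.r_distr G.nat_pow_distrib)
  show "(a \<boxtimes> b) \<odot>\<^bsub>?E\<^esub> x = a \<odot>\<^bsub>?E\<^esub> (b \<odot>\<^bsub>?E\<^esub> x)" if ab: "a \<in> carrier (Zp p)" "b \<in> carrier (Zp p)"
      and "x \<in> carrier ?E" for a b x
  proof -
    have x: "fst x \<in> carrier (Zp p)" "snd x \<in> carrier G" using that by (auto simp: S)
    have "(a \<boxtimes> b) k = (a k * b k) mod int p ^ k" by (simp add: Zp_nth)
    hence "snd x [^]\<^bsub>G\<^esub> nat ((a \<boxtimes> b) k) = snd x [^]\<^bsub>G\<^esub> nat (a k * b k)"
      using pow_nat_mod[OF x(2), of "a k * b k"] nn[OF ab(1)] nn[OF ab(2)] by simp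
    also have "\<dots> = (snd x [^]\<^bsub>G\<^esub> nat (b k)) [^]\<^bsub>G\<^esub> nat (a k)"
      using nn[OF ab(1)] nn[OF ab(2)] x by (simp only: nat_mult_distrib G.nat_pow_pow mult.commute)
    finally show ?thesis using x ab by (simp add: S Zp.m_assoc)
  qed
  show "\<one>\<^bsub>Zp p\<^esub> \<odot>\<^bsub>?E\<^esub> x = x" if "x \<in> carrier ?E" for x
  proof -
    have x: "fst x \<in> carrier (Zp p)" "snd x \<in> carrier G" using that by (auto simp: S)
    have "\<one>\<^bsub>Zp p\<^esub> k = 1 mod int p ^ k" by (simp add: Zp_nth)
    hence "snd x [^]\<^bsub>G\<^esub> nat (\<one>\<^bsub>Zp p\<^esub> k) = snd x [^]\<^bsub>G\<^esub> nat 1" using pow_nat_mod[OF x(2), of 1] by simp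
    thus ?thesis using x by (simp add: S)
  qed
qed

lemma ext_module_ext_pair: "ext_pair p G (ext_module \<xi>) (pw k, \<one>\<^bsub>G\<^esub>) snd"
  unfolding ext_pair_def
proof (intro conjI ballI impI)
  let ?E = "ext_module \<xi>"
  note S = ext_module_simps
  have pk: "pw k k = 0" by (simp add: padic_of_int_def)
  show "(pw k, \<one>\<^bsub>G\<^esub>) \<in> carrier ?E" using pk char_one by (simp add: S)
  show "z = \<zero>\<^bsub>Zp p\<^esub>" if "z \<in> carrier (Zp p)" "z \<odot>\<^bsub>?E\<^esub> (pw k, \<one>\<^bsub>G\<^esub>) = \<zero>\<^bsub>?E\<^esub>" for z
    using that Zp_pw_mult_eq_0[of z k] by (simp add: S Zp.m_comm)
  show "snd \<in> hom (add_monoid ?E) G" by (rule homI) (auto simp: S)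
  show "snd ` carrier ?E = carrier G"
  proof (intro equalityI subsetI)
    fix y assume y: "y \<in> carrier G"
    have "(padic_of_int p (\<xi> y), y) \<in> carrier ?E"
      using y char_range[OF y] by (simp add: S) (simp add: padic_of_int_def)
    thus "y \<in> snd ` carrier ?E" by force
  qed (auto simp: S)
  show "snd e = \<one>\<^bsub>G\<^esub> \<longleftrightarrow> (\<exists>z\<in>carrier (Zp p). e = z \<odot>\<^bsub>?E\<^esub> (pw k, \<one>\<^bsub>G\<^esub>))" if e: "e \<in> carrier ?E" for e
  proof
    assume 1: "snd e = \<one>\<^bsub>G\<^esub>"
    hence "fst e k = 0" "fst e \<in> carrier (Zp p)" using e char_one by (auto simp: S)
    then obtain z where z: "z \<in> carrier (Zp p)" "fst e = pw k \<boxtimes> z" using Zp_pw_dvd by blast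
    hence "e = z \<odot>\<^bsub>?E\<^esub> (pw k, \<one>\<^bsub>G\<^esub>)" using 1 by (simp add: S Zp.m_comm prod_eq_iff)
    thus "\<exists>z\<in>carrier (Zp p). e = z \<odot>\<^bsub>?E\<^esub> (pw k, \<one>\<^bsub>G\<^esub>)" using z by blast
  qed (auto simp: S)
qed

text \<open>In the first component, p^k e = z (p^k, 1) reads p^k (\<open>fst e\<close>) = p^k z. So
  z is the first component of e, whose residue modulo p^k is \<xi> of the second by
  construction.\<close>

lemma ext_module_is_char: "is_char p k (ext_module \<xi>) (pw k, \<one>\<^bsub>G\<^esub>) snd \<xi>"
  unfolding is_char_def
proof (intro ballI impI)
  let ?E = "ext_module \<xi>"
  note S = ext_module_simps
  fix e z assume e: "e \<in> carrier ?E" and z: "z \<in> carrier (Zp p)" and eq: "pw k \<odot>\<^bsub>?E\<^esub> e = z \<odot>\<^bsub>?E\<^esub> (pw k, \<one>\<^bsub>G\<^esub>)"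
  hence "pw k \<boxtimes> fst e = pw k \<boxtimes> z" by (simp add: S Zp.m_comm)
  hence "fst e = z" using pw_mult_cancel e z by (auto simp: S)
  thus "\<xi> (snd e) = z k" using e by (simp add: S)
qed

end

lemma multiplicity_order: "multiplicity p (order G) = k"
  unfolding ordG using prime by (simp add: multiplicity_same_power)

text \<open>On the carriers, the inclusion is determined by the image of 1, and q is linear as soon
  as it is additive; so \<open>extensions\<close> and \<open>ext_pair\<close> carry the same
  information.\<close>

lemma extensions_iff:
  "(E, i, q) \<in> extensions p G \<longleftrightarrow>
     Zp_module p E \<and> ext_pair p G E (i \<one>\<^bsub>Zp p\<^esub>) q \<and> (\<forall>z\<in>carrier (Zp p). i z = z \<odot>\<^bsub>E\<^esub> i \<one>\<^bsub>Zp p\<^esub>)"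
proof
  assume "(E, i, q) \<in> extensions p G"
  hence E: "Module.module (Zp p) E" and i: "i \<in> mod_hom (Zp p) (Zp p) E" "inj_on i (carrier (Zp p))"
    and q: "q \<in> mod_hom (Zp p) E (p_group_module p G)" "q ` carrier E = carrier G"
    and ker: "i ` carrier (Zp p) = {e \<in> carrier E. q e = \<one>\<^bsub>G\<^esub>}"
    by (auto simp: extensions_def)
  have ZE: "Zp_module p E" by (rule Zp_module.intro[OF padic_prime_axioms E])
  interpret E: Zp_module p E by (rule ZE)
  have iz: "i z = z \<odot>\<^bsub>E\<^esub> i \<one>\<^bsub>Zp p\<^esub>" if z: "z \<in> carrier (Zp p)" for z
  proof -
    have "z \<odot>\<^bsub>Zp p\<^esub> \<one>\<^bsub>Zp p\<^esub> = z \<boxtimes> \<one>\<^bsub>Zp p\<^esub>" by (simp add: Zp_simps)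
    hence "i z = i (z \<odot>\<^bsub>Zp p\<^esub> \<one>\<^bsub>Zp p\<^esub>)" using z by simp
    thus ?thesis using i(1) z Zp.one_closed unfolding mod_hom_def by auto
  qed
  have "ext_pair p G E (i \<one>\<^bsub>Zp p\<^esub>) q"
    unfolding ext_pair_def
  proof (intro conjI ballI impI)
    show i1: "i \<one>\<^bsub>Zp p\<^esub> \<in> carrier E" using i by (auto simp: mod_hom_def)
    have "i \<zero>\<^bsub>Zp p\<^esub> = \<zero>\<^bsub>E\<^esub>" using iz[of "\<zero>\<^bsub>Zp p\<^esub>"] i1 by simp
    thus "z = \<zero>\<^bsub>Zp p\<^esub>" if "z \<in> carrier (Zp p)" "z \<odot>\<^bsub>E\<^esub> i \<one>\<^bsub>Zp p\<^esub> = \<zero>\<^bsub>E\<^esub>" for z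
      using that iz i(2) by (metis Zp.zero_closed inj_onD)
    show "q \<in> hom (add_monoid E) G" using q by (auto simp: mod_hom_def hom_def p_group_module_def)
    show "q ` carrier E = carrier G" by fact
    show "q e = \<one>\<^bsub>G\<^esub> \<longleftrightarrow> (\<exists>z\<in>carrier (Zp p). e = z \<odot>\<^bsub>E\<^esub> i \<one>\<^bsub>Zp p\<^esub>)" if e: "e \<in> carrier E" for e
    proof -
      have "q e = \<one>\<^bsub>G\<^esub> \<longleftrightarrow> (\<exists>z\<in>carrier (Zp p). e = i z)" using ker e by blast
      thus ?thesis using iz by metis
    qed
  qed
  thus "Zp_module p E \<and> ext_pair p G E (i \<one>\<^bsub>Zp p\<^esub>) q \<and> (\<forall>z\<in>carrier (Zp p). i z = z \<odot>\<^bsub>E\<^esub> i \<one>\<^bsub>Zp p\<^esub>)"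
    using ZE iz by blast
next
  assume *: "Zp_module p E \<and> ext_pair p G E (i \<one>\<^bsub>Zp p\<^esub>) q \<and> (\<forall>z\<in>carrier (Zp p). i z = z \<odot>\<^bsub>E\<^esub> i \<one>\<^bsub>Zp p\<^esub>)"
  hence E: "Zp_module p E" and ext: "ext_pair p G E (i \<one>\<^bsub>Zp p\<^esub>) q"
      and iz: "\<And>z. z \<in> carrier (Zp p) \<Longrightarrow> i z = z \<odot>\<^bsub>E\<^esub> i \<one>\<^bsub>Zp p\<^esub>"
    by blast+
  interpret E: Zp_module p E by (rule E)
  have i1: "i \<one>\<^bsub>Zp p\<^esub> \<in> carrier E" using ext by (simp add: ext_pair_def)
  have "i \<in> mod_hom (Zp p) (Zp p) E"
    unfolding mod_hom_def
  proof (intro CollectI conjI ballI)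
    show "i \<in> carrier (Zp p) \<rightarrow> carrier E" using iz i1 E.smult_closed by (metis Pi_I)
    show "i (x \<boxplus> y) = i x \<oplus>\<^bsub>E\<^esub> i y" if "x \<in> carrier (Zp p)" "y \<in> carrier (Zp p)" for x y
      using iz[OF that(1)] iz[OF that(2)] iz[of "x \<boxplus> y"] E.smult_l_distr[OF that i1] that by simp
    show "i (a \<odot>\<^bsub>Zp p\<^esub> x) = a \<odot>\<^bsub>E\<^esub> i x" if "a \<in> carrier (Zp p)" "x \<in> carrier (Zp p)" for a x
    proof -
      have "a \<odot>\<^bsub>Zp p\<^esub> x = a \<boxtimes> x" by (simp add: Zp_simps)
      thus ?thesis using iz[OF that(2)] iz[of "a \<boxtimes> x"] E.smult_assoc1[OF that i1] that by simp
    qed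
  qed
  moreover have "inj_on i (carrier (Zp p))"
  proof (rule inj_onI)
    fix z w assume zw: "z \<in> carrier (Zp p)" "w \<in> carrier (Zp p)" "i z = i w"
    have "z \<odot>\<^bsub>E\<^esub> i \<one>\<^bsub>Zp p\<^esub> = w \<odot>\<^bsub>E\<^esub> i \<one>\<^bsub>Zp p\<^esub>" using zw(3) unfolding iz[OF zw(1)] iz[OF zw(2)] .
    thus "z = w" by (rule E.nontorsion_cancel[OF ext_nontorsion[OF E ext] zw(1,2)])
  qed
  moreover have "q \<in> mod_hom (Zp p) E (p_group_module p G)"
    unfolding mod_hom_def
  proof (intro CollectI conjI ballI)
    show "q \<in> carrier E \<rightarrow> carrier (p_group_module p G)"
      using ext_q_closed[OF E ext] by (simp add: p_group_module_def)
    show "q (x \<oplus>\<^bsub>E\<^esub> y) = q x \<oplus>\<^bsub>p_group_module p G\<^esub> q y" if "x \<in> carrier E" "y \<in> carrier E" for x y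
      using ext_q_add[OF E ext that] by (simp add: p_group_module_def)
    show "q (a \<odot>\<^bsub>E\<^esub> x) = a \<odot>\<^bsub>p_group_module p G\<^esub> q x" if "a \<in> carrier (Zp p)" "x \<in> carrier E" for a x
    proof -
      \<comment> \<open>The module structure on G uses integer exponents, \<open>ext_q_smult\<close>
        natural ones; residues are nonnegative, so the two agree.\<close>
      have "a k = int (nat (a k))" using that by (simp add: Zp_carrier_iff)
      hence "q x [^]\<^bsub>G\<^esub> a k = q x [^]\<^bsub>G\<^esub> nat (a k)"
        by (metis int_pow_int)
      thus ?thesis using ext_q_smult[OF E ext that(2,1)]
        by (simp add: p_group_module_def multiplicity_order)
    qed
  qed
  moreover have "q ` carrier E = carrier G" using ext by (simp add: ext_pair_def)
  moreover have "i ` carrier (Zp p) = {e \<in> carrier E. q e = \<one>\<^bsub>G\<^esub>}"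
  proof -
    have "i ` carrier (Zp p) = (\<lambda>z. z \<odot>\<^bsub>E\<^esub> i \<one>\<^bsub>Zp p\<^esub>) ` carrier (Zp p)"
      using iz by (rule image_cong[OF refl])
    also have "\<dots> = {e \<in> carrier E. \<exists>z\<in>carrier (Zp p). e = z \<odot>\<^bsub>E\<^esub> i \<one>\<^bsub>Zp p\<^esub>}" using i1 by auto
    also have "\<dots> = {e \<in> carrier E. q e = \<one>\<^bsub>G\<^esub>}"
      by (intro Collect_cong conj_cong refl) (simp add: ext_q_ker[OF E ext])
    finally show ?thesis .
  qed
  ultimately show "(E, i, q) \<in> extensions p G" using E.module_axioms by (simp add: extensions_def)
qed

definition ext_char :: "'g extension \<Rightarrow> 'g \<Rightarrow> int"
  where "ext_char = (\<lambda>(E, i, q). THE \<xi>. \<xi> \<in> CH \<and> is_char p k E (i \<one>\<^bsub>Zp p\<^esub>) q \<xi>)"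

lemma ext_char:
  assumes "(E, i, q) \<in> extensions p G"
  shows "ext_char (E, i, q) \<in> CH" "is_char p k E (i \<one>\<^bsub>Zp p\<^esub>) q (ext_char (E, i, q))"
proof -
  have *: "Zp_module p E" "ext_pair p G E (i \<one>\<^bsub>Zp p\<^esub>) q" using assms extensions_iff by blast+
  have "\<exists>!\<xi>. \<xi> \<in> CH \<and> is_char p k E (i \<one>\<^bsub>Zp p\<^esub>) q \<xi>"
    using ext_char_exists[OF *] ext_char_unique[OF *] by blast
  from theI'[OF this] show "ext_char (E, i, q) \<in> CH" "is_char p k E (i \<one>\<^bsub>Zp p\<^esub>) q (ext_char (E, i, q))"
    by (simp_all add: ext_char_def)
qed

lemma ext_char_eqI:
  assumes "(E, i, q) \<in> extensions p G" "\<xi> \<in> CH" "is_char p k E (i \<one>\<^bsub>Zp p\<^esub>) q \<xi>"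
  shows "ext_char (E, i, q) = \<xi>"
proof -
  have *: "Zp_module p E" "ext_pair p G E (i \<one>\<^bsub>Zp p\<^esub>) q" using assms extensions_iff by blast+
  show ?thesis using ext_char_unique[OF * _ _ ext_char(2)[OF assms(1)] assms(3)] ext_char(1)[OF
      assms(1)] assms(2) by blast
qed

lemma ext_char_image: "ext_char ` extensions p G = CH"
proof (intro equalityI subsetI)
  fix \<xi> assume \<xi>: "\<xi> \<in> CH"
  define i where "i z = z \<odot>\<^bsub>ext_module \<xi>\<^esub> (pw k, \<one>\<^bsub>G\<^esub>)" for z
  interpret E: Zp_module p "ext_module \<xi>" by (rule ext_module_Zp_module[OF \<xi>])
  have i1: "i \<one>\<^bsub>Zp p\<^esub> = (pw k, \<one>\<^bsub>G\<^esub>)"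
    unfolding i_def using ext_hM[OF ext_module_Zp_module[OF \<xi>] ext_module_ext_pair[OF \<xi>]] by simp
  have "(ext_module \<xi>, i, snd) \<in> extensions p G" "is_char p k (ext_module \<xi>) (i \<one>\<^bsub>Zp p\<^esub>) snd \<xi>"
    using ext_module_Zp_module[OF \<xi>] ext_module_ext_pair[OF \<xi>] ext_module_is_char[OF \<xi>]
    unfolding extensions_iff i1 by (simp_all add: i_def)
  thus "\<xi> \<in> ext_char ` extensions p G" using ext_char_eqI[OF _ \<xi>] by (metis image_eqI)
next
  fix \<xi> assume "\<xi> \<in> ext_char ` extensions p G"
  thus "\<xi> \<in> CH" using ext_char(1) by auto
qed

text \<open>An equivalence transports the character; conversely, equal characters give an
  equivalence by \<open>ext_iso\<close>. The classes in \<open>Ext\<close> are thus the fibres of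
  \<open>ext_char\<close>.\<close>

lemma extension_equiv_iff:
  assumes x: "(E, i, q) \<in> extensions p G" and y: "(E', i', q') \<in> extensions p G"
  shows "((E, i, q), (E', i', q')) \<in> extension_equiv p G \<longleftrightarrow> ext_char (E, i, q) = ext_char (E', i', q')"
proof
  have E: "Zp_module p E" "ext_pair p G E (i \<one>\<^bsub>Zp p\<^esub>) q" using x extensions_iff by blast+
  have E': "Zp_module p E'" "ext_pair p G E' (i' \<one>\<^bsub>Zp p\<^esub>) q'" using y extensions_iff by blast+
  have iz: "i z = z \<odot>\<^bsub>E\<^esub> i \<one>\<^bsub>Zp p\<^esub>" "i' z = z \<odot>\<^bsub>E'\<^esub> i' \<one>\<^bsub>Zp p\<^esub>" if "z \<in> carrier (Zp p)" for z
    using x y extensions_iff that by blast+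
  have i1: "i \<one>\<^bsub>Zp p\<^esub> \<in> carrier E" using E(2) by (simp add: ext_pair_def)
  show "ext_char (E, i, q) = ext_char (E', i', q')"
    if equiv: "((E, i, q), (E', i', q')) \<in> extension_equiv p G"
  proof -
    obtain f where f: "f \<in> mod_hom (Zp p) E E'" "\<forall>z\<in>carrier (Zp p). f (i z) = i' z"
        "\<forall>e\<in>carrier E. q' (f e) = q e"
      using equiv unfolding extension_equiv_def by blast
    have "f (i \<one>\<^bsub>Zp p\<^esub>) = i' \<one>\<^bsub>Zp p\<^esub>" using f(2) Zp.one_closed by blast
    hence "is_char p k E (i \<one>\<^bsub>Zp p\<^esub>) q (ext_char (E', i', q'))"
      using is_char_transport[OF f(1) i1, of q' q] f(3) ext_char(2)[OF y] by metis
    thus ?thesis using ext_char_eqI[OF x ext_char(1)[OF y]] by blast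
  qed
  show "((E, i, q), (E', i', q')) \<in> extension_equiv p G"
    if eq: "ext_char (E, i, q) = ext_char (E', i', q')"
  proof -
    obtain f where f: "f \<in> mod_hom (Zp p) E E'" "bij_betw f (carrier E) (carrier E')"
        "f (i \<one>\<^bsub>Zp p\<^esub>) = i' \<one>\<^bsub>Zp p\<^esub>"
      "\<forall>e\<in>carrier E. q' (f e) = q e"
      using ext_iso[OF E(1) E'(1) E(2) E'(2) ext_char(2)[OF x] ext_char(2)[OF y, folded eq]] by blast
    have "f (i z) = i' z" if "z \<in> carrier (Zp p)" for z
    proof -
      have "f (z \<odot>\<^bsub>E\<^esub> i \<one>\<^bsub>Zp p\<^esub>) = z \<odot>\<^bsub>E'\<^esub> f (i \<one>\<^bsub>Zp p\<^esub>)" using f(1) i1 that unfolding mod_hom_def by blast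
      thus ?thesis unfolding f(3) iz[OF that, symmetric] .
    qed
    thus ?thesis unfolding extension_equiv_def using x y f(1,2,4) by blast
  qed
qed

lemma extension_equiv_eq:
  "extension_equiv p G =
    {(x, y). x \<in> extensions p G \<and> y \<in> extensions p G \<and> ext_char x = ext_char y}"
proof (rule Set.set_eqI)
  have sub: "extension_equiv p G \<subseteq> extensions p G \<times> extensions p G"
    unfolding extension_equiv_def by blast
  fix w :: "'g extension \<times> 'g extension"
  obtain x y where w: "w = (x, y)" by (cases w)
  obtain E i q where x: "x = (E, i, q)" by (cases x)
  obtain E' i' q' where y: "y = (E', i', q')" by (cases y)
  have "(x, y) \<in> extension_equiv p G \<longleftrightarrow> ext_char x = ext_char y"
    if "x \<in> extensions p G" "y \<in> extensions p G"
    using that unfolding x y by (rule extension_equiv_iff)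
  thus "w \<in> extension_equiv p G \<longleftrightarrow> w \<in> {(x, y). x \<in> extensions p G \<and> y \<in> extensions p G \<and> ext_char x
      = ext_char y}"
    using sub unfolding w by blast
qed

text \<open>Structures on one fixed M replace extensions with middle term isomorphic to M; this
  frees M from the element type imposed by \<open>extensions\<close>.\<close>

definition realized :: "(padic, 'a) module \<Rightarrow> ('g \<Rightarrow> int) set"
  where "realized M = {\<xi> \<in> CH. \<exists>h q. ext_pair p G M h q \<and> is_char p k M h q \<xi>}"

lemma Ext_bij: "bij_betw (\<lambda>\<xi>. {x \<in> extensions p G. ext_char x = \<xi>}) CH (Ext p G)"
  using quotient_kernel_bij[of "extensions p G" ext_char]
  unfolding Ext_def extension_equiv_eq ext_char_image .

lemma finite_Ext: "finite (Ext p G)"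
  using bij_betw_finite[OF Ext_bij] finite_CH by simp

lemma Ext_nonempty: "Ext p G \<noteq> {}"
  unfolding bij_betw_imp_surj_on[OF Ext_bij, symmetric] using CH_nonempty by simp

text \<open>A uniform element of Ext is a uniform character. If a class contains a middle term
  isomorphic to M, its structure is transported to M and realizes the character there; conversely, a
  realization on M is isomorphic to any extension in the class by \<open>ext_iso\<close>.\<close>

theorem prob_dstar_eq:
  assumes M: "Zp_module p M"
  shows "prob_dstar p G M = real (card (realized M)) / real (p ^ k)"
proof -
  let ?c = "\<lambda>\<xi>. {x \<in> extensions p G. ext_char x = \<xi>}"
  have card_Ext: "card (Ext p G) = p ^ k"
    using bij_betw_same_card[OF Ext_bij] card_charsG by simp
  have iff: "(\<exists>(E, i, q)\<in>?c \<xi>. mod_isomorphic (Zp p) E M) \<longleftrightarrow> \<xi> \<in> realized M" if \<xi>: "\<xi> \<in> CH" for \<xi>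
  proof
    assume "\<exists>(E, i, q)\<in>?c \<xi>. mod_isomorphic (Zp p) E M"
    then obtain E i q f where x: "(E, i, q) \<in> extensions p G" "ext_char (E, i, q) = \<xi>"
      and f: "f \<in> mod_hom (Zp p) E M" "bij_betw f (carrier E) (carrier M)"
      unfolding mod_isomorphic_def by blast
    have E: "Zp_module p E" "ext_pair p G E (i \<one>\<^bsub>Zp p\<^esub>) q" using x extensions_iff by blast+
    interpret E: Zp_module p E by (rule E)
    have i1: "i \<one>\<^bsub>Zp p\<^esub> \<in> carrier E" using E(2) by (simp add: ext_pair_def)
    define g where "g = inv_into (carrier E) f"
    have g: "g \<in> mod_hom (Zp p) M E" "bij_betw g (carrier M) (carrier E)"
      unfolding g_def using mod_hom_inv_into[OF E.module_axioms f] by auto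
    have gf: "g (f (i \<one>\<^bsub>Zp p\<^esub>)) = i \<one>\<^bsub>Zp p\<^esub>" unfolding g_def using f(2) i1 by (simp add: bij_betw_def)
    have fi: "f (i \<one>\<^bsub>Zp p\<^esub>) \<in> carrier M" using f(1) i1 by (auto simp: mod_hom_def)
    have "ext_pair p G M (f (i \<one>\<^bsub>Zp p\<^esub>)) (\<lambda>e. q (g e))"
      by (rule ext_pair_transport[OF M E(1) g fi refl]) (simp add: gf E(2))
    moreover have "is_char p k M (f (i \<one>\<^bsub>Zp p\<^esub>)) (\<lambda>e. q (g e)) \<xi>"
      by (rule is_char_transport[OF g(1) fi refl]) (use ext_char(2)[OF x(1)] x(2) gf in simp)
    ultimately show "\<xi> \<in> realized M" unfolding realized_def using \<xi> by blast
  next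
    assume "\<xi> \<in> realized M"
    then obtain h q where hq: "ext_pair p G M h q" "is_char p k M h q \<xi>" by (auto simp: realized_def)
    obtain x where x: "x \<in> extensions p G" "ext_char x = \<xi>" using ext_char_image \<xi> by (metis imageE)
    obtain E i q' where Eiq: "x = (E, i, q')" by (cases x)
    have E: "Zp_module p E" "ext_pair p G E (i \<one>\<^bsub>Zp p\<^esub>) q'"
      using x(1) extensions_iff unfolding Eiq by blast+
    have "\<exists>f\<in>mod_hom (Zp p) E M. bij_betw f (carrier E) (carrier M) \<and> f (i \<one>\<^bsub>Zp p\<^esub>) = h
        \<and> (\<forall>e\<in>carrier E. q (f e) = q' e)"
      using ext_iso[OF E(1) M E(2) hq(1) _ hq(2)] ext_char(2)[of E i q'] x Eiq by simp
    hence "mod_isomorphic (Zp p) E M" unfolding mod_isomorphic_def by blast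
    thus "\<exists>(E, i, q)\<in>?c \<xi>. mod_isomorphic (Zp p) E M" using x Eiq by blast
  qed
  define P where "P c \<longleftrightarrow> (\<exists>(E, i, q)\<in>c. mod_isomorphic (Zp p) E M)" for c :: "'g extension set"
  have sub: "realized M \<subseteq> CH" by (auto simp: realized_def)
  have "Ext p G = ?c ` CH" using Ext_bij by (simp add: bij_betw_def)
  hence "{c \<in> Ext p G. P c} = ?c ` {\<xi> \<in> CH. P (?c \<xi>)}" by (simp only: filter_image)
  also have "{\<xi> \<in> CH. P (?c \<xi>)} = realized M" using iff sub unfolding P_def by fast
  finally have eq: "{c \<in> Ext p G. P c} = ?c ` realized M" .
  have "inj_on ?c CH" using Ext_bij by (simp add: bij_betw_def)
  hence "inj_on ?c (realized M)" using sub by (rule inj_on_subset)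
  hence "card {c \<in> Ext p G. P c} = card (realized M)"
    unfolding eq by (rule card_image)
  moreover have "Ext p G \<inter> {c \<in> Ext p G. P c} = {c \<in> Ext p G. P c}" by blast
  ultimately show ?thesis
    unfolding prob_dstar_def P_def[symmetric] measure_pmf_of_set[OF Ext_nonempty finite_Ext] card_Ext
    by simp
qed

end

section \<open>Counting extensions with a given middle term\<close>

lemma (in abelian_group) add_eq_add_diff:
  assumes "a \<in> carrier G" "b \<in> carrier G" "s \<in> carrier G" "t \<in> carrier G" "a \<oplus> s = b \<oplus> t"
  shows "a \<ominus> b = t \<ominus> s"
proof -
  have "a \<ominus> b = (s \<oplus> \<ominus> s) \<oplus> (a \<oplus> \<ominus> b)" using assms by (simp add: a_minus_def r_neg)
  also have "\<dots> = (a \<oplus> s) \<oplus> (\<ominus> s \<oplus> \<ominus> b)" using assms(1-4) by (simp add: a_ac)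
  also have "\<dots> = (b \<oplus> t) \<oplus> (\<ominus> s \<oplus> \<ominus> b)" using assms(5) by simp
  also have "\<dots> = (b \<oplus> \<ominus> b) \<oplus> (t \<oplus> \<ominus> s)" using assms(1-4) by (simp add: a_ac)
  also have "\<dots> = t \<ominus> s" using assms by (simp add: a_minus_def r_neg)
  finally show ?thesis .
qed

section \<open>Automorphisms of H fixing g modulo torsion\<close>

context Zp_module
begin

lemma smult_mod_hom: "u \<in> carrier (Zp p) \<Longrightarrow> (\<lambda>x. u \<odot> x) \<in> mod_hom (Zp p) M M"
  by (auto simp: mod_hom_def smult_r_distr smult_comm[of u])

lemma smult_bij:
  assumes "u \<in> punit"
  shows "bij_betw (\<lambda>x. u \<odot> x) (carrier M) (carrier M)"
proof -
  obtain w where w: "w \<in> punit" "w \<boxtimes> u = \<one>\<^bsub>Zp p\<^esub>" using assms punit_inverse by metis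
  note uw = punit_carrier[OF assms] punit_carrier[OF w(1)]
  have 1: "w \<odot> (u \<odot> x) = x" if "x \<in> carrier M" for x
    using smult_assoc1[OF uw(2,1) that] w(2) that by simp
  show ?thesis
    by (rule bij_betwI[of _ _ _ "\<lambda>x. w \<odot> x"]) (use 1 uw smult_comm[OF uw] in auto)
qed

definition shear :: "'a \<Rightarrow> ('a \<Rightarrow> 'a) set"
  where "shear g = {f \<in> extensional (carrier M). f \<in> mod_hom (Zp p) M M
      \<and> bij_betw f (carrier M) (carrier M) \<and> (\<exists>t\<in>tors. f g = g \<oplus> t)}"

abbreviation tors_group
  where "tors_group \<equiv> (add_monoid M)\<lparr>carrier := tors\<rparr>"

lemma tors_zero: "\<zero> \<in> tors"
  using tors_submodule subgroup.one_closed submodule.axioms(1) by fastforce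

lemma tors_add: "s \<in> tors \<Longrightarrow> t \<in> tors \<Longrightarrow> s \<oplus> t \<in> tors"
  using submoduleE(5)[OF tors_submodule] .

lemma tors_neg: "s \<in> tors \<Longrightarrow> \<ominus> s \<in> tors"
  using submoduleE(3)[OF tors_submodule] .

lemma tors_smult: "z \<in> carrier (Zp p) \<Longrightarrow> s \<in> tors \<Longrightarrow> z \<odot> s \<in> tors"
  using submoduleE(4)[OF tors_submodule] .

lemma tors_diff: "s \<in> tors \<Longrightarrow> t \<in> tors \<Longrightarrow> s \<ominus> t \<in> tors"
  by (simp add: a_minus_def tors_add tors_neg)

lemma mod_hom_add: "f \<in> mod_hom (Zp p) M M' \<Longrightarrow> x \<in> carrier M \<Longrightarrow> y \<in> carrier M \<Longrightarrow> f (x \<oplus> y) = f x \<oplus>\<^bsub>M'\<^esub> f y"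
  and mod_hom_smult: "f \<in> mod_hom (Zp p) M M' \<Longrightarrow> a \<in> carrier (Zp p) \<Longrightarrow> x \<in> carrier M \<Longrightarrow> f (a \<odot> x)
      = a \<odot>\<^bsub>M'\<^esub> f x"
  and mod_hom_closed: "f \<in> mod_hom (Zp p) M M' \<Longrightarrow> x \<in> carrier M \<Longrightarrow> f x \<in> carrier M'"
  by (auto simp: mod_hom_def)

lemma mod_hom_zero: "f \<in> mod_hom (Zp p) M M \<Longrightarrow> f \<zero> = \<zero>"
  using mod_hom_smult[of f M "\<zero>\<^bsub>Zp p\<^esub>" "\<zero>"] mod_hom_closed[of f M "\<zero>"] by simp

lemma mod_hom_tors:
  assumes "f \<in> mod_hom (Zp p) M M" "t \<in> tors"
  shows "f t \<in> tors"
proof -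
  obtain a where a: "a \<in> carrier (Zp p)" "a \<noteq> \<zero>\<^bsub>Zp p\<^esub>" "a \<odot> t = \<zero>"
    using assms(2) by (auto simp: torsion_submodule_def)
  have tM: "t \<in> carrier M" using assms(2) by (rule tors_carrier)
  have "a \<odot> f t = \<zero>" using mod_hom_smult[OF assms(1) a(1) tM] a(3) mod_hom_zero[OF assms(1)] by simp
  thus ?thesis using a mod_hom_closed[OF assms(1) tM] by (auto simp: torsion_submodule_def)
qed

end

context split_module
begin

lemma gM [simp]: "g \<in> carrier M"
  using g by (simp add: nontorsion_def)

lemma tM [simp]: "t \<in> tors \<Longrightarrow> t \<in> carrier M"
  by (rule tors_carrier)

lemma split_unique:
  assumes "c \<in> carrier (Zp p)" "d \<in> carrier (Zp p)" "s \<in> tors" "t \<in> tors" "c \<odot> g \<oplus> s = d \<odot> g \<oplus> t"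
  shows "c = d" "s = t"
proof -
  have "c \<odot> g \<ominus> d \<odot> g = t \<ominus> s"
    by (rule M.add_eq_add_diff[OF _ _ _ _ assms(5)]) (use assms in auto)
  hence "(c \<ominus>\<^bsub>Zp p\<^esub> d) \<odot> g \<in> tors" using assms tors_diff by (simp add: smult_l_diff)
  hence "c \<ominus>\<^bsub>Zp p\<^esub> d = \<zero>\<^bsub>Zp p\<^esub>" using nontorsion_smult_tors[OF g] Zp.minus_closed[OF assms(1,2)] by blast
  thus "c = d" using Zp.minus_zeroD assms by blast
  thus "s = t" using assms by simp
qed

lemma nontorsion_line:
  assumes "c \<in> carrier (Zp p)" "c \<noteq> \<zero>\<^bsub>Zp p\<^esub>" "s \<in> tors"
  shows "nontorsion (c \<odot> g \<oplus> s)"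
  unfolding nontorsion_def
proof (intro conjI ballI impI)
  show "c \<odot> g \<oplus> s \<in> carrier M" using assms by simp
  fix z assume z: "z \<in> carrier (Zp p)" "z \<odot> (c \<odot> g \<oplus> s) = \<zero>"
  have "(z \<boxtimes> c) \<odot> g \<oplus> z \<odot> s = \<zero>\<^bsub>Zp p\<^esub> \<odot> g \<oplus> \<zero>"
    using z assms by (simp add: smult_r_distr smult_assoc1)
  hence "z \<boxtimes> c = \<zero>\<^bsub>Zp p\<^esub>"
    using split_unique(1)[of "z \<boxtimes> c" "\<zero>\<^bsub>Zp p\<^esub>" "z \<odot> s" "\<zero>"] z(1) assms tors_smult tors_zero by simp
  thus "z = \<zero>\<^bsub>Zp p\<^esub>" using Zp_domain z(1) assms by blast
qed

lemma card_tors_pos: "card tors > 0"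
  using tors_finite tors_zero by (auto simp: card_gt_0_iff)

lemma finite_auto_tors: "finite (auto tors_group)"
proof -
  have "auto tors_group \<subseteq> tors \<rightarrow>\<^sub>E tors"
    by (auto simp: auto_def Bij_def hom_def PiE_def)
  thus ?thesis by (rule finite_subset) (simp add: finite_PiE tors_finite)
qed

text \<open>On torsion a scalar acts as a natural number, with which any additive map commutes. This
  reconciles the group automorphisms counted by \<open>mu1\<close> with module maps.\<close>

lemma auto_tors_smult:
  assumes \<alpha>: "\<alpha> \<in> auto tors_group" and z: "z \<in> carrier (Zp p)" and s: "s \<in> tors"
  shows "\<alpha> (z \<odot> s) = z \<odot> \<alpha> s"
proof -
  have \<alpha>t: "\<alpha> t \<in> tors" if "t \<in> tors" for t using \<alpha> that by (auto simp: auto_def hom_def)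
  have \<alpha>a: "\<alpha> (t \<oplus> t') = \<alpha> t \<oplus> \<alpha> t'" if "t \<in> tors" "t' \<in> tors" for t t'
    using \<alpha> that by (auto simp: auto_def hom_def)
  have "\<alpha> (\<zero> \<oplus> \<zero>) = \<alpha> \<zero> \<oplus> \<alpha> \<zero>" using \<alpha>a tors_zero by blast
  hence \<alpha>0: "\<alpha> \<zero> = \<zero>" using \<alpha>t[OF tors_zero] by (simp add: M.add.r_cancel_one)
  have nat: "padic_of_int p (int n) \<odot> t \<in> tors \<and> \<alpha> (padic_of_int p (int n) \<odot> t)
      = padic_of_int p (int n) \<odot> \<alpha> t"
    if t: "t \<in> tors" for n t
  proof (induction n)
    case 0
    show ?case using t \<alpha>0 \<alpha>t tors_zero by (simp add: Zp_zero_conv[symmetric])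
  next
    case (Suc n)
    have "padic_of_int p (int (Suc n)) = padic_of_int p (int n) \<boxplus> \<one>\<^bsub>Zp p\<^esub>"
      by (simp add: Zp_one_conv padic_of_int_add[symmetric] add.commute)
    thus ?case using Suc t \<alpha>t \<alpha>a tors_add by (simp add: smult_l_distr)
  qed
  have zN: "z N = int (nat (z N))" using z by (simp add: Zp_carrier_iff)
  have "z \<odot> s = padic_of_int p (int (nat (z N))) \<odot> s" "z \<odot> \<alpha> s = padic_of_int p (int (nat (z N))) \<odot> \<alpha> s"
    using smult_killed[OF tM[OF s] z tors_killed[OF s]] smult_killed[OF tM[OF \<alpha>t[OF s]] z
        tors_killed[OF \<alpha>t[OF s]]] zN
    by simp_all
  thus ?thesis using nat[OF s, of "nat (z N)"] by metis
qed

lemma shear_tors_bij: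
  assumes "f \<in> shear g"
  shows "bij_betw f tors tors"
proof -
  have f: "f \<in> mod_hom (Zp p) M M" "inj_on f (carrier M)"
    using assms by (auto simp: shear_def bij_betw_def)
  have inj: "inj_on f tors" using f(2) by (rule inj_on_subset) auto
  have "f ` tors \<subseteq> tors" using mod_hom_tors[OF f(1)] by blast
  hence "f ` tors = tors" using endo_inj_surj[OF tors_finite] inj by blast
  thus ?thesis using inj by (simp add: bij_betw_def)
qed

text \<open>The map is f (c g + s) = c (g + t) + \<alpha> s. It is triangular: the coefficient of g
  is kept, while the torsion part goes through \<alpha> and is shifted by c t. Bijectivity therefore
  reduces to that of \<alpha>.\<close>

lemma shear_extend:
  assumes t: "t \<in> tors" and \<alpha>: "\<alpha> \<in> auto tors_group"
  shows "\<exists>f\<in>shear g. f g = g \<oplus> t \<and> restrict f tors = \<alpha>"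
proof -
  have \<alpha>t: "\<alpha> s \<in> tors" if "s \<in> tors" for s using \<alpha> that by (auto simp: auto_def hom_def)
  have \<alpha>a: "\<alpha> (s \<oplus> s') = \<alpha> s \<oplus> \<alpha> s'" if "s \<in> tors" "s' \<in> tors" for s s'
    using \<alpha> that by (auto simp: auto_def hom_def)
  have \<alpha>b: "bij_betw \<alpha> tors tors" "\<alpha> \<in> extensional tors" using \<alpha> by (auto simp: auto_def Bij_def)
  have "\<alpha> (\<zero> \<oplus> \<zero>) = \<alpha> \<zero> \<oplus> \<alpha> \<zero>" using \<alpha>a tors_zero by blast
  hence \<alpha>0: "\<alpha> \<zero> = \<zero>" using \<alpha>t[OF tors_zero] by (simp add: M.add.r_cancel_one)
  have "\<exists>cs. fst cs \<in> carrier (Zp p) \<and> snd cs \<in> tors \<and> x = fst cs \<odot> g \<oplus> snd cs"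
      if x: "x \<in> carrier M" for x
    using split[OF x] by (metis fst_conv snd_conv)
  then obtain cs where cs: "\<And>x. x \<in> carrier M \<Longrightarrow> fst (cs x) \<in> carrier (Zp p) \<and> snd (cs x) \<in> tors \<and> x
      = fst (cs x) \<odot> g \<oplus> snd (cs x)"
    by metis
  define f where "f = (\<lambda>x\<in>carrier M. fst (cs x) \<odot> (g \<oplus> t) \<oplus> \<alpha> (snd (cs x)))"
  have f: "f (c \<odot> g \<oplus> s) = c \<odot> (g \<oplus> t) \<oplus> \<alpha> s" if "c \<in> carrier (Zp p)" "s \<in> tors" for c s
  proof -
    have x: "c \<odot> g \<oplus> s \<in> carrier M" using that by simp
    have "c = fst (cs (c \<odot> g \<oplus> s))" "s = snd (cs (c \<odot> g \<oplus> s))"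
      using split_unique[of c "fst (cs (c \<odot> g \<oplus> s))" s "snd (cs (c \<odot> g \<oplus> s))"] cs[OF x] that by auto
    thus ?thesis using x unfolding f_def by simp
  qed
  have f': "f (c \<odot> g \<oplus> s) = c \<odot> g \<oplus> (c \<odot> t \<oplus> \<alpha> s)" if "c \<in> carrier (Zp p)" "s \<in> tors" for c s
    using f[OF that] that t \<alpha>t by (simp add: smult_r_distr M.a_assoc)
  have fg: "f g = g \<oplus> t" using f[of "\<one>\<^bsub>Zp p\<^esub>" "\<zero>"] t tors_zero \<alpha>0 by simp
  have fs: "f s = \<alpha> s" if "s \<in> tors" for s using f[of "\<zero>\<^bsub>Zp p\<^esub>" s] that t \<alpha>t by simp
  have fM: "f x \<in> carrier M" if "x \<in> carrier M" for x using that cs[OF that] t \<alpha>t by (simp add: f_def)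
  have "f \<in> mod_hom (Zp p) M M"
    unfolding mod_hom_def
  proof (intro CollectI conjI ballI)
    show "f \<in> carrier M \<rightarrow> carrier M" using fM by blast
    fix x assume "x \<in> carrier M"
    then obtain c s where x: "c \<in> carrier (Zp p)" "s \<in> tors" "x = c \<odot> g \<oplus> s" using split by blast
    {
      fix y assume "y \<in> carrier M"
      then obtain d u where y: "d \<in> carrier (Zp p)" "u \<in> tors" "y = d \<odot> g \<oplus> u" using split by blast
      have "x \<oplus> y = (c \<boxplus> d) \<odot> g \<oplus> (s \<oplus> u)" using x y by (simp add: smult_l_distr M.a_ac)
      hence "f (x \<oplus> y) = (c \<boxplus> d) \<odot> (g \<oplus> t) \<oplus> \<alpha> (s \<oplus> u)" using f x(1,2) y(1,2) tors_add by simp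
      also have "\<dots> = f x \<oplus> f y"
        unfolding x(3) y(3) f[OF x(1,2)] f[OF y(1,2)]
        using x(1,2) y(1,2) t \<alpha>t by (simp add: \<alpha>a smult_l_distr M.a_ac)
      finally show "f (x \<oplus> y) = f x \<oplus> f y" .
    }
    fix a assume a: "a \<in> carrier (Zp p)"
    have "a \<odot> x = (a \<boxtimes> c) \<odot> g \<oplus> a \<odot> s" using x a by (simp add: smult_r_distr smult_assoc1)
    hence "f (a \<odot> x) = (a \<boxtimes> c) \<odot> (g \<oplus> t) \<oplus> \<alpha> (a \<odot> s)" using f x(1,2) a tors_smult by simp
    also have "\<dots> = a \<odot> f x"
      unfolding x(3) f[OF x(1,2)] using x(1,2) a t \<alpha>t
      by (simp add: auto_tors_smult[OF \<alpha>] smult_assoc1 smult_r_distr)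
    finally show "f (a \<odot> x) = a \<odot> f x" .
  qed
  moreover have "bij_betw f (carrier M) (carrier M)"
    unfolding bij_betw_def
  proof
    show "inj_on f (carrier M)"
    proof (rule inj_onI)
      fix x y assume xy: "x \<in> carrier M" "y \<in> carrier M" "f x = f y"
      obtain c s where x: "c \<in> carrier (Zp p)" "s \<in> tors" "x = c \<odot> g \<oplus> s" using split xy by blast
      obtain d u where y: "d \<in> carrier (Zp p)" "u \<in> tors" "y = d \<odot> g \<oplus> u" using split xy by blast
      have eq: "c \<odot> g \<oplus> (c \<odot> t \<oplus> \<alpha> s) = d \<odot> g \<oplus> (d \<odot> t \<oplus> \<alpha> u)"
        using xy(3) f'[OF x(1,2)] f'[OF y(1,2)] x(3) y(3) by simp
      have T: "c \<odot> t \<oplus> \<alpha> s \<in> tors" "d \<odot> t \<oplus> \<alpha> u \<in> tors"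
        using x y t \<alpha>t tors_add tors_smult by auto
      have "c = d" using split_unique(1)[OF x(1) y(1) T eq] .
      moreover have "c \<odot> t \<oplus> \<alpha> s = d \<odot> t \<oplus> \<alpha> u" using split_unique(2)[OF x(1) y(1) T eq] .
      ultimately have "\<alpha> s = \<alpha> u" using x y t \<alpha>t by simp
      hence "s = u" using \<alpha>b(1) x y by (auto simp: bij_betw_def inj_on_def)
      thus "x = y" using \<open>c = d\<close> x y by simp
    qed
    have "y \<in> f ` carrier M" if y: "y \<in> carrier M" for y
    proof -
      obtain c s where cs: "c \<in> carrier (Zp p)" "s \<in> tors" "y = c \<odot> g \<oplus> s" using split[OF y] by blast
      have "s \<ominus> c \<odot> t \<in> tors" using cs t tors_diff tors_smult by blast
      then obtain u where u: "u \<in> tors" "\<alpha> u = s \<ominus> c \<odot> t"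
        using \<alpha>b(1) by (metis bij_betw_imp_surj_on imageE)
      have "f (c \<odot> g \<oplus> u) = c \<odot> g \<oplus> (c \<odot> t \<oplus> (s \<ominus> c \<odot> t))" using f'[OF cs(1) u(1)] u(2) by simp
      also have "c \<odot> t \<oplus> (s \<ominus> c \<odot> t) = s" using M.minus_eqD[of s "c \<odot> t", OF _ _ refl] cs t by simp
      finally show ?thesis using cs u(1) by (intro image_eqI[of _ _ "c \<odot> g \<oplus> u"]) auto
    qed
    thus "f ` carrier M = carrier M" using fM by blast
  qed
  moreover have "f \<in> extensional (carrier M)" by (simp add: f_def)
  ultimately have "f \<in> shear g" unfolding shear_def using fg t by blast
  moreover have "restrict f tors = \<alpha>"
    by (rule extensionalityI[of _ tors]) (use \<alpha>b fs in auto)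
  ultimately show ?thesis using fg by blast
qed

text \<open>The displacement of g within T and the restriction to T determine such an automorphism
  and can be prescribed freely.\<close>

lemma card_shear: "card (shear g) = card tors * card (auto tors_group)"
proof -
  have b: "bij_betw (\<lambda>f. (f g \<ominus> g, restrict f tors)) (shear g) (tors \<times> auto tors_group)"
    unfolding bij_betw_def
  proof
    show "inj_on (\<lambda>f. (f g \<ominus> g, restrict f tors)) (shear g)"
    proof (rule inj_onI)
      fix f f' assume f: "f \<in> shear g" and f': "f' \<in> shear g"
        and eq: "(f g \<ominus> g, restrict f tors) = (f' g \<ominus> g, restrict f' tors)"
      have h: "f \<in> mod_hom (Zp p) M M" "f' \<in> mod_hom (Zp p) M M" "f \<in> extensional (carrier M)"
          "f' \<in> extensional (carrier M)"
        using f f' by (auto simp: shear_def)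
      have c: "f g \<in> carrier M" "f' g \<in> carrier M"
        using mod_hom_closed[OF h(1) gM] mod_hom_closed[OF h(2) gM] .
      have "f g = g \<oplus> (f g \<ominus> g)" using M.minus_eqD[OF c(1) gM refl] .
      also have "\<dots> = g \<oplus> (f' g \<ominus> g)" using eq by simp
      also have "\<dots> = f' g" using M.minus_eqD[OF c(2) gM refl] by simp
      finally have fg: "f g = f' g" .
      have fs: "f s = f' s" if "s \<in> tors" for s using eq that by (metis prod.inject restrict_apply')
      have "f x = f' x" if x: "x \<in> carrier M" for x
      proof -
        obtain c s where cs: "c \<in> carrier (Zp p)" "s \<in> tors" "x = c \<odot> g \<oplus> s" using split[OF x] by blast
        have lin: "\<phi> x = c \<odot> \<phi> g \<oplus> \<phi> s" if "\<phi> \<in> mod_hom (Zp p) M M" for \<phi>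
          unfolding cs(3) using mod_hom_add[OF that, of "c \<odot> g" s] mod_hom_smult[OF that cs(1) gM]
              cs(1,2) by simp
        show ?thesis using lin[OF h(1)] lin[OF h(2)] fg fs[OF cs(2)] by simp
      qed
      thus "f = f'" using h(3,4) by (intro extensionalityI[of _ "carrier M"])
    qed
    show "(\<lambda>f. (f g \<ominus> g, restrict f tors)) ` shear g = tors \<times> auto tors_group"
    proof (intro equalityI subsetI)
      fix y assume "y \<in> (\<lambda>f. (f g \<ominus> g, restrict f tors)) ` shear g"
      then obtain f where f: "f \<in> shear g" "y = (f g \<ominus> g, restrict f tors)" by blast
      obtain t where t: "t \<in> tors" "f g = g \<oplus> t" using f(1) by (auto simp: shear_def)
      have "f g \<ominus> g = t"
        unfolding t(2) using t(1) by (simp add: a_minus_def M.a_assoc M.a_comm[of _ "\<ominus> g"] M.r_neg1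
            M.r_neg2)
      hence "f g \<ominus> g \<in> tors" using t by simp
      moreover have "restrict f tors \<in> auto tors_group"
      proof -
        have h: "f \<in> mod_hom (Zp p) M M" using f by (simp add: shear_def)
        have b: "bij_betw (restrict f tors) tors tors"
          using shear_tors_bij[OF f(1)] by (simp add: bij_betw_restrict_eq)
        have "restrict f tors \<in> hom tors_group tors_group"
          by (rule homI) (auto simp: mod_hom_tors[OF h] tors_add mod_hom_add[OF h])
        thus ?thesis using b by (simp add: auto_def Bij_def)
      qed
      ultimately show "y \<in> tors \<times> auto tors_group" using f(2) by simp
    next
      fix y assume "y \<in> tors \<times> auto tors_group"
      then obtain t \<alpha> where y: "y = (t, \<alpha>)" "t \<in> tors" "\<alpha> \<in> auto tors_group" by blast
      obtain f where f: "f \<in> shear g" "f g = g \<oplus> t" "restrict f tors = \<alpha>"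
        using shear_extend[OF y(2,3)] by blast
      have "f g \<ominus> g = t"
        unfolding f(2) using y(2) by (simp add: a_minus_def M.a_assoc M.a_comm[of _ "\<ominus> g"] M.r_neg1
            M.r_neg2)
      thus "y \<in> (\<lambda>f. (f g \<ominus> g, restrict f tors)) ` shear g"
        using f y by (intro image_eqI[of _ _ f]) auto
    qed
  qed
  show "card (shear g) = card tors * card (auto tors_group)"
    unfolding bij_betw_same_card[OF b] by (rule card_cartesian_product)
qed

end

section \<open>Surjections onto G with prescribed kernel\<close>

context p_group
begin

text \<open>Both images of e stand in the relation \<open>ext_rel\<close> to e, and the partner is
  unique. In \<open>card_fibre\<close> this recovers a shear from its effect on a structure.\<close>

lemma ext_iso_unique:
  assumes M: "Zp_module p M" and M': "Zp_module p M'"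
    and ext: "ext_pair p G M h q" and ext': "ext_pair p G M' h' q'"
    and ch: "is_char p k M h q \<xi>" "is_char p k M' h' q' \<xi>"
    and f: "f \<in> mod_hom (Zp p) M M'" "f h = h'" "\<And>e. e \<in> carrier M \<Longrightarrow> q' (f e) = q e"
    and f': "f' \<in> mod_hom (Zp p) M M'" "f' h = h'" "\<And>e. e \<in> carrier M \<Longrightarrow> q' (f' e) = q e"
    and e: "e \<in> carrier M"
  shows "f e = f' e"
proof -
  interpret M: Zp_module p M by (rule M)
  have R: "ext_rel p k M h q M' h' q' e (\<phi> e)"
    if \<phi>: "\<phi> \<in> mod_hom (Zp p) M M'" "\<phi> h = h'" "\<And>e. e \<in> carrier M \<Longrightarrow> q' (\<phi> e) = q e" for \<phi>
  proof -
    obtain z where z: "z \<in> carrier (Zp p)" "pw k \<odot>\<^bsub>M\<^esub> e = z \<odot>\<^bsub>M\<^esub> h" using ext_pw[OF M ext e] by blast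
    have "pw k \<odot>\<^bsub>M'\<^esub> \<phi> e = \<phi> (z \<odot>\<^bsub>M\<^esub> h)" using M.mod_hom_smult[OF \<phi>(1) padic_of_int_closed e] z(2) by metis
    also have "\<dots> = z \<odot>\<^bsub>M'\<^esub> h'" using M.mod_hom_smult[OF \<phi>(1) z(1) ext_hM[OF M ext]] \<phi>(2) by metis
    finally show ?thesis
      unfolding ext_rel_def using e z \<phi>(3)[OF e] M.mod_hom_closed[OF \<phi>(1) e] by blast
  qed
  show ?thesis
    using ext_rel_ex1[OF M M' ext ext' ch e] R[OF f] R[OF f'] by blast
qed

definition quotient_maps :: "(padic, 'a) module \<Rightarrow> 'a \<Rightarrow> ('a \<Rightarrow> 'g) set"
  where "quotient_maps M h = {q \<in> extensional (carrier M). ext_pair p G M h q}"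

lemma finite_auto: "finite (auto G)"
proof -
  have "auto G \<subseteq> carrier G \<rightarrow>\<^sub>E carrier G"
    by (auto simp: auto_def Bij_def hom_def PiE_def)
  thus ?thesis by (rule finite_subset) (simp add: finite_PiE finG)
qed

context
  fixes M :: "(padic, 'a) module" and h
  assumes M: "Zp_module p M" and hM: "h \<in> carrier M"
begin

interpretation M: Zp_module p M by (rule M)

lemma cyc_subgroup: "subgroup (M.cyc h) (add_monoid M)"
  using M.cyc_submodule[OF hM] by (rule submodule.axioms(1))

lemma cyc_normal: "M.cyc h \<lhd> add_monoid M"
  using comm_group.normal_iff_subgroup[OF M.a_comm_group] cyc_subgroup by blast

text \<open>The projection modulo Zp h followed by the isomorphism. It is stated for every h,
  torsion or not, because \<open>presents_nontorsion\<close> uses it to exclude torsion h.\<close>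

lemma quotient_iso_hom:
  assumes "(add_monoid M Mod M.cyc h) \<cong> G"
  shows "\<exists>q \<in> extensional (carrier M). q \<in> hom (add_monoid M) G \<and> q ` carrier M = carrier G \<and>
    (\<forall>e\<in>carrier M. q e = \<one>\<^bsub>G\<^esub> \<longleftrightarrow> (\<exists>z\<in>carrier (Zp p). e = z \<odot>\<^bsub>M\<^esub> h))"
proof -
  obtain \<phi> where \<phi>: "\<phi> \<in> iso (add_monoid M Mod M.cyc h) G" using assms by (auto simp: is_iso_def)
  interpret N: normal "M.cyc h" "add_monoid M" by (rule cyc_normal)
  let ?c = "\<lambda>x. M.cyc h #>\<^bsub>add_monoid M\<^esub> x"
  have c: "?c \<in> hom (add_monoid M) (add_monoid M Mod M.cyc h)" by (rule N.r_coset_hom_Mod)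
  have \<phi>h: "\<phi> \<in> hom (add_monoid M Mod M.cyc h) G"
    and \<phi>b: "bij_betw \<phi> (carrier (add_monoid M Mod M.cyc h)) (carrier G)"
    using \<phi> by (auto simp: iso_def)
  have comp: "(\<lambda>x. \<phi> (?c x)) \<in> hom (add_monoid M) G"
    using hom_compose[OF c \<phi>h] by (simp add: comp_def)
  define q where "q = restrict (\<lambda>x. \<phi> (?c x)) (carrier M)"
  have q: "q x = \<phi> (?c x)" if "x \<in> carrier M" for x using that by (simp add: q_def)
  have "q \<in> hom (add_monoid M) G"
    using comp by (auto simp: hom_def q)
  moreover have "q ` carrier M = carrier G"
  proof -
    have "q ` carrier M = \<phi> ` (?c ` carrier M)" using q by (auto simp: image_iff)
    also have "?c ` carrier M = carrier (add_monoid M Mod M.cyc h)" by (simp add: carrier_FactGroup)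
    finally show ?thesis using \<phi>b by (simp add: bij_betw_def)
  qed
  moreover have "q e = \<one>\<^bsub>G\<^esub> \<longleftrightarrow> (\<exists>z\<in>carrier (Zp p). e = z \<odot>\<^bsub>M\<^esub> h)" if e: "e \<in> carrier M" for e
  proof -
    have ce: "?c e \<in> carrier (add_monoid M Mod M.cyc h)" using e by (simp add: carrier_FactGroup)
    have one: "\<phi> (M.cyc h) = \<one>\<^bsub>G\<^esub>"
      using hom_one[OF \<phi>h N.factorgroup_is_group G.is_group] by simp
    have "M.cyc h \<in> carrier (add_monoid M Mod M.cyc h)"
      using group.is_monoid[OF N.factorgroup_is_group] monoid.one_closed by fastforce
    hence "q e = \<one>\<^bsub>G\<^esub> \<longleftrightarrow> ?c e = M.cyc h"
      using q[OF e] one ce \<phi>b by (auto simp: bij_betw_def inj_on_def)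
    also have "\<dots> \<longleftrightarrow> e \<in> M.cyc h"
      using group.coset_join1[OF M.a_group _ _ cyc_subgroup] group.coset_join2[OF M.a_group _
          cyc_subgroup] e
      by auto
    finally show ?thesis by (auto simp: M.cyc_def)
  qed
  moreover have "q \<in> extensional (carrier M)" by (simp add: q_def)
  ultimately show ?thesis by blast
qed

end

context
  fixes M :: "(padic, 'a) module" and h
  assumes M: "Zp_module p M" and h: "Zp_module.nontorsion p M h"
begin

interpretation M: Zp_module p M by (rule M)

lemma nontorsion_mem: "h \<in> carrier M"
  using h by (simp add: M.nontorsion_def)

lemma quotient_maps_iff:
  "quotient_maps M h \<noteq> {} \<longleftrightarrow> (add_monoid M Mod M.cyc h) \<cong> G"
proof
  assume "quotient_maps M h \<noteq> {}"
  then obtain q where ext: "ext_pair p G M h q" by (auto simp: quotient_maps_def)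
  interpret q: group_hom "add_monoid M" G q
    using ext M.a_group G.is_group by (simp add: group_hom_def group_hom_axioms_def ext_pair_def)
  have "kernel (add_monoid M) G q = M.cyc h"
    using ext_q_ker[OF M ext] nontorsion_mem by (auto simp: kernel_def M.cyc_def)
  thus "(add_monoid M Mod M.cyc h) \<cong> G"
    using q.FactGroup_iso ext by (simp add: ext_pair_def)
next
  assume "(add_monoid M Mod M.cyc h) \<cong> G"
  from quotient_iso_hom[OF M nontorsion_mem this] show "quotient_maps M h \<noteq> {}"
    using h unfolding quotient_maps_def ext_pair_def M.nontorsion_def by blast
qed

text \<open>Two surjections with the same kernel Zp h have the same fibres (\<open>imp\<close>), so
  q factors through q0 by an automorphism of G, defined with the help of a section r of q0.\<close>

lemma quotient_maps_bij:
  assumes q0: "q0 \<in> quotient_maps M h"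
  shows "bij_betw (\<lambda>\<alpha>. restrict (\<lambda>e. \<alpha> (q0 e)) (carrier M)) (auto G) (quotient_maps M h)"
  unfolding bij_betw_def
proof
  have ext0: "ext_pair p G M h q0" using q0 by (simp add: quotient_maps_def)
  have q0G: "q0 e \<in> carrier G" if "e \<in> carrier M" for e using ext_q_closed[OF M ext0 that] .
  show "inj_on (\<lambda>\<alpha>. restrict (\<lambda>e. \<alpha> (q0 e)) (carrier M)) (auto G)"
  proof (rule inj_onI)
    fix \<alpha> \<beta> assume \<alpha>\<beta>: "\<alpha> \<in> auto G" "\<beta> \<in> auto G"
      and eq: "restrict (\<lambda>e. \<alpha> (q0 e)) (carrier M) = restrict (\<lambda>e. \<beta> (q0 e)) (carrier M)"
    show "\<alpha> = \<beta>"
    proof (rule extensionalityI[of _ "carrier G"])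
      show "\<alpha> \<in> extensional (carrier G)" "\<beta> \<in> extensional (carrier G)"
        using \<alpha>\<beta> by (auto simp: auto_def Bij_def)
      fix y assume "y \<in> carrier G"
      then obtain e where "e \<in> carrier M" "q0 e = y" using ext_q_surj[OF M ext0] by blast
      thus "\<alpha> y = \<beta> y" using fun_cong[OF eq, of e] by simp
    qed
  qed
  show "(\<lambda>\<alpha>. restrict (\<lambda>e. \<alpha> (q0 e)) (carrier M)) ` auto G = quotient_maps M h"
  proof (intro equalityI subsetI)
    fix q assume "q \<in> (\<lambda>\<alpha>. restrict (\<lambda>e. \<alpha> (q0 e)) (carrier M)) ` auto G"
    then obtain \<alpha> where \<alpha>: "\<alpha> \<in> auto G" "q = restrict (\<lambda>e. \<alpha> (q0 e)) (carrier M)" by blast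
    have \<alpha>h: "\<alpha> \<in> hom G G" and \<alpha>b: "bij_betw \<alpha> (carrier G) (carrier G)"
      using \<alpha> by (auto simp: auto_def Bij_def)
    have q: "q e = \<alpha> (q0 e)" if "e \<in> carrier M" for e using that \<alpha> by simp
    have "q \<in> hom (add_monoid M) G"
    proof (rule homI)
      fix x y assume "x \<in> carrier (add_monoid M)" "y \<in> carrier (add_monoid M)"
      hence xy: "x \<in> carrier M" "y \<in> carrier M" by simp_all
      show "q x \<in> carrier G" using q[OF xy(1)] \<alpha>h q0G[OF xy(1)] by (auto simp: hom_def)
      have "q (x \<oplus>\<^bsub>M\<^esub> y) = \<alpha> (q0 x \<otimes>\<^bsub>G\<^esub> q0 y)" using q[of "x \<oplus>\<^bsub>M\<^esub> y"] xy ext_q_add[OF M ext0 xy] by simp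
      thus "q (x \<otimes>\<^bsub>add_monoid M\<^esub> y) = q x \<otimes>\<^bsub>G\<^esub> q y"
        using \<alpha>h q0G xy q by (simp add: hom_def)
    qed
    moreover have "q ` carrier M = carrier G"
    proof -
      have "q ` carrier M = \<alpha> ` (q0 ` carrier M)" using q by (auto simp: image_iff)
      thus ?thesis using ext0 \<alpha>b by (simp add: ext_pair_def bij_betw_def)
    qed
    moreover have "q e = \<one>\<^bsub>G\<^esub> \<longleftrightarrow> (\<exists>z\<in>carrier (Zp p). e = z \<odot>\<^bsub>M\<^esub> h)" if e: "e \<in> carrier M" for e
    proof -
      have "\<alpha> \<one>\<^bsub>G\<^esub> = \<one>\<^bsub>G\<^esub>" using hom_one[OF \<alpha>h G.is_group G.is_group] .
      hence "q e = \<one>\<^bsub>G\<^esub> \<longleftrightarrow> q0 e = \<one>\<^bsub>G\<^esub>"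
        using q[OF e] q0G[OF e] \<alpha>b G.one_closed unfolding bij_betw_def inj_on_def by metis
      thus ?thesis using ext_q_ker[OF M ext0 e] by simp
    qed
    ultimately have "ext_pair p G M h q"
      using h unfolding ext_pair_def M.nontorsion_def by blast
    thus "q \<in> quotient_maps M h" using \<alpha>(2) by (simp add: quotient_maps_def)
  next
    fix q assume "q \<in> quotient_maps M h"
    hence ext: "ext_pair p G M h q" and qe: "q \<in> extensional (carrier M)"
      by (auto simp: quotient_maps_def)
    have imp: "q2 e = q2 f"
      if q12: "ext_pair p G M h q1" "ext_pair p G M h q2" and ef: "e \<in> carrier M" "f \<in> carrier M"
          "q1 e = q1 f" for q1 q2 e f
    proof -
      obtain w where w: "w \<in> carrier (Zp p)" "e = f \<oplus>\<^bsub>M\<^esub> w \<odot>\<^bsub>M\<^esub> h" using ext_diff[OF M q12(1) ef] by blast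
      have "w \<odot>\<^bsub>M\<^esub> h \<in> carrier M" using w nontorsion_mem by simp
      moreover have "q2 (w \<odot>\<^bsub>M\<^esub> h) = \<one>\<^bsub>G\<^esub>" using ext_q_ker[OF M q12(2) \<open>w \<odot>\<^bsub>M\<^esub> h \<in> carrier M\<close>] w by blast
      ultimately show ?thesis
        unfolding w(2) using ext_q_add[OF M q12(2) ef(2)] ext_q_closed[OF M q12(2) ef(2)] by simp
    qed
    have qG: "q e \<in> carrier G" if "e \<in> carrier M" for e using ext_q_closed[OF M ext that] .
    obtain r where r: "\<And>y. y \<in> carrier G \<Longrightarrow> r y \<in> carrier M \<and> q0 (r y) = y"
      using ext_q_surj[OF M ext0] by metis
    define \<alpha> where "\<alpha> = (\<lambda>y\<in>carrier G. q (r y))"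
    have \<alpha>: "\<alpha> (q0 e) = q e" if e: "e \<in> carrier M" for e
    proof -
      have "q (r (q0 e)) = q e" using imp[OF ext0 ext _ e] r[OF q0G[OF e]] by blast
      thus ?thesis using q0G[OF e] by (simp add: \<alpha>_def)
    qed
    have "\<alpha> \<in> hom G G"
    proof (rule homI)
      fix x y assume xy: "x \<in> carrier G" "y \<in> carrier G"
      show "\<alpha> x \<in> carrier G" using xy r qG by (simp add: \<alpha>_def)
      have "x \<otimes>\<^bsub>G\<^esub> y = q0 (r x \<oplus>\<^bsub>M\<^esub> r y)" using r xy ext_q_add[OF M ext0] by simp
      hence "\<alpha> (x \<otimes>\<^bsub>G\<^esub> y) = q (r x \<oplus>\<^bsub>M\<^esub> r y)" using \<alpha> r xy by simp
      also have "\<dots> = \<alpha> x \<otimes>\<^bsub>G\<^esub> \<alpha> y" using ext_q_add[OF M ext] r xy by (simp add: \<alpha>_def)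
      finally show "\<alpha> (x \<otimes>\<^bsub>G\<^esub> y) = \<alpha> x \<otimes>\<^bsub>G\<^esub> \<alpha> y" .
    qed
    moreover have "inj_on \<alpha> (carrier G)"
    proof (rule inj_onI)
      fix x y assume xy: "x \<in> carrier G" "y \<in> carrier G" "\<alpha> x = \<alpha> y"
      hence "q (r x) = q (r y)" by (simp add: \<alpha>_def)
      hence "q0 (r x) = q0 (r y)" using imp[OF ext ext0] r xy by blast
      thus "x = y" using r xy by simp
    qed
    moreover have "\<alpha> ` carrier G = carrier G"
    proof (intro equalityI subsetI)
      fix y assume "y \<in> carrier G"
      then obtain e where "e \<in> carrier M" "q e = y" using ext_q_surj[OF M ext] by blast
      thus "y \<in> \<alpha> ` carrier G" using \<alpha> q0G by (metis image_eqI)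
    qed (use r qG in \<open>auto simp: \<alpha>_def\<close>)
    moreover have "\<alpha> \<in> extensional (carrier G)" by (simp add: \<alpha>_def)
    ultimately have "\<alpha> \<in> auto G" by (simp add: auto_def Bij_def bij_betw_def)
    moreover have "q = restrict (\<lambda>e. \<alpha> (q0 e)) (carrier M)"
      by (rule extensionalityI[OF qe]) (use \<alpha> in auto)
    ultimately show "q \<in> (\<lambda>\<alpha>. restrict (\<lambda>e. \<alpha> (q0 e)) (carrier M)) ` auto G" by blast
  qed
qed

lemma finite_quotient_maps: "finite (quotient_maps M h)"
  using quotient_maps_bij bij_betw_finite finite_auto by (cases "quotient_maps M h = {}") auto

lemma card_quotient_maps:
  "card (quotient_maps M h) = (if (add_monoid M Mod M.cyc h) \<cong> G then card (auto G) else 0)"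
proof (cases "quotient_maps M h = {}")
  case True
  thus ?thesis using quotient_maps_iff by simp
next
  case False
  then obtain q0 where "q0 \<in> quotient_maps M h" by blast
  hence "card (auto G) = card (quotient_maps M h)" by (intro bij_betw_same_card[OF quotient_maps_bij])
  thus ?thesis using quotient_maps_iff False by simp
qed

end

end

section \<open>Double counting of normalized extensions\<close>

locale split_p_group = split_module p M g N + p_group p G k
  for p and M :: "(padic, 'a) module" (structure) and g :: 'a and N :: nat
    and G :: "'g monoid" and k :: nat
begin

abbreviation line :: "nat \<Rightarrow> 'a \<Rightarrow> 'a" where "line v s \<equiv> pw v \<odot> g \<oplus> s"

lemma line_nontorsion: "s \<in> tors \<Longrightarrow> nontorsion (line v s)"
  using nontorsion_line pw_nonzero by simp

text \<open>The elements j g + t with 0 \<le> j < p^v and t torsion represent each class modulo Zp h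
  exactly once. This pins down v independently of u and s.\<close>

lemma order_line:
  assumes ext: "ext_pair p G M h q" and h: "h = (pw v \<boxtimes> u) \<odot> g \<oplus> s" and u: "u \<in> punit" and s: "s \<in> tors"
  shows "p ^ k = p ^ v * card tors"
proof -
  note E = Zp_module_axioms ext
  have uc: "u \<in> carrier (Zp p)" using u by (rule punit_carrier)
  have wh: "w \<odot> h = (pw v \<boxtimes> (w \<boxtimes> u)) \<odot> g \<oplus> w \<odot> s" if "w \<in> carrier (Zp p)" for w
    unfolding h using that uc s by (simp add: smult_r_distr smult_assoc1 Zp.m_lcomm[of "pw v" w])
  let ?f = "\<lambda>(j, t). q (padic_of_int p (int j) \<odot> g \<oplus> t)"
  have "bij_betw ?f ({..<p ^ v} \<times> tors) (carrier G)"
    unfolding bij_betw_def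
  proof
    show "inj_on ?f ({..<p ^ v} \<times> tors)"
    proof (rule inj_onI, clarify)
      fix i j t t' assume i: "i < p ^ v" and j: "j < p ^ v" and t: "t \<in> tors" "t' \<in> tors"
        and eq: "q (padic_of_int p (int i) \<odot> g \<oplus> t) = q (padic_of_int p (int j) \<odot> g \<oplus> t')"
      obtain w where w: "w \<in> carrier (Zp p)"
          "padic_of_int p (int i) \<odot> g \<oplus> t = padic_of_int p (int j) \<odot> g \<oplus> t' \<oplus> w \<odot> h"
        using ext_diff[OF E _ _ eq] t by auto
      have "padic_of_int p (int j) \<odot> g \<oplus> t' \<oplus> w \<odot> h =
          (padic_of_int p (int j) \<boxplus> pw v \<boxtimes> (w \<boxtimes> u)) \<odot> g \<oplus> (t' \<oplus> w \<odot> s)"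
        unfolding wh[OF w(1)] using w(1) uc s t by (simp add: smult_l_distr M.a_ac)
      hence eq2: "padic_of_int p (int i) \<odot> g \<oplus> t =
          (padic_of_int p (int j) \<boxplus> pw v \<boxtimes> (w \<boxtimes> u)) \<odot> g \<oplus> (t' \<oplus> w \<odot> s)" using w(2) by simp
      have T: "t' \<oplus> w \<odot> s \<in> tors" using t s w(1) tors_add tors_smult by blast
      have C: "padic_of_int p (int j) \<boxplus> pw v \<boxtimes> (w \<boxtimes> u) \<in> carrier (Zp p)" using w(1) uc by simp
      have 1: "padic_of_int p (int i) = padic_of_int p (int j) \<boxplus> pw v \<boxtimes> (w \<boxtimes> u)"
        and 2: "t = t' \<oplus> w \<odot> s"
        using split_unique[OF padic_of_int_closed C t(1) T eq2] by auto
      have "int i mod int p ^ v = (int j mod int p ^ v + (pw v \<boxtimes> (w \<boxtimes> u)) v) mod int p ^ v"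
        using fun_cong[OF 1, of v] by (simp only: Zp_nth(3)) (simp add: padic_of_int_def)
      hence "int i mod int p ^ v = int j mod int p ^ v" by (simp add: Zp_nth_pw_mult)
      hence "int i = int j" using i j by (simp flip: of_nat_power)
      hence ij: "i = j" by simp
      have "pw v \<boxtimes> (w \<boxtimes> u) = \<zero>\<^bsub>Zp p\<^esub>"
        using 1 ij w(1) uc Zp.add.r_cancel_one'[of "pw v \<boxtimes> (w \<boxtimes> u)"
            "padic_of_int p (int j)"] Zp.a_comm by simp
      hence "w = \<zero>\<^bsub>Zp p\<^esub>"
        using Zp_pw_mult_eq_0[of "w \<boxtimes> u" v] Zp_domain[OF w(1) uc] punit_nonzero[OF u] w(1) uc by auto
      thus "i = j \<and> t = t'" using ij 2 t s by simp
    qed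
    show "?f ` ({..<p ^ v} \<times> tors) = carrier G"
    proof (intro equalityI subsetI)
      fix y assume "y \<in> ?f ` ({..<p ^ v} \<times> tors)"
      thus "y \<in> carrier G" using ext_q_closed[OF E] by auto
    next
      fix y assume "y \<in> carrier G"
      then obtain x where x: "x \<in> carrier M" "q x = y" using ext_q_surj[OF E] by blast
      obtain c t where ct: "c \<in> carrier (Zp p)" "t \<in> tors" "x = c \<odot> g \<oplus> t" using split[OF x(1)] by blast
      obtain b where b: "b \<in> carrier (Zp p)" "c = padic_of_int p (c v) \<boxplus> pw v \<boxtimes> b"
        using Zp_pw_split[OF ct(1)] by blast
      obtain u' where u': "u' \<in> punit" "u' \<boxtimes> u = \<one>\<^bsub>Zp p\<^esub>" using punit_inverse[OF u] .
      have u'c: "u' \<in> carrier (Zp p)" using u'(1) by (rule punit_carrier)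
      \<comment> \<open>Chosen so that w h has g-part p^v b; removing w h from x leaves the residue
        \<open>c v\<close> as coefficient of g.\<close>
      define w where "w = b \<boxtimes> u'"
      have w: "w \<in> carrier (Zp p)" "w \<boxtimes> u = b" using b u'c uc u'(2) by (simp_all add: w_def Zp.m_assoc)
      define x' where "x' = padic_of_int p (c v) \<odot> g \<oplus> (t \<ominus> w \<odot> s)"
      have T: "t \<ominus> w \<odot> s \<in> tors" using ct s w tors_diff tors_smult by blast
      have x'M: "x' \<in> carrier M" using T by (simp add: x'_def)
      have ts: "t = w \<odot> s \<oplus> (t \<ominus> w \<odot> s)" using M.minus_eqD[of t "w \<odot> s", OF _ _ refl] ct s w by simp
      have "x = (padic_of_int p (c v) \<boxplus> pw v \<boxtimes> b) \<odot> g \<oplus> (w \<odot> s \<oplus> (t \<ominus> w \<odot> s))"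
        using ct(3) b(2) ts by simp
      also have "\<dots> = x' \<oplus> ((pw v \<boxtimes> b) \<odot> g \<oplus> w \<odot> s)"
        unfolding x'_def using b(1) T w s by (simp add: smult_l_distr M.a_ac)
      also have "\<dots> = x' \<oplus> w \<odot> h" using wh[OF w(1)] w(2) by simp
      finally have "q x = q x' \<otimes>\<^bsub>G\<^esub> q (w \<odot> h)"
        using ext_q_add[OF E x'M, of "w \<odot> h"] ext_hM[OF E] w by simp
      moreover have "q (w \<odot> h) = \<one>\<^bsub>G\<^esub>" using ext_q_ker[OF E, of "w \<odot> h"] ext_hM[OF E] w by auto
      ultimately have "y = q x'" using x ext_q_closed[OF E x'M] by simp
      moreover have "c v = int (nat (c v))" "nat (c v) < p ^ v"
        using ct(1) by (auto simp: Zp_carrier_iff nat_less_iff)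
      ultimately show "y \<in> ?f ` ({..<p ^ v} \<times> tors)"
        using T unfolding x'_def by (intro image_eqI[of _ _ "(nat (c v), t \<ominus> w \<odot> s)"]) auto
    qed
  qed
  hence "card ({..<p ^ v} \<times> tors) = card (carrier G)" by (rule bij_betw_same_card)
  thus ?thesis using ordG by (simp add: order_def card_cartesian_product)
qed

text \<open>The coefficient of g in h cannot vanish, since h would be torsion; splitting it into a
  power of p and a unit gives the form needed for \<open>order_line\<close>.\<close>

lemma ext_line:
  assumes ext: "ext_pair p G M h q"
  obtains v u s where "u \<in> punit" "s \<in> tors" "h = (pw v \<boxtimes> u) \<odot> g \<oplus> s" "p ^ k = p ^ v * card tors"
proof -
  have nt: "nontorsion h" using ext_nontorsion[OF Zp_module_axioms ext] .
  hence hM: "h \<in> carrier M" by (simp add: nontorsion_def)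
  obtain c s where cs: "c \<in> carrier (Zp p)" "s \<in> tors" "h = c \<odot> g \<oplus> s" using split[OF hM] by blast
  have "c \<noteq> \<zero>\<^bsub>Zp p\<^esub>"
  proof
    assume "c = \<zero>\<^bsub>Zp p\<^esub>"
    hence "\<one>\<^bsub>Zp p\<^esub> \<odot> h \<in> tors" using cs by simp
    thus False using nontorsion_smult_tors[OF nt Zp.one_closed] Zp_one_neq_zero by blast
  qed
  then obtain v u where u: "u \<in> punit" "c = pw v \<boxtimes> u" using Zp_decompose[OF cs(1)] by metis
  thus ?thesis using that[OF u(1) cs(2)] order_line[OF ext _ u(1) cs(2)] cs(3) by simp
qed

text \<open>The common object of the double count: fibred over s in
  \<open>card_pairs_quotients\<close>, over characters in
  \<open>card_pairs_realized\<close>.\<close>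

definition pairs :: "nat \<Rightarrow> ('a \<times> ('a \<Rightarrow> 'g)) set"
  where "pairs v = Sigma tors (\<lambda>s. quotient_maps M (line v s))"

lemma card_pairs_quotients:
  "card (pairs v) = card {s \<in> tors. (add_monoid M Mod cyc (line v s)) \<cong> G} * card (auto G)"
proof -
  have "card (pairs v) = (\<Sum>s\<in>tors. card (quotient_maps M (line v s)))"
    unfolding pairs_def using tors_finite finite_quotient_maps[OF Zp_module_axioms line_nontorsion]
    by (intro card_SigmaI) auto
  also have "\<dots> = (\<Sum>s\<in>tors. if (add_monoid M Mod cyc (line v s)) \<cong> G then card (auto G) else 0)"
    using card_quotient_maps[OF Zp_module_axioms line_nontorsion] by (intro sum.cong) auto
  also have "\<dots> = card {s \<in> tors. (add_monoid M Mod cyc (line v s)) \<cong> G} * card (auto G)"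
    using tors_finite by (simp add: sum.If_cases Int_def)
  finally show ?thesis .
qed

lemma finite_pairs: "finite (pairs v)"
  unfolding pairs_def using tors_finite finite_quotient_maps[OF Zp_module_axioms line_nontorsion]
  by (intro finite_SigmaI) auto

lemma pairsD:
  assumes "(s, q) \<in> pairs v"
  shows "s \<in> tors" "ext_pair p G M (line v s) q" "q \<in> extensional (carrier M)"
  using assms by (auto simp: pairs_def quotient_maps_def)

text \<open>For h = p^v u g + s, multiplication by u is an automorphism of M taking p^v g + u^-1 s
  to h. Pulling back along it normalizes h and keeps the character.\<close>

lemma realized_pair:
  assumes \<xi>: "\<xi> \<in> realized M" and v: "p ^ k = p ^ v * card tors"
  shows "\<exists>s q. (s, q) \<in> pairs v \<and> is_char p k M (line v s) q \<xi>"
proof -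
  obtain h q where hq: "ext_pair p G M h q" "is_char p k M h q \<xi>" using \<xi> by (auto simp: realized_def)
  obtain w u s where u: "u \<in> punit" "s \<in> tors" "h = (pw w \<boxtimes> u) \<odot> g \<oplus> s" "p ^ k = p ^ w * card tors"
    using ext_line[OF hq(1)] .
  have wv: "w = v" using u(4) v card_tors_pos p_gt_1 by simp
  obtain u' where u': "u' \<in> punit" "u' \<boxtimes> u = \<one>\<^bsub>Zp p\<^esub>" using punit_inverse[OF u(1)] .
  note uc = punit_carrier[OF u(1)] and u'c = punit_carrier[OF u'(1)]
  define s' where "s' = u' \<odot> s"
  have s': "s' \<in> tors" using u'c u(2) tors_smult by (simp add: s'_def)
  have uh: "u \<odot> line v s' = h"
  proof -
    have "u \<odot> s' = s" unfolding s'_def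
      using smult_assoc1[OF uc u'c tM[OF u(2)]] u'(2) Zp.m_comm[OF uc u'c] u(2) by simp
    moreover have "u \<odot> (pw v \<odot> g) = (pw v \<boxtimes> u) \<odot> g"
      using smult_comm[OF uc padic_of_int_closed gM] smult_assoc1[OF padic_of_int_closed uc gM] by simp
    ultimately show ?thesis using u(3) wv s' uc by (simp add: smult_r_distr)
  qed
  have lM: "line v s' \<in> carrier M" using s' by simp
  define q' where "q' = restrict (\<lambda>e. q (u \<odot> e)) (carrier M)"
  have q': "q (u \<odot> e) = q' e" if "e \<in> carrier M" for e using that by (simp add: q'_def)
  have "ext_pair p G M (line v s') q'"
    by (rule ext_pair_transport[OF Zp_module_axioms Zp_module_axioms smult_mod_hom[OF uc]
        smult_bij[OF u(1)] lM,
          where q' = q and q = q', OF q'])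
      (auto simp: uh hq)
  moreover have "is_char p k M (line v s') q' \<xi>"
    by (rule is_char_transport[OF smult_mod_hom[OF uc] lM, where q' = q
        and q = q', OF q']) (auto simp: uh hq)
  ultimately show ?thesis using s' by (auto simp: pairs_def quotient_maps_def q'_def)
qed

lemma pair_realized: "(s, q) \<in> pairs v \<Longrightarrow> \<exists>\<xi>\<in>realized M. is_char p k M (line v s) q \<xi>"
  using ext_char_exists[OF Zp_module_axioms, of "line v s" q] pairsD(2)[of s q v]
  unfolding realized_def by blast

text \<open>Some automorphism f0 is supplied by \<open>ext_iso\<close>. Writing f0 g = a g + t and
  comparing coefficients of g in f0 (p^v g + s) = p^v g + s' gives p^v a = p^v, hence a = 1.\<close>

lemma shear_between_pairs:
  assumes sq: "(s, q) \<in> pairs v" and sq': "(s', q') \<in> pairs v"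
    and ch: "is_char p k M (line v s) q \<xi>" "is_char p k M (line v s') q' \<xi>"
  shows "\<exists>f\<in>shear g. f (line v s) = line v s' \<and> (\<forall>e\<in>carrier M. q' (f e) = q e)"
proof -
  note Z = Zp_module_axioms
  obtain f0 where f0: "f0 \<in> mod_hom (Zp p) M M" "bij_betw f0 (carrier M) (carrier M)"
      "f0 (line v s) = line v s'"
    "\<forall>e\<in>carrier M. q' (f0 e) = q e"
    using ext_iso[OF Z Z pairsD(2)[OF sq] pairsD(2)[OF sq'] ch] by blast
  have sT: "s \<in> tors" "s' \<in> tors" using pairsD(1) sq sq' by auto
  have f0g: "f0 g \<in> carrier M" using mod_hom_closed[OF f0(1) gM] .
  obtain a t where at: "a \<in> carrier (Zp p)" "t \<in> tors" "f0 g = a \<odot> g \<oplus> t" using split[OF f0g] by blast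
  have f0s: "f0 s \<in> tors" using mod_hom_tors[OF f0(1) sT(1)] .
  have "line v s' = pw v \<odot> f0 g \<oplus> f0 s"
    using f0(3) mod_hom_add[OF f0(1), of "pw v \<odot> g" s] mod_hom_smult[OF f0(1) padic_of_int_closed
        gM] sT by simp
  also have "\<dots> = (pw v \<boxtimes> a) \<odot> g \<oplus> (pw v \<odot> t \<oplus> f0 s)"
    unfolding at(3) using at(1,2) f0s by (simp add: smult_r_distr smult_assoc1 M.a_assoc)
  finally have eq: "pw v \<odot> g \<oplus> s' = (pw v \<boxtimes> a) \<odot> g \<oplus> (pw v \<odot> t \<oplus> f0 s)" .
  have "pw v \<odot> t \<oplus> f0 s \<in> tors" using at f0s tors_add tors_smult padic_of_int_closed by blast
  hence "pw v = pw v \<boxtimes> a"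
    using split_unique(1)[OF padic_of_int_closed _ sT(2) _ eq] at(1) by simp
  hence "a = \<one>\<^bsub>Zp p\<^esub>" using pw_mult_cancel[of a "\<one>\<^bsub>Zp p\<^esub>" v] at(1) by simp
  hence "f0 g = g \<oplus> t" using at(3) by simp
  moreover have "restrict f0 (carrier M) \<in> mod_hom (Zp p) M M" using f0(1) by (auto simp: mod_hom_def)
  moreover have "bij_betw (restrict f0 (carrier M)) (carrier M) (carrier M)"
    using f0(2) by (simp add: bij_betw_restrict_eq)
  ultimately have "restrict f0 (carrier M) \<in> shear g" using at(2) by (auto simp: shear_def)
  moreover have "restrict f0 (carrier M) (line v s) = line v s'" using f0(3) sT by simp
  ultimately show ?thesis using f0(4) by (intro bexI[of _ "restrict f0 (carrier M)"]) auto
qed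

text \<open>With f g = g + t the condition becomes f s' = s - p^v t, which is solvable because f
  permutes the torsion.\<close>

lemma shear_pullback:
  assumes sq: "(s, q) \<in> pairs v" and f: "f \<in> shear g"
  shows "\<exists>s'\<in>tors. f (line v s') = line v s"
proof -
  have fh: "f \<in> mod_hom (Zp p) M M" using f by (simp add: shear_def)
  obtain t where t: "t \<in> tors" "f g = g \<oplus> t" using f by (auto simp: shear_def)
  have sT: "s \<in> tors" using pairsD(1)[OF sq] .
  have pt: "pw v \<odot> t \<in> tors" using t tors_smult padic_of_int_closed by blast
  hence "s \<ominus> pw v \<odot> t \<in> tors" using sT tors_diff by blast
  then obtain s' where s': "s' \<in> tors" "f s' = s \<ominus> pw v \<odot> t"
    using shear_tors_bij[OF f] by (metis bij_betw_imp_surj_on imageE)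
  have "f (line v s') = pw v \<odot> f g \<oplus> f s'"
    using mod_hom_add[OF fh, of "pw v \<odot> g" s'] mod_hom_smult[OF fh padic_of_int_closed gM] s'(1) by simp
  also have "\<dots> = pw v \<odot> g \<oplus> (pw v \<odot> t \<oplus> (s \<ominus> pw v \<odot> t))"
    unfolding t(2) s'(2) using t(1) sT pt by (simp add: smult_r_distr M.a_assoc)
  also have "pw v \<odot> t \<oplus> (s \<ominus> pw v \<odot> t) = s"
    using M.minus_eqD[of s "pw v \<odot> t", OF _ _ refl] sT pt by simp
  finally show ?thesis using s' by blast
qed

text \<open>One structure is fixed as base point. Every other with the same character is carried to
  it by exactly one shear, and every shear occurs, by pulling the base point back along it.\<close>

lemma card_fibre:
  assumes \<xi>: "\<xi> \<in> realized M" and v: "p ^ k = p ^ v * card tors"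
  shows "card {(s, q) \<in> pairs v. is_char p k M (line v s) q \<xi>} = card (shear g)"
proof -
  note Z = Zp_module_axioms
  define F where "F = {(s, q) \<in> pairs v. is_char p k M (line v s) q \<xi>}"
  have F: "(s, q) \<in> F \<longleftrightarrow> (s, q) \<in> pairs v \<and> is_char p k M (line v s) q \<xi>" for s q
    by (simp add: F_def)
  obtain s0 q0 where sq0: "(s0, q0) \<in> pairs v" "is_char p k M (line v s0) q0 \<xi>"
    using realized_pair[OF \<xi> v] by blast
  define P where "P x f \<longleftrightarrow> f \<in> shear g \<and> f (line v (fst x)) = line v s0 \<and> (\<forall>e\<in>carrier M. q0 (f e)
      = snd x e)" for x f
  have "\<exists>f. P x f" if x: "x \<in> F" for x
  proof -
    obtain s q where xs: "x = (s, q)" by (cases x)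
    have "\<exists>f\<in>shear g. f (line v s) = line v s0 \<and> (\<forall>e\<in>carrier M. q0 (f e) = q e)"
      using shear_between_pairs[OF _ sq0(1) _ sq0(2)] x F xs by blast
    thus ?thesis unfolding P_def xs by auto
  qed
  then obtain \<Phi> where "\<forall>x\<in>F. P x (\<Phi> x)" using bchoice[of F P] by blast
  hence \<Phi>: "P x (\<Phi> x)" if "x \<in> F" for x using that by blast
  have "bij_betw \<Phi> F (shear g)"
    unfolding bij_betw_def
  proof
    show "inj_on \<Phi> F"
    proof (rule inj_onI)
      fix x y assume x: "x \<in> F" and y: "y \<in> F" and eq: "\<Phi> x = \<Phi> y"
      obtain s q where xs: "x = (s, q)" by (cases x)
      obtain s' q' where ys: "y = (s', q')" by (cases y)
      have xp: "(s, q) \<in> pairs v" and yp: "(s', q') \<in> pairs v" using x y xs ys F by blast+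
      note D = pairsD[OF xp] and D' = pairsD[OF yp]
      have lM: "line v s \<in> carrier M" "line v s' \<in> carrier M" using D(1) D'(1) by auto
      have Px: "P x (\<Phi> x)" "P y (\<Phi> x)" using \<Phi>[OF x] \<Phi>[OF y] eq by auto
      have "inj_on (\<Phi> x) (carrier M)" using Px(1) by (auto simp: P_def shear_def bij_betw_def)
      moreover have "\<Phi> x (line v s) = \<Phi> x (line v s')" using Px by (simp add: P_def xs ys)
      ultimately have "line v s = line v s'" using lM by (auto simp: inj_on_def)
      hence "s = s'" using split_unique(2)[of "pw v" "pw v" s s'] D(1) D'(1) by simp
      moreover have "q = q'"
        by (rule extensionalityI[OF D(3) D'(3)]) (use Px in \<open>auto simp: P_def xs ys\<close>)
      ultimately show "x = y" by (simp add: xs ys)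
    qed
    show "\<Phi> ` F = shear g"
    proof (intro equalityI subsetI)
      fix f assume "f \<in> \<Phi> ` F"
      then obtain x where "x \<in> F" "f = \<Phi> x" by blast
      thus "f \<in> shear g" using \<Phi>[of x] by (simp add: P_def)
    next
      fix f assume f: "f \<in> shear g"
      hence fh: "f \<in> mod_hom (Zp p) M M" "bij_betw f (carrier M) (carrier M)"
          "f \<in> extensional (carrier M)" by (auto simp: shear_def)
      obtain s where s: "s \<in> tors" "f (line v s) = line v s0" using shear_pullback[OF sq0(1) f] by blast
      have lM: "line v s \<in> carrier M" using s by simp
      define q where "q = restrict (\<lambda>e. q0 (f e)) (carrier M)"
      have q: "q0 (f e) = q e" if "e \<in> carrier M" for e using that by (simp add: q_def)
      have ext: "ext_pair p G M (line v s) q"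
        by (rule ext_pair_transport[OF Z Z fh(1,2) lM, where q' = q0
            and q = q, OF q]) (auto simp: s(2) pairsD(2)[OF sq0(1)])
      have ch: "is_char p k M (line v s) q \<xi>"
        by (rule is_char_transport[OF fh(1) lM, where q' = q0 and q = q, OF q]) (auto simp: s(2) sq0(2))
      have "(s, q) \<in> pairs v" using ext s(1) by (simp add: pairs_def quotient_maps_def q_def)
      hence x: "(s, q) \<in> F" using ch F by blast
      have P: "\<Phi> (s, q) \<in> mod_hom (Zp p) M M" "\<Phi> (s, q) (line v s) = line v s0"
        "\<And>e. e \<in> carrier M \<Longrightarrow> q0 (\<Phi> (s, q) e) = q e" "\<Phi> (s, q) \<in> extensional (carrier M)"
        using \<Phi>[OF x] by (auto simp: P_def shear_def)
      have "\<Phi> (s, q) = f"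
        by (rule extensionalityI[OF P(4) fh(3)])
          (rule ext_iso_unique[OF Z Z ext pairsD(2)[OF sq0(1)] ch sq0(2) P(1-3) fh(1) s(2) q])
      thus "f \<in> \<Phi> ` F" using x by blast
    qed
  qed
  thus ?thesis unfolding F_def by (rule bij_betw_same_card)
qed

lemma card_pairs_realized:
  assumes v: "p ^ k = p ^ v * card tors"
  shows "card (pairs v) = card (realized M) * (card tors * card (auto tors_group))"
proof -
  note Z = Zp_module_axioms
  let ?F = "\<lambda>\<xi>. {(s, q) \<in> pairs v. is_char p k M (line v s) q \<xi>}"
  have R: "realized M \<subseteq> CH" by (auto simp: realized_def)
  have un: "pairs v = (\<Union>\<xi>\<in>realized M. ?F \<xi>)" using pair_realized[of _ _ v] by fast
  have "card (\<Union>\<xi>\<in>realized M. ?F \<xi>) = (\<Sum>\<xi>\<in>realized M. card (?F \<xi>))"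
  proof (rule card_UN_disjoint)
    show "finite (realized M)" using R finite_CH by (rule finite_subset)
    show "\<forall>\<xi>\<in>realized M. finite (?F \<xi>)"
      by (intro ballI finite_subset[OF _ finite_pairs[of v]]) auto
    show "\<forall>\<xi>\<in>realized M. \<forall>\<xi>'\<in>realized M. \<xi> \<noteq> \<xi>' \<longrightarrow> ?F \<xi> \<inter> ?F \<xi>' = {}"
    proof (intro ballI impI)
      fix \<xi> \<xi>' assume x: "\<xi> \<in> realized M" "\<xi>' \<in> realized M" "\<xi> \<noteq> \<xi>'"
      have "False" if sq: "(s, q) \<in> ?F \<xi>" "(s, q) \<in> ?F \<xi>'" for s q
        using ext_char_unique[OF Z pairsD(2)[of s q v], of \<xi> \<xi>'] sq x R by auto
      thus "?F \<xi> \<inter> ?F \<xi>' = {}" by fast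
    qed
  qed
  also have "\<dots> = card (realized M) * card (shear g)" using card_fibre[OF _ v] by simp
  finally show ?thesis using un card_shear by simp
qed

theorem realized_count:
  assumes v: "p ^ k = p ^ v * card tors"
  shows "card (realized M) * (card tors * card (auto tors_group)) =
    card {s \<in> tors. (add_monoid M Mod cyc (line v s)) \<cong> G} * card (auto G)"
  using card_pairs_realized[OF v] card_pairs_quotients[of v] by simp

text \<open>Covers the orders that \<open>ext_line\<close> rules out. With its counterpart
  \<open>presents_empty\<close> for quotients, both sides of the balance vanish in this
  case.\<close>

lemma realized_empty:
  assumes "\<And>v. p ^ k \<noteq> p ^ v * card tors"
  shows "realized M = {}"
  using ext_line assms unfolding realized_def by blast

end

section \<open>Haar measure\<close>

lemma (in padic_prime) Zp_cong_split:
  assumes "c \<in> carrier (Zp p)" "d \<in> carrier (Zp p)" "d n = c n"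
  shows "\<exists>b\<in>carrier (Zp p). d = c \<oplus>\<^bsub>Zp p\<^esub> pw n \<otimes>\<^bsub>Zp p\<^esub> b"
proof -
  obtain x where x: "x \<in> carrier (Zp p)" "c = padic_of_int p (c n) \<oplus>\<^bsub>Zp p\<^esub> pw n \<otimes>\<^bsub>Zp p\<^esub> x"
    using Zp_pw_split[OF assms(1)] by blast
  obtain y where y: "y \<in> carrier (Zp p)" "d = padic_of_int p (c n) \<oplus>\<^bsub>Zp p\<^esub> pw n \<otimes>\<^bsub>Zp p\<^esub> y"
    using Zp_pw_split[OF assms(2), of n] assms(3) by auto
  have "c \<oplus>\<^bsub>Zp p\<^esub> pw n \<otimes>\<^bsub>Zp p\<^esub> (y \<ominus>\<^bsub>Zp p\<^esub> x)
      = (padic_of_int p (c n) \<oplus>\<^bsub>Zp p\<^esub> pw n \<otimes>\<^bsub>Zp p\<^esub> x) \<oplus>\<^bsub>Zp p\<^esub> pw n \<otimes>\<^bsub>Zp p\<^esub> (y \<ominus>\<^bsub>Zp p\<^esub> x)"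
    using x(2) by simp
  also have "\<dots> = padic_of_int p (c n) \<oplus>\<^bsub>Zp p\<^esub> pw n \<otimes>\<^bsub>Zp p\<^esub> (x \<oplus>\<^bsub>Zp p\<^esub> (y \<ominus>\<^bsub>Zp p\<^esub> x))"
    using x(1) y(1) by (simp add: Zp.r_distr Zp.a_assoc)
  also have "x \<oplus>\<^bsub>Zp p\<^esub> (y \<ominus>\<^bsub>Zp p\<^esub> x) = y" using Zp.minus_eqD[OF y(1) x(1) refl] by simp
  finally show ?thesis using y x(1) by (intro bexI[of _ "y \<ominus>\<^bsub>Zp p\<^esub> x"]) auto
qed

context split_module
begin

text \<open>
  For \<open>n \<ge> N\<close> the subgroup \<open>p^n H\<close> is \<open>Zp (p^n g)\<close>, so its cosets correspond to
  the cells \<open>(c mod p^n, t)\<close>.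
\<close>

definition cells :: "nat \<Rightarrow> (int \<times> 'a) set" where "cells n = {0..<int p ^ n} \<times> tors"

text \<open>For n \<ge> N this is the union of the cosets of p^n H whose cells lie in W.
  Intersection, refinement and translation become finite combinatorics of cells.\<close>

definition level :: "nat \<Rightarrow> (int \<times> 'a) set \<Rightarrow> 'a set"
  where "level n W = {c \<odot> g \<oplus> t |c t. c \<in> carrier (Zp p) \<and> t \<in> tors \<and> (c n, t) \<in> W}"

definition coset :: "nat \<Rightarrow> 'a \<Rightarrow> 'a set"
  where "coset n x = {x \<oplus> add_pow M (p ^ n) y |y. y \<in> carrier M}"

text \<open>A countable base of the topology that is closed under intersection: it serves both to
  generate the Borel sets and to determine measures.\<close>

definition gens :: "'a set set"
  where "gens = {level n W |n W. N \<le> n \<and> W \<subseteq> cells n}"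

lemma finite_cells [simp]: "finite (cells n)"
  using tors_finite by (simp add: cells_def)

lemma card_cells: "card (cells n) = p ^ n * card tors"
  by (simp add: cells_def card_cartesian_product nat_power_eq)

lemma cells_I: "c \<in> carrier (Zp p) \<Longrightarrow> t \<in> tors \<Longrightarrow> (c n, t) \<in> cells n"
  by (simp add: cells_def Zp_carrier_iff)

lemma level_carrier: "level n W \<subseteq> carrier M"
  by (auto simp: level_def)

lemma level_iff:
  assumes "c \<in> carrier (Zp p)" "t \<in> tors"
  shows "c \<odot> g \<oplus> t \<in> level n W \<longleftrightarrow> (c n, t) \<in> W"
proof
  assume "c \<odot> g \<oplus> t \<in> level n W"
  then obtain d s where ds: "d \<in> carrier (Zp p)" "s \<in> tors" "(d n, s) \<in> W" "c \<odot> g \<oplus> t = d \<odot> g \<oplus> s"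
    unfolding level_def by blast
  show "(c n, t) \<in> W" using split_unique[OF assms(1) ds(1) assms(2) ds(2,4)] ds(3) by simp
qed (use assms in \<open>auto simp: level_def\<close>)

lemma set_eq_splitI:
  assumes "A \<subseteq> carrier M" "B \<subseteq> carrier M"
      "\<And>c t. c \<in> carrier (Zp p) \<Longrightarrow> t \<in> tors \<Longrightarrow> c \<odot> g \<oplus> t \<in> A \<longleftrightarrow> c \<odot> g \<oplus> t \<in> B"
  shows "A = B"
proof (rule Set.set_eqI)
  fix x
  show "x \<in> A \<longleftrightarrow> x \<in> B"
  proof (cases "x \<in> carrier M")
    case True
    then obtain c t where "c \<in> carrier (Zp p)" "t \<in> tors" "x = c \<odot> g \<oplus> t" using split by blast
    thus ?thesis using assms(3)[of c t] by blast
  qed (use assms(1,2) in blast)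
qed

lemma level_refine:
  assumes "n \<le> m" "W \<subseteq> cells n"
  shows "level n W = level m {(a, t) \<in> cells m. (a mod int p ^ n, t) \<in> W}"
  by (rule set_eq_splitI[OF level_carrier level_carrier])
    (simp add: level_iff Zp_nth_mod[OF _ assms(1)] cells_I)

lemma level_mono: "V \<subseteq> W \<Longrightarrow> level n V \<subseteq> level n W"
  unfolding level_def by blast

lemma level_Int: "level n W \<inter> level n V = level n (W \<inter> V)"
proof (rule set_eq_splitI)
  show "level n W \<inter> level n V \<subseteq> carrier M" using level_carrier by blast
qed (simp_all add: level_iff level_carrier)

lemma level_cells: "level n (cells n) = carrier M"
  by (rule set_eq_splitI) (simp_all add: level_iff level_carrier cells_I)

text \<open>Both sets are refined to the larger of their two levels, where intersecting them means
  intersecting sets of cells.\<close>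

lemma gens_Int_stable: "Int_stable gens"
proof (rule Int_stableI)
  fix A B assume "A \<in> gens" "B \<in> gens"
  then obtain n W m V where A: "A = level n W" "N \<le> n" "W \<subseteq> cells n"
    and B: "B = level m V" "N \<le> m" "V \<subseteq> cells m" unfolding gens_def by blast
  define k where "k = max n m"
  define W' where "W' = {(a, t) \<in> cells k. (a mod int p ^ n, t) \<in> W}"
  define V' where "V' = {(a, t) \<in> cells k. (a mod int p ^ m, t) \<in> V}"
  have "A = level k W'" "B = level k V'"
    unfolding A B W'_def V'_def using A B by (auto intro!: level_refine simp: k_def)
  hence "A \<inter> B = level k (W' \<inter> V')" using level_Int by simp
  moreover have "W' \<inter> V' \<subseteq> cells k" unfolding W'_def by blast
  moreover have "N \<le> k" using A(2) by (simp add: k_def)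
  ultimately show "A \<inter> B \<in> gens" unfolding gens_def by blast
qed

lemma gens_carrier: "gens \<subseteq> Pow (carrier M)"
  using level_carrier unfolding gens_def by blast

lemma countable_gens: "countable gens"
proof -
  have "gens \<subseteq> (\<Union>n. level n ` Pow (cells n))" unfolding gens_def by blast
  moreover have "countable (\<Union>n. level n ` Pow (cells n))"
    by (intro countable_UN[OF countableI_type] countable_image countable_finite) simp
  ultimately show ?thesis by (rule countable_subset)
qed

lemma carrier_gens: "carrier M \<in> gens"
  unfolding gens_def using level_cells[of N] by blast

lemma level_gens: "N \<le> n \<Longrightarrow> W \<subseteq> cells n \<Longrightarrow> level n W \<in> gens"
  unfolding gens_def by blast

text \<open>Here n \<ge> N enters: p^n kills the torsion part of any element, so adding a member of
  p^n H moves only the coefficient of g.\<close>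

lemma coset_mem:
  assumes "N \<le> n" "c \<in> carrier (Zp p)" "t \<in> tors" "d \<in> carrier (Zp p)" "s \<in> tors"
  shows "c \<odot> g \<oplus> t \<oplus> add_pow M (p ^ n) (d \<odot> g \<oplus> s) = (c \<boxplus> pw n \<boxtimes> d) \<odot> g \<oplus> t"
proof -
  have "pw n \<odot> s = pw (n - N) \<odot> (pw N \<odot> s)"
    using assms pw_add[of "n - N" N] smult_assoc1[of "pw (n - N)" "pw N" s] by simp
  hence "pw n \<odot> s = \<zero>" using tors_killed[OF assms(5)] by simp
  hence "add_pow M (p ^ n) (d \<odot> g \<oplus> s) = (pw n \<boxtimes> d) \<odot> g"
    using assms by (simp add: add_pow_eq_smult smult_r_distr smult_assoc1)
  thus ?thesis using assms by (simp add: smult_l_distr M.a_ac)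
qed

lemma coset_eq_level:
  assumes "N \<le> n" "c \<in> carrier (Zp p)" "t \<in> tors"
  shows "coset n (c \<odot> g \<oplus> t) = level n {(c n, t)}"
proof (intro equalityI subsetI)
  fix x assume "x \<in> coset n (c \<odot> g \<oplus> t)"
  then obtain y where y: "y \<in> carrier M" "x = c \<odot> g \<oplus> t \<oplus> add_pow M (p ^ n) y"
    unfolding coset_def by blast
  obtain d s where ds: "d \<in> carrier (Zp p)" "s \<in> tors" "y = d \<odot> g \<oplus> s" using split[OF y(1)] by blast
  have "x = (c \<boxplus> pw n \<boxtimes> d) \<odot> g \<oplus> t" unfolding y(2) ds(3) by (rule coset_mem[OF assms ds(1,2)])
  moreover have "(c \<boxplus> pw n \<boxtimes> d) n = c n"
    using assms(2) by (simp add: Zp_nth(3) Zp_nth_pw_mult)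
  ultimately show "x \<in> level n {(c n, t)}"
    using level_iff[of "c \<boxplus> pw n \<boxtimes> d" t n "{(c n, t)}"] assms ds(1) by simp
next
  fix x assume "x \<in> level n {(c n, t)}"
  then obtain d where d: "d \<in> carrier (Zp p)" "d n = c n" "x = d \<odot> g \<oplus> t" unfolding level_def by blast
  obtain b where b: "b \<in> carrier (Zp p)" "d = c \<boxplus> pw n \<boxtimes> b"
    using Zp_cong_split[OF assms(2) d(1,2)] by blast
  have "x = c \<odot> g \<oplus> t \<oplus> add_pow M (p ^ n) (b \<odot> g \<oplus> \<zero>)"
    using coset_mem[OF assms b(1) tors_zero] d(3) b(2) by simp
  moreover have "b \<odot> g \<oplus> \<zero> \<in> carrier M" using b(1) by simp
  ultimately show "x \<in> coset n (c \<odot> g \<oplus> t)" unfolding coset_def by blast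
qed

lemma coset_open: "x \<in> carrier M \<Longrightarrow> openin (padic_topology p M) (coset n x)"
  unfolding padic_topology_def coset_def by (rule topology_generated_by_Basis) blast

lemma openin_carrier:
  assumes "openin (padic_topology p M) U"
  shows "U \<subseteq> carrier M"
proof -
  have "topspace (padic_topology p M) \<subseteq> carrier M"
    unfolding padic_topology_def topology_generated_by_topspace by auto
  thus ?thesis using openin_subset[OF assms] by blast
qed

text \<open>Cosets of p^n H around x shrink as n grows. Asking for all large n, not for one, carries
  the induction through intersections and allows n \<ge> N to be imposed afterwards.\<close>

lemma open_contains_coset:
  assumes "openin (padic_topology p M) U" "x \<in> U"
  shows "\<exists>m. \<forall>n\<ge>m. coset n x \<subseteq> U"
proof -
  have "generate_topology_on {{x \<oplus> add_pow M (p ^ n) y | y. y \<in> carrier M} | x n. x \<in> carrier M} U"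
    using assms(1) unfolding padic_topology_def by (rule openin_topology_generated_by)
  thus ?thesis using assms(2)
  proof (induction arbitrary: x)
    case (Int a b)
    then obtain m m' where "\<forall>n\<ge>m. coset n x \<subseteq> a" "\<forall>n\<ge>m'. coset n x \<subseteq> b" by blast
    thus ?case by (intro exI[of _ "max m m'"]) auto
  next
    case (UN K)
    then obtain k where k: "k \<in> K" "x \<in> k" by blast
    then obtain m where "\<forall>n\<ge>m. coset n x \<subseteq> k" using UN.IH by blast
    thus ?case using k(1) by blast
  next
    case (Basis s)
    then obtain z m where s: "s = coset m z" "z \<in> carrier M" unfolding coset_def by blast
    then obtain y where y: "y \<in> carrier M" "x = z \<oplus> add_pow M (p ^ m) y"
      using Basis.prems unfolding coset_def by blast
    have "coset n x \<subseteq> s" if n: "n \<ge> m" for n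
    proof
      fix w assume "w \<in> coset n x"
      then obtain u where u: "u \<in> carrier M" "w = x \<oplus> add_pow M (p ^ n) u" unfolding coset_def by blast
      have "add_pow M (p ^ n) u = pw m \<odot> (pw (n - m) \<odot> u)"
        using add_pow_eq_smult[OF u(1), of "p ^ n"] pw_add[of m "n - m"] n
          smult_assoc1[of "pw m" "pw (n - m)" u] u(1) by simp
      hence "w = z \<oplus> (pw m \<odot> y \<oplus> pw m \<odot> (pw (n - m) \<odot> u))"
        unfolding u(2) y(2) using add_pow_eq_smult[OF y(1), of "p ^ m"] s(2) y(1) u(1)
        by (simp add: M.a_assoc)
      also have "pw m \<odot> y \<oplus> pw m \<odot> (pw (n - m) \<odot> u) = pw m \<odot> (y \<oplus> pw (n - m) \<odot> u)"
        using y(1) u(1) by (simp add: smult_r_distr)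
      also have "\<dots> = add_pow M (p ^ m) (y \<oplus> pw (n - m) \<odot> u)"
        using add_pow_eq_smult[of "y \<oplus> pw (n - m) \<odot> u" "p ^ m"] y(1) u(1) by simp
      finally show "w \<in> s"
        unfolding s(1) coset_def using y(1) u(1) M.a_closed smult_closed[OF padic_of_int_closed]
          by blast
    qed
    thus ?case by blast
  qed simp
qed

lemma mem_cell:
  assumes "x \<in> carrier M"
  obtains c t where "c \<in> carrier (Zp p)" "t \<in> tors" "x = c \<odot> g \<oplus> t" "x \<in> level n {(c n, t)}"
proof -
  obtain c t where "c \<in> carrier (Zp p)" "t \<in> tors" "x = c \<odot> g \<oplus> t" using split[OF assms] by blast
  thus ?thesis using that[of c t] level_iff[of c t n "{(c n, t)}"] by simp
qed

lemma level_open: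
  assumes "N \<le> n"
  shows "openin (padic_topology p M) (level n W)"
proof (subst openin_subopen, intro ballI)
  fix x assume x: "x \<in> level n W"
  hence xM: "x \<in> carrier M" using level_carrier by blast
  obtain c t where ct: "c \<in> carrier (Zp p)" "t \<in> tors" "x = c \<odot> g \<oplus> t" "x \<in> level n {(c n, t)}"
    using mem_cell[OF xM] .
  have "(c n, t) \<in> W" using x level_iff[OF ct(1,2)] ct(3) by simp
  hence "level n {(c n, t)} \<subseteq> level n W" by (intro level_mono) simp
  moreover have "openin (padic_topology p M) (level n {(c n, t)})"
    using coset_open[OF xM, of n] coset_eq_level[OF assms ct(1,2)] ct(3) by simp
  ultimately show "\<exists>T. openin (padic_topology p M) T \<and> x \<in> T \<and> T \<subseteq> level n W" using ct(4) by blast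
qed

text \<open>Each open set is the union of the members of \<open>gens\<close> inside it, and there
  are only countably many of these.\<close>

lemma sigma_open_eq: "sigma_sets (carrier M) {U. openin (padic_topology p M) U}
    = sigma_sets (carrier M) gens"
proof (intro equalityI sigma_sets_mono subsetI)
  fix U assume "U \<in> {U. openin (padic_topology p M) U}"
  hence U: "openin (padic_topology p M) U" by simp
  have sub: "x \<in> \<Union>{B \<in> gens. B \<subseteq> U}" if x: "x \<in> U" for x
  proof -
    have xM: "x \<in> carrier M" using x openin_carrier[OF U] by blast
    obtain m where m: "\<forall>n\<ge>m. coset n x \<subseteq> U" using open_contains_coset[OF U x] by blast
    define n where "n = max m N"
    obtain c t where ct: "c \<in> carrier (Zp p)" "t \<in> tors" "x = c \<odot> g \<oplus> t" "x \<in> level n {(c n, t)}"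
      using mem_cell[OF xM] .
    have "level n {(c n, t)} \<subseteq> U"
      using m[rule_format, of n] coset_eq_level[OF _ ct(1,2), of n] ct(3) by (simp add: n_def)
    moreover have "level n {(c n, t)} \<in> gens"
      using cells_I[OF ct(1,2)] by (intro level_gens) (auto simp: n_def)
    ultimately show ?thesis using ct(4) by blast
  qed
  have eq: "U = \<Union>{B \<in> gens. B \<subseteq> U}"
    by (rule equalityI[OF subsetI[OF sub]]) blast+
  have "\<Union>{B \<in> gens. B \<subseteq> U} \<in> sigma_sets (carrier M) gens"
    by (rule sigma_sets_UNION) (auto intro: countable_subset[OF _ countable_gens])
  thus "U \<in> sigma_sets (carrier M) gens" using eq by simp
next
  fix A assume "A \<in> gens"
  then obtain n W where "A = level n W" "N \<le> n" unfolding gens_def by blast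
  thus "A \<in> sigma_sets (carrier M) {U. openin (padic_topology p M) U}"
    using level_open[of n W] by (intro sigma_sets.Basic) simp
qed

text \<open>Haar measure in computable form: the p^n |T| cells of a level have equal mass. It is
  shown equivalent to \<open>is_haar_measure\<close>, and the definite description
  \<open>haar\<close> is resolved through it.\<close>

definition uniform_on_cells :: "'a measure \<Rightarrow> bool"
  where "uniform_on_cells \<mu> \<longleftrightarrow> prob_space \<mu> \<and> space \<mu> = carrier M \<and> sets \<mu>
      = sigma_sets (carrier M) gens \<and>
    (\<forall>n\<ge>N. \<forall>w\<in>cells n. measure \<mu> (level n {w}) = 1 / (real p ^ n * real (card tors)))"

lemma level_decompose: "level n W = (\<Union>w\<in>W. level n {w})"
  unfolding level_def by auto

lemma level_disjoint: "disjoint_family_on (\<lambda>w. level n {w}) W"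
  unfolding disjoint_family_on_def
proof (intro ballI impI)
  fix v w :: "int \<times> 'a" assume "v \<noteq> w"
  hence "{v} \<inter> {w} = {}" by simp
  hence "level n {v} \<inter> level n {w} = level n {}" using level_Int by metis
  thus "level n {v} \<inter> level n {w} = {}" by (simp add: level_def)
qed

lemma measure_level_sum:
  assumes "finite_measure \<mu>" "sets \<mu> = sigma_sets (carrier M) gens" "N \<le> n" "W \<subseteq> cells n"
  shows "measure \<mu> (level n W) = (\<Sum>w\<in>W. measure \<mu> (level n {w}))"
proof -
  have "(\<lambda>w. level n {w}) ` W \<subseteq> sets \<mu>"
    unfolding assms(2) using assms(3,4) by (auto intro!: sigma_sets.Basic level_gens)
  moreover have "finite W" using finite_subset[OF assms(4) finite_cells] .
  ultimately show ?thesis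
    unfolding level_decompose[of n W]
    by (intro finite_measure.finite_measure_finite_Union[OF assms(1)] level_disjoint)
qed

lemma uniform_on_cells_level:
  assumes "uniform_on_cells \<mu>" "N \<le> n" "W \<subseteq> cells n"
  shows "measure \<mu> (level n W) = real (card W) / (real p ^ n * real (card tors))"
proof -
  have "measure \<mu> (level n W) = (\<Sum>w\<in>W. measure \<mu> (level n {w}))"
    using assms prob_space.finite_measure by (intro measure_level_sum) (auto simp: uniform_on_cells_def)
  also have "\<dots> = (\<Sum>w\<in>W. 1 / (real p ^ n * real (card tors)))"
    using assms by (intro sum.cong) (auto simp: uniform_on_cells_def)
  finally show ?thesis by simp
qed

lemma uniform_on_cells_unique:
  assumes "uniform_on_cells \<mu>" "uniform_on_cells \<nu>"
  shows "\<mu> = \<nu>"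
proof (rule measure_eqI_generator_eq[OF gens_Int_stable gens_carrier])
  interpret \<mu>: prob_space \<mu> using assms by (simp add: uniform_on_cells_def)
  interpret \<nu>: prob_space \<nu> using assms by (simp add: uniform_on_cells_def)
  show "sets \<mu> = sigma_sets (carrier M) gens" "sets \<nu> = sigma_sets (carrier M) gens"
    using assms by (simp_all add: uniform_on_cells_def)
  fix X assume "X \<in> gens"
  then obtain n W where "X = level n W" "N \<le> n" "W \<subseteq> cells n" unfolding gens_def by blast
  hence "measure \<mu> X = measure \<nu> X" using uniform_on_cells_level assms by metis
  thus "emeasure \<mu> X = emeasure \<nu> X" by (simp add: \<mu>.emeasure_eq_measure \<nu>.emeasure_eq_measure)
next
  show "range (\<lambda>_::nat. carrier M) \<subseteq> gens" using carrier_gens by blast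
  interpret \<mu>: prob_space \<mu> using assms by (simp add: uniform_on_cells_def)
  show "emeasure \<mu> (carrier M) \<noteq> \<infinity>" by simp
qed simp

lemma translate_cell:
  assumes "c \<in> carrier (Zp p)" "t \<in> tors" "(a, s) \<in> cells n"
  shows "(\<lambda>x. c \<odot> g \<oplus> t \<oplus> x) ` level n {(a, s)} = level n {((c n + a) mod int p ^ n, t \<oplus> s)}"
proof (intro equalityI subsetI)
  have s: "s \<in> tors" using assms by (simp add: cells_def)
  fix y assume "y \<in> (\<lambda>x. c \<odot> g \<oplus> t \<oplus> x) ` level n {(a, s)}"
  then obtain d where d: "d \<in> carrier (Zp p)" "d n = a" "y = c \<odot> g \<oplus> t \<oplus> (d \<odot> g \<oplus> s)"
    unfolding level_def by blast
  have "y = (c \<boxplus> d) \<odot> g \<oplus> (t \<oplus> s)" unfolding d(3) using d(1) assms s by (simp add: smult_l_distr M.a_ac)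
  thus "y \<in> level n {((c n + a) mod int p ^ n, t \<oplus> s)}"
    using level_iff[of "c \<boxplus> d" "t \<oplus> s" n "{((c n + a) mod int p ^ n, t \<oplus> s)}"] d assms s tors_add
    by (simp add: Zp_nth(3))
next
  have s: "s \<in> tors" and a: "0 \<le> a" "a < int p ^ n" using assms by (auto simp: cells_def)
  fix y assume "y \<in> level n {((c n + a) mod int p ^ n, t \<oplus> s)}"
  then obtain d where d: "d \<in> carrier (Zp p)" "d n = (c n + a) mod int p ^ n" "y = d \<odot> g \<oplus> (t \<oplus> s)"
    unfolding level_def by blast
  have dc: "c \<boxplus> (d \<ominus>\<^bsub>Zp p\<^esub> c) = d" using Zp.minus_eqD[OF d(1) assms(1) refl] by simp
  have "(d \<ominus>\<^bsub>Zp p\<^esub> c) n = a"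
  proof -
    have "(c n + (d \<ominus>\<^bsub>Zp p\<^esub> c) n) mod int p ^ n = (c n + a) mod int p ^ n"
      using dc d(2) Zp_nth(3)[of p c "d \<ominus>\<^bsub>Zp p\<^esub> c" n] by simp
    hence "(d \<ominus>\<^bsub>Zp p\<^esub> c) n mod int p ^ n = a mod int p ^ n" by (simp add: mod_eq_dvd_iff)
    moreover have "d \<ominus>\<^bsub>Zp p\<^esub> c \<in> carrier (Zp p)" using d assms by simp
    ultimately show ?thesis using a Zp_nth_mod_self[of "d \<ominus>\<^bsub>Zp p\<^esub> c" p n] by simp
  qed
  hence "(d \<ominus>\<^bsub>Zp p\<^esub> c) \<odot> g \<oplus> s \<in> level n {(a, s)}"
    using level_iff[of "d \<ominus>\<^bsub>Zp p\<^esub> c" s n "{(a, s)}"] d assms s by simp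
  moreover have "y = c \<odot> g \<oplus> t \<oplus> ((d \<ominus>\<^bsub>Zp p\<^esub> c) \<odot> g \<oplus> s)"
  proof -
    have "c \<odot> g \<oplus> t \<oplus> ((d \<ominus>\<^bsub>Zp p\<^esub> c) \<odot> g \<oplus> s) = (c \<boxplus> (d \<ominus>\<^bsub>Zp p\<^esub> c)) \<odot> g \<oplus> (t \<oplus> s)"
      using d(1) assms s by (simp add: smult_l_distr M.a_ac)
    thus ?thesis using dc d(3) by simp
  qed
  ultimately show "y \<in> (\<lambda>x. c \<odot> g \<oplus> t \<oplus> x) ` level n {(a, s)}" by blast
qed

text \<open>Every cell is a translate of the cell containing 0, so invariance makes the finitely
  many cells of a level equally likely.\<close>

lemma haar_uniform:
  assumes "is_haar_measure p M \<mu>"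
  shows "uniform_on_cells \<mu>"
proof -
  have \<mu>: "prob_space \<mu>" "space \<mu> = carrier M" "sets \<mu> = sigma_sets (carrier M) gens"
    and inv: "\<And>x A. x \<in> carrier M \<Longrightarrow> A \<in> sets \<mu> \<Longrightarrow> emeasure \<mu> ((\<lambda>a. x \<oplus> a) ` A) = emeasure \<mu> A"
    using assms unfolding is_haar_measure_def sigma_open_eq by auto
  interpret \<mu>: prob_space \<mu> by fact
  have "measure \<mu> (level n {w}) = 1 / (real p ^ n * real (card tors))" if n: "n \<ge> N"
      and w: "w \<in> cells n" for n w
  proof -
    have z: "(0, \<zero>) \<in> cells n" using tors_zero q_pos[of n] unfolding cells_def by simp
    have eq: "measure \<mu> (level n {v}) = measure \<mu> (level n {(0, \<zero>)})" if v: "v \<in> cells n" for v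
    proof -
      obtain a t where at: "v = (a, t)" "0 \<le> a" "a < int p ^ n" "t \<in> tors"
        using v by (auto simp: cells_def)
      have "(\<lambda>x. padic_of_int p a \<odot> g \<oplus> t \<oplus> x) ` level n {(0, \<zero>)} =
          level n {((padic_of_int p a n + 0) mod int p ^ n, t \<oplus> \<zero>)}"
        by (rule translate_cell[OF padic_of_int_closed at(4) z])
      also have "\<dots> = level n {v}" using at by (simp add: padic_of_int_def)
      finally have tr: "(\<lambda>x. padic_of_int p a \<odot> g \<oplus> t \<oplus> x) ` level n {(0, \<zero>)} = level n {v}" .
      have "level n {(0, \<zero>)} \<in> sets \<mu>"
        unfolding \<mu>(3) using z n by (intro sigma_sets.Basic level_gens) auto
      from inv[OF _ this, of "padic_of_int p a \<odot> g \<oplus> t"] have "emeasure \<mu> (level n {v})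
          = emeasure \<mu> (level n {(0, \<zero>)})"
        unfolding tr using at(4) by simp
      thus ?thesis by (simp add: \<mu>.emeasure_eq_measure)
    qed
    have "1 = measure \<mu> (level n (cells n))" using \<mu>.prob_space level_cells \<mu>(2) by simp
    also have "\<dots> = (\<Sum>v\<in>cells n. measure \<mu> (level n {v}))"
      by (rule measure_level_sum[OF _ \<mu>(3) n]) (auto simp: \<mu>.finite_measure_axioms)
    also have "\<dots> = (\<Sum>v\<in>cells n. measure \<mu> (level n {w}))"
      using eq w by (intro sum.cong) auto
    also have "\<dots> = real (p ^ n * card tors) * measure \<mu> (level n {w})" by (simp add: card_cells)
    finally show ?thesis using card_tors_pos p_gt_1 by (simp add: field_simps)
  qed
  thus ?thesis using \<mu> by (simp add: uniform_on_cells_def)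
qed

end

section \<open>Base p digits and the existence of Haar measure\<close>

lemma digit_sum_div_mod:
  fixes a p :: nat
  shows "(\<Sum>i<n. (a div p ^ i mod p) * p ^ i) = a mod p ^ n"
proof (induction n)
  case (Suc n)
  have "a mod p ^ Suc n = p ^ n * (a div p ^ n mod p) + a mod p ^ n"
    using mod_mult2_eq[of a "p ^ n" p] by (simp add: mult.commute)
  thus ?case using Suc by (simp add: mult.commute)
qed simp

lemma digit_sum_less:
  fixes d :: "nat \<Rightarrow> nat"
  assumes "\<And>i. d i < p"
  shows "(\<Sum>i<n. d i * p ^ i) < p ^ n"
proof (induction n)
  case (Suc n)
  have "d n * p ^ n + p ^ n \<le> p * p ^ n"
    using assms[of n] mult_right_mono[of "d n + 1" p "p ^ n"] by simp
  thus ?case using Suc by simp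
qed simp

lemma digit_sum_digit:
  fixes d :: "nat \<Rightarrow> nat"
  assumes "\<And>i. d i < p" "i < n"
  shows "(\<Sum>j<n. d j * p ^ j) div p ^ i mod p = d i"
  using assms(2)
proof (induction n)
  case (Suc n)
  let ?S = "\<Sum>j<n. d j * p ^ j"
  have p: "p > 0" using assms(1)[of 0] by simp
  show ?case
  proof (cases "i = n")
    case True
    thus ?thesis using digit_sum_less[of d p n] assms(1) p by simp
  next
    case False
    hence i: "i < n" using Suc.prems by simp
    have "p ^ n = p ^ i * (p * p ^ (n - i - 1))"
    proof -
      have "n = i + Suc (n - i - 1)" using i by simp
      hence "p ^ n = p ^ (i + Suc (n - i - 1))" by simp
      thus ?thesis by (simp only: power_add power_Suc)
    qed
    hence "?S + d n * p ^ n = ?S + p ^ i * (p * (p ^ (n - i - 1) * d n))" by (simp add: mult_ac)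
    hence "(?S + d n * p ^ n) div p ^ i = p * (p ^ (n - i - 1) * d n) + ?S div p ^ i"
      using p by (simp only: div_mult_self2) simp
    thus ?thesis using Suc.IH[OF i] by simp
  qed
qed simp

context split_module
begin

text \<open>The measure is the law of \<open>c g + t\<close> with independent uniform digits of \<open>c\<close> and uniform \<open>t\<close>.\<close>

lemma uniform_on_cells_exists: "\<exists>\<mu>. uniform_on_cells \<mu>"
proof -
  define K where "K = card tors"
  have K: "K > 0" using card_tors_pos by (simp add: K_def)
  obtain \<psi> where \<psi>: "bij_betw \<psi> {0..<K} tors"
    using ex_bij_betw_nat_finite[OF tors_finite] by (auto simp: K_def)
  \<comment> \<open>Coordinate 0 numbers the torsion part through \<psi>; coordinate i + 1 is the
    digit of p^i in the coefficient of g.\<close>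
  define B where "B i = {0..<(if i = 0 then K else p)}" for i :: nat
  define D where "D i = uniform_count_measure (B i)" for i
  have B: "finite (B i)" "B i \<noteq> {}" for i using K p_gt_1 by (auto simp: B_def)
  interpret D: product_prob_space D UNIV
    unfolding product_prob_space_def product_prob_space_axioms_def product_sigma_finite_def D_def
    using prob_space_uniform_count_measure[OF B] prob_space_imp_sigma_finite by blast
  let ?P = "PiM UNIV D"
  have spD: "space (D i) = B i" for i by (simp add: D_def space_uniform_count_measure)
  have spP: "d \<in> space ?P \<longleftrightarrow> (\<forall>i. d i \<in> B i)" for d by (auto simp: space_PiM spD PiE_def)
  define z where "z d n = int (\<Sum>i<n. d (Suc i) * p ^ i)" for d :: "nat \<Rightarrow> nat" and n
  have dp: "d (Suc i) < p" if "d \<in> space ?P" for d i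
    using that unfolding spP by (auto simp: B_def dest: spec[of _ "Suc i"])
  have d0: "d 0 \<in> {0..<K}" if "d \<in> space ?P" for d
    using that unfolding spP by (auto simp: B_def dest: spec[of _ 0])
  have zZ: "z d \<in> carrier (Zp p)" if d: "d \<in> space ?P" for d
    unfolding Zp_carrier_iff
  proof (intro allI conjI)
    fix n
    have less: "(\<Sum>i<n. d (Suc i) * p ^ i) < p ^ n" using dp[OF d] by (intro digit_sum_less)
    thus "z d n < int p ^ n" unfolding z_def by (metis of_nat_less_iff of_nat_power)
    show "0 \<le> z d n" unfolding z_def by (rule of_nat_0_le_iff)
    have "(\<Sum>i<Suc n. d (Suc i) * p ^ i) mod p ^ n = (\<Sum>i<n. d (Suc i) * p ^ i)" using less by simp
    hence "int ((\<Sum>i<Suc n. d (Suc i) * p ^ i) mod p ^ n) = int (\<Sum>i<n. d (Suc i) * p ^ i)"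
      by (rule arg_cong)
    thus "z d (Suc n) mod int p ^ n = z d n" unfolding z_def zmod_int of_nat_power .
  qed
  define f where "f d = z d \<odot> g \<oplus> \<psi> (d 0)" for d
  have \<psi>T: "\<psi> (d 0) \<in> tors" if "d \<in> space ?P" for d using bij_betwE[OF \<psi>] d0[OF that] by blast
  have fM: "f \<in> space ?P \<rightarrow> carrier M" using zZ \<psi>T by (auto simp: f_def)
  \<comment> \<open>A cell of level n fixes the torsion part and the first n digits, so its preimage
    is a cylinder over the coordinates 0 to n.\<close>
  have pre: "f -` level n {w} \<inter> space ?P \<in> sets ?P \<and>
      emeasure ?P (f -` level n {w} \<inter> space ?P) = ennreal (1 / (real p ^ n * real K))"
    if w: "w \<in> cells n" for n w
  proof -
    obtain a t where at: "w = (int a, t)" "a < p ^ n" "t \<in> tors"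
      using w unfolding cells_def
      by (auto simp: zless_nat_eq_int_zless elim!: nonneg_int_cases simp flip: of_nat_power)
    obtain j where j: "j \<in> {0..<K}" "\<psi> j = t" using \<psi> at(3) by (metis bij_betw_imp_surj_on imageE)
    define v where "v i = (case i of 0 \<Rightarrow> j | Suc i \<Rightarrow> a div p ^ i mod p)" for i
    have v: "v i \<in> B i" for i using j p_gt_1 by (auto simp: v_def B_def split: nat.splits)
    have "f d \<in> level n {w} \<longleftrightarrow> (\<forall>i\<le>n. d i = v i)" if d: "d \<in> space ?P" for d
    proof -
      have "f d \<in> level n {w} \<longleftrightarrow> z d n = int a \<and> \<psi> (d 0) = t"
        unfolding f_def level_iff[OF zZ[OF d] \<psi>T[OF d]] at by auto
      also have "\<psi> (d 0) = t \<longleftrightarrow> d 0 = j"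
        using \<psi> d0[OF d] j by (auto simp: bij_betw_def inj_on_def)
      also have "z d n = int a \<longleftrightarrow> (\<forall>i<n. d (Suc i) = a div p ^ i mod p)"
      proof
        assume "z d n = int a"
        hence "a = (\<Sum>i<n. d (Suc i) * p ^ i)" unfolding z_def by (metis of_nat_eq_iff)
        thus "\<forall>i<n. d (Suc i) = a div p ^ i mod p"
          using digit_sum_digit[of "\<lambda>i. d (Suc i)" p _ n] dp[OF d] by simp
      next
        assume "\<forall>i<n. d (Suc i) = a div p ^ i mod p"
        hence "(\<Sum>i<n. d (Suc i) * p ^ i) = (\<Sum>i<n. (a div p ^ i mod p) * p ^ i)" by (intro sum.cong) auto
        also have "\<dots> = a" using digit_sum_div_mod[of a p n] at(2) by simp
        finally show "z d n = int a" by (simp add: z_def)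
      qed
      also have "(\<forall>i<n. d (Suc i) = a div p ^ i mod p) \<and> d 0 = j \<longleftrightarrow> (\<forall>i\<le>n. d i = v i)"
        unfolding v_def by (auto split: nat.splits)
      finally show ?thesis .
    qed
    hence eq: "f -` level n {w} \<inter> space ?P = D.emb UNIV {..n} (PiE {..n} (\<lambda>i. {v i}))"
      by (auto simp: prod_emb_def spP[unfolded space_PiM] space_PiM spD PiE_def extensional_def
          restrict_def Pi_def)
    have sing: "{v i} \<in> sets (D i)" for i using v by (simp add: D_def sets_uniform_count_measure)
    have "emeasure ?P (D.emb UNIV {..n} (PiE {..n} (\<lambda>i. {v i}))) = (\<Prod>i\<le>n. emeasure (D i) {v i})"
      by (rule D.emeasure_PiM_emb) (auto simp: sing)
    also have "\<dots> = (\<Prod>i\<le>n. ennreal (1 / real (card (B i))))"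
      using v B by (intro prod.cong) (auto simp: D_def emeasure_uniform_count_measure)
    also have "\<dots> = ennreal (\<Prod>i\<le>n. 1 / real (card (B i)))" by (intro prod_ennreal) simp
    also have "(\<Prod>i\<le>n. 1 / real (card (B i))) = 1 / (real p ^ n * real K)"
      unfolding prod.atMost_shift by (simp add: B_def power_divide prod_constant)
    finally have "emeasure ?P (f -` level n {w} \<inter> space ?P) = ennreal (1 / (real p ^ n * real K))"
      unfolding eq .
    moreover have "f -` level n {w} \<inter> space ?P \<in> sets ?P"
      unfolding eq using sing by (intro sets_PiM_I) auto
    ultimately show ?thesis by blast
  qed
  have sets: "sets (sigma (carrier M) gens) = sigma_sets (carrier M) gens"
      "space (sigma (carrier M) gens) = carrier M"
    using gens_carrier by (simp_all add: space_measure_of_conv)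
  have meas: "f \<in> ?P \<rightarrow>\<^sub>M sigma (carrier M) gens"
  proof (rule measurable_measure_of[OF gens_carrier fM])
    fix A assume "A \<in> gens"
    then obtain n W where A: "A = level n W" "W \<subseteq> cells n" unfolding gens_def by blast
    have "f -` A \<inter> space ?P = (\<Union>w\<in>W. f -` level n {w} \<inter> space ?P)"
      unfolding A(1) by (subst level_decompose) blast
    also have "\<dots> \<in> sets ?P"
      using pre A(2) finite_subset[OF A(2) finite_cells] by (intro sets.finite_UN) auto
    finally show "f -` A \<inter> space ?P \<in> sets ?P" .
  qed
  have "uniform_on_cells (distr ?P (sigma (carrier M) gens) f)"
    unfolding uniform_on_cells_def
  proof (intro conjI allI impI ballI)
    show "prob_space (distr ?P (sigma (carrier M) gens) f)" by (rule D.prob_space_distr[OF meas])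
    fix n w assume n: "N \<le> n" and w: "w \<in> cells n"
    have "level n {w} \<in> sets (sigma (carrier M) gens)"
      unfolding sets using n w by (intro sigma_sets.Basic level_gens) auto
    hence "measure (distr ?P (sigma (carrier M) gens) f) (level n {w})
        = measure ?P (f -` level n {w} \<inter> space ?P)"
      by (rule measure_distr[OF meas])
    also have "\<dots> = 1 / (real p ^ n * real K)" using pre[OF w] by (simp add: measure_def)
    finally show "measure (distr ?P (sigma (carrier M) gens) f) (level n {w})
        = 1 / (real p ^ n * real (card tors))"
      by (simp add: K_def)
  qed (simp_all add: sets)
  thus ?thesis by blast
qed

lemma translate_level:
  assumes "x \<in> carrier M" "W \<subseteq> cells n"
  shows "\<exists>V\<subseteq>cells n. (\<lambda>y. x \<oplus> y) ` level n W = level n V \<and> card V \<le> card W"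
proof -
  obtain c t where ct: "c \<in> carrier (Zp p)" "t \<in> tors" "x = c \<odot> g \<oplus> t" using split[OF assms(1)] by blast
  define h where "h = (\<lambda>(a, s). ((c n + a) mod int p ^ n, t \<oplus> s))"
  have cell: "(\<lambda>y. x \<oplus> y) ` level n {w} = level n {h w}" if "w \<in> cells n" for w
    using translate_cell[OF ct(1,2), of "fst w" "snd w" n] that unfolding ct(3) h_def by (cases w) auto
  have "(\<lambda>y. x \<oplus> y) ` level n W = (\<Union>w\<in>W. (\<lambda>y. x \<oplus> y) ` level n {w})"
    unfolding level_decompose[of n W] by (rule image_UN)
  also have "\<dots> = (\<Union>w\<in>W. level n {h w})"
    by (rule SUP_cong[OF refl]) (use cell assms(2) in blast)
  also have "\<dots> = level n (h ` W)" unfolding level_decompose[of n "h ` W"] by simp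
  finally have "(\<lambda>y. x \<oplus> y) ` level n W = level n (h ` W)" .
  moreover have "h ` W \<subseteq> cells n"
    using assms(2) ct(2) tors_add by (auto simp: h_def cells_def)
  ultimately show ?thesis using card_image_le[OF finite_subset[OF assms(2) finite_cells], of h] by blast
qed

text \<open>A translate of \<mu> again gives equal mass to the cells of each level, hence equals
  \<mu> by uniqueness; this yields invariance on all Borel sets at once.\<close>

lemma uniform_on_cells_haar:
  assumes u: "uniform_on_cells \<mu>"
  shows "is_haar_measure p M \<mu>"
proof -
  have \<mu>: "prob_space \<mu>" "space \<mu> = carrier M" "sets \<mu> = sigma_sets (carrier M) gens"
    using u by (auto simp: uniform_on_cells_def)
  interpret \<mu>: prob_space \<mu> by fact
  have "emeasure \<mu> ((\<lambda>a. x \<oplus> a) ` A) = emeasure \<mu> A" if x: "x \<in> carrier M" and A: "A \<in> sets \<mu>" for x A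
  proof -
    \<comment> \<open>Translation by -x: its preimages are the images under translation by x that
      occur in the definition of invariance.\<close>
    define S where "S = (\<lambda>a. \<ominus> x \<oplus> a)"
    have img: "S -` A \<inter> carrier M = (\<lambda>a. x \<oplus> a) ` A" if "A \<subseteq> carrier M" for A
    proof (intro equalityI subsetI)
      fix y assume "y \<in> S -` A \<inter> carrier M"
      thus "y \<in> (\<lambda>a. x \<oplus> a) ` A" using x
        by (intro image_eqI[of _ _ "\<ominus> x \<oplus> y"]) (auto simp: S_def M.r_neg2)
    next
      fix y assume "y \<in> (\<lambda>a. x \<oplus> a) ` A"
      thus "y \<in> S -` A \<inter> carrier M" using x that by (auto simp: S_def M.r_neg1 subset_iff)
    qed
    have S: "S \<in> \<mu> \<rightarrow>\<^sub>M \<mu>"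
    proof (rule measurable_sigma_sets[OF \<mu>(3) gens_carrier])
      show "S \<in> space \<mu> \<rightarrow> carrier M" using x \<mu>(2) by (auto simp: S_def)
      fix B assume "B \<in> gens"
      then obtain n W where B: "B = level n W" "N \<le> n" "W \<subseteq> cells n" unfolding gens_def by blast
      obtain V where V: "V \<subseteq> cells n" "(\<lambda>y. x \<oplus> y) ` level n W = level n V"
        using translate_level[OF x B(3)] by blast
      have "S -` B \<inter> space \<mu> = level n V" using img[OF level_carrier] B(1) V(2) \<mu>(2) by simp
      thus "S -` B \<inter> space \<mu> \<in> sets \<mu>"
        unfolding \<mu>(3) using B(2) V(1) by (auto intro: sigma_sets.Basic level_gens)
    qed
    have "uniform_on_cells (distr \<mu> \<mu> S)"
      unfolding uniform_on_cells_def
    proof (intro conjI allI impI ballI)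
      show "prob_space (distr \<mu> \<mu> S)" by (rule \<mu>.prob_space_distr[OF S])
      fix n w assume n: "N \<le> n" and w: "w \<in> cells n"
      obtain c t where ct: "c \<in> carrier (Zp p)" "t \<in> tors" "x = c \<odot> g \<oplus> t" using split[OF x] by blast
      obtain a s where as: "w = (a, s)" by (cases w)
      define w' where "w' = ((c n + a) mod int p ^ n, t \<oplus> s)"
      have w': "w' \<in> cells n" using w ct(2) tors_add unfolding w'_def as by (auto simp: cells_def)
      have tr: "(\<lambda>y. x \<oplus> y) ` level n {w} = level n {w'}"
        using translate_cell[OF ct(1,2), of a s n] w unfolding ct(3) as w'_def by simp
      have "level n {w} \<in> sets \<mu>"
        unfolding \<mu>(3) using n w by (intro sigma_sets.Basic level_gens) auto
      hence "measure (distr \<mu> \<mu> S) (level n {w}) = measure \<mu> (S -` level n {w} \<inter> space \<mu>)"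
        by (rule measure_distr[OF S])
      also have "\<dots> = measure \<mu> (level n {w'})" using img[OF level_carrier] tr \<mu>(2) by simp
      also have "\<dots> = 1 / (real p ^ n * real (card tors))"
        using u n w' by (auto simp: uniform_on_cells_def)
      finally show "measure (distr \<mu> \<mu> S) (level n {w}) = 1 / (real p ^ n * real (card tors))" .
    qed (simp_all add: \<mu>)
    hence "distr \<mu> \<mu> S = \<mu>" using u by (rule uniform_on_cells_unique)
    hence "emeasure \<mu> A = emeasure \<mu> (S -` A \<inter> space \<mu>)" using emeasure_distr[OF S A] by simp
    also have "S -` A \<inter> space \<mu> = (\<lambda>a. x \<oplus> a) ` A"
      using img sets.sets_into_space[OF A] \<mu>(2) by simp
    finally show ?thesis by simp
  qed
  thus ?thesis using \<mu> unfolding is_haar_measure_def sigma_open_eq by blast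
qed

text \<open>Existence and uniqueness together give meaning to the definite description.\<close>

theorem haar_uniform_on_cells: "uniform_on_cells (haar p M)"
proof -
  obtain \<mu> where \<mu>: "uniform_on_cells \<mu>" using uniform_on_cells_exists by blast
  have "haar p M = \<mu>"
    unfolding haar_def
    using uniform_on_cells_haar[OF \<mu>] uniform_on_cells_unique[OF haar_uniform \<mu>] by (rule the_equality)
  thus ?thesis using \<mu> by simp
qed

end

section \<open>The quotient by a random element\<close>

lemma card_nonmultiples:
  fixes p :: nat
  assumes "p > 0"
  shows "card {b \<in> {0..<int p ^ Suc n}. \<not> int p dvd b} = p ^ Suc n - p ^ n"
proof -
  have "{b \<in> {0..<int p ^ Suc n}. int p dvd b} = (\<lambda>j. int p * j) ` {0..<int p ^ n}"
  proof (intro equalityI subsetI)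
    fix b assume "b \<in> {b \<in> {0..<int p ^ Suc n}. int p dvd b}"
    then obtain j where j: "b = int p * j" "0 \<le> int p * j" "int p * j < int p * int p ^ n" by auto
    hence "0 \<le> j" "j < int p ^ n" using assms by (simp_all add: zero_le_mult_iff)
    thus "b \<in> (\<lambda>j. int p * j) ` {0..<int p ^ n}" using j by auto
  qed (use assms in auto)
  moreover have "inj_on (\<lambda>j. int p * j) {0..<int p ^ n}" using assms by (auto simp: inj_on_def)
  ultimately have c: "card {b \<in> {0..<int p ^ Suc n}. int p dvd b} = p ^ n"
    by (simp add: card_image nat_power_eq)
  have "card ({0..<int p ^ Suc n} - {b \<in> {0..<int p ^ Suc n}. int p dvd b})
      = card {0..<int p ^ Suc n} - p ^ n"
    unfolding c[symmetric]
    by (rule card_Diff_subset[OF finite_subset[OF Collect_restrict] Collect_restrict]) simp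
  also have "{0..<int p ^ Suc n} - {b \<in> {0..<int p ^ Suc n}. int p dvd b} =
      {b \<in> {0..<int p ^ Suc n}. \<not> int p dvd b}" by blast
  also have "card {0..<int p ^ Suc n} = p ^ Suc n" by (simp add: nat_power_eq nat_mult_distrib)
  finally show ?thesis .
qed

context Zp_module
begin

lemma cyc_smult_unit:
  assumes u: "u \<in> punit" and h: "h \<in> carrier M"
  shows "cyc (u \<odot> h) = cyc h"
proof -
  obtain w where w: "w \<in> punit" "w \<boxtimes> u = \<one>\<^bsub>Zp p\<^esub>" using punit_inverse[OF u] .
  note uc = punit_carrier[OF u] and wc = punit_carrier[OF w(1)]
  show ?thesis
  proof (intro equalityI subsetI)
    fix x assume "x \<in> cyc (u \<odot> h)"
    then obtain z where z: "z \<in> carrier (Zp p)" "x = z \<odot> (u \<odot> h)" by (auto simp: cyc_def)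
    hence "x = (z \<boxtimes> u) \<odot> h" using uc h by (simp add: smult_assoc1)
    moreover have "z \<boxtimes> u \<in> carrier (Zp p)" using z uc by simp
    ultimately show "x \<in> cyc h" unfolding cyc_def by blast
  next
    fix x assume "x \<in> cyc h"
    then obtain z where z: "z \<in> carrier (Zp p)" "x = z \<odot> h" by (auto simp: cyc_def)
    have "(z \<boxtimes> w) \<odot> (u \<odot> h) = z \<odot> ((w \<boxtimes> u) \<odot> h)" using z(1) uc wc h by (simp add: smult_assoc1)
    hence "x = (z \<boxtimes> w) \<odot> (u \<odot> h)" using z w h by simp
    moreover have "z \<boxtimes> w \<in> carrier (Zp p)" using z wc by simp
    ultimately show "x \<in> cyc (u \<odot> h)" unfolding cyc_def by blast
  qed
qed

end

context split_p_group
begin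

definition presents :: "'a \<Rightarrow> bool"
  where "presents h \<longleftrightarrow> (add_monoid M Mod cyc h) \<cong> G"

text \<open>p^k kills the quotient G, so p^k g lies in Zp h; a torsion h would make p^k g
  torsion.\<close>

lemma presents_nontorsion:
  assumes h: "h \<in> carrier M" and pres: "presents h"
  shows "nontorsion h"
proof -
  obtain q where q: "q \<in> hom (add_monoid M) G"
      "\<And>e. e \<in> carrier M \<Longrightarrow> q e = \<one>\<^bsub>G\<^esub> \<longleftrightarrow> (\<exists>z\<in>carrier (Zp p). e = z \<odot> h)"
    using quotient_iso_hom[OF Zp_module_axioms h] pres unfolding presents_def by blast
  interpret q: group_hom "add_monoid M" G q
    using q(1) M.a_group G.is_group by (simp add: group_hom_def group_hom_axioms_def)
  have qg: "q g \<in> carrier G" using q.hom_closed[of g] by simp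
  have "q (add_pow M (p ^ k) g) = q g [^]\<^bsub>G\<^esub> (p ^ k)"
    using q.hom_nat_pow[of g "p ^ k"] by (simp add: add_pow_def)
  hence "q (pw k \<odot> g) = \<one>\<^bsub>G\<^esub>" using pow_pk[OF qg] add_pow_eq_smult[OF gM, of "p ^ k"] by simp
  then obtain z where z: "z \<in> carrier (Zp p)" "pw k \<odot> g = z \<odot> h" using q(2)[of "pw k \<odot> g"] by auto
  obtain c t where ct: "c \<in> carrier (Zp p)" "t \<in> tors" "h = c \<odot> g \<oplus> t" using split[OF h] by blast
  have "c \<noteq> \<zero>\<^bsub>Zp p\<^esub>"
  proof
    assume "c = \<zero>\<^bsub>Zp p\<^esub>"
    hence "h \<in> tors" using ct by simp
    hence "pw k \<odot> g \<in> tors" using z tors_smult by simp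
    thus False using nontorsion_smult_tors[OF g padic_of_int_closed] pw_nonzero by blast
  qed
  thus ?thesis unfolding ct(3) using ct(1,2) by (intro nontorsion_line)
qed

lemma presents_ext:
  assumes h: "h \<in> carrier M" and pres: "presents h"
  obtains q where "ext_pair p G M h q"
  using quotient_maps_iff[OF Zp_module_axioms presents_nontorsion[OF assms]] pres that
  unfolding presents_def quotient_maps_def by blast

lemma presents_unit: "u \<in> punit \<Longrightarrow> h \<in> carrier M \<Longrightarrow> presents (u \<odot> h) \<longleftrightarrow> presents h"
  unfolding presents_def by (simp add: cyc_smult_unit)

lemma prob_d_eq: "prob_d p M G = measure (haar p M) {h \<in> carrier M. presents h}"
proof -
  have "{h \<in> carrier M. (add_monoid M Mod submodule_generated (Zp p) M {h}) \<cong> G}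
      = {h \<in> carrier M. presents h}"
    unfolding presents_def using submodule_generated_singleton by auto
  thus ?thesis by (simp add: prob_d_def)
qed

lemma presents_empty:
  assumes "\<And>v. p ^ k \<noteq> p ^ v * card tors"
  shows "{h \<in> carrier M. presents h} = {}"
proof -
  have "False" if "h \<in> carrier M" "presents h" for h
    using presents_ext[OF that] ext_line assms by metis
  thus ?thesis by blast
qed

text \<open>
  At level \<open>v + N + 1\<close> the elements presenting \<open>G\<close> are the unit multiples \<open>b (p^v g + s)\<close>; as
  \<open>p^N\<close> kills the torsion, \<open>b s\<close> depends only on \<open>b\<close> modulo \<open>p^(N+1)\<close>.
\<close>

definition cell_map :: "nat \<Rightarrow> int \<times> 'a \<Rightarrow> int \<times> 'a"
  where "cell_map v = (\<lambda>(b, s). (int p ^ v * b, padic_of_int p b \<odot> s))"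

text \<open>A pair (b, s) stands for b (p^v g + s) with b a unit. The range p^(N+1) rather than p^N
  keeps b modulo p visible even when N = 0.\<close>

definition unit_cells :: "nat \<Rightarrow> (int \<times> 'a) set"
  where "unit_cells v = {b \<in> {0..<int p ^ Suc N}. \<not> int p dvd b} \<times> {s \<in> tors. presents (line v s)}"

lemma smult_tors_eq:
  assumes "x \<in> carrier (Zp p)" "y \<in> carrier (Zp p)" "x (Suc N) = y (Suc N)" "s \<in> tors"
  shows "x \<odot> s = y \<odot> s"
proof -
  have "x N = y N" using Zp_nth_mod[OF assms(1), of N "Suc N"] Zp_nth_mod[OF assms(2), of N "Suc N"]
      assms(3) by simp
  thus ?thesis
    using smult_killed[OF tM[OF assms(4)] _ tors_killed[OF assms(4)]] assms(1,2) by metis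
qed

lemma padic_of_int_nth: "0 \<le> b \<Longrightarrow> b < int p ^ n \<Longrightarrow> padic_of_int p b n = b"
  by (simp add: padic_of_int_def)

lemma padic_of_int_unit: "\<not> int p dvd b \<Longrightarrow> padic_of_int p b \<in> punit"
  unfolding punit_def by (auto simp: padic_of_int_def[of p b] dvd_eq_mod_eq_0) (simp add:
      padic_of_int_def[symmetric])

lemma line_smult:
  assumes "u \<in> carrier (Zp p)" "s \<in> tors"
  shows "u \<odot> line v s = (pw v \<boxtimes> u) \<odot> g \<oplus> u \<odot> s"
  using assms smult_comm[of u "pw v" g] by (simp add: smult_r_distr smult_assoc1)

lemma pw_mult_nth: "u \<in> carrier (Zp p) \<Longrightarrow> (pw v \<boxtimes> u) (v + n) = int p ^ v * u n"
proof -
  assume u: "u \<in> carrier (Zp p)"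
  have "(pw v \<boxtimes> u) (v + n) = (int p ^ v * u (v + n)) mod (int p ^ v * int p ^ n)"
    by (simp add: Zp_nth_pw_mult power_add)
  also have "\<dots> = int p ^ v * (u (v + n) mod int p ^ n)" by (simp only: mult_mod_right)
  finally show ?thesis using Zp_nth_mod[OF u, of n "v + n"] by simp
qed

text \<open>If c g + t presents G, then c = p^v u by \<open>ext_line\<close>, and b = u mod p^(N+1)
  with s = u^-1 t gives the cell. Conversely, a cell yields c = p^v u with u congruent to b modulo
  p^(N+1); then u is a unit and u s = b s = t, so c g + t = u (p^v g + s).\<close>

lemma presents_iff_cell:
  assumes v: "p ^ k = p ^ v * card tors" and ct: "c \<in> carrier (Zp p)" "t \<in> tors"
  shows "presents (c \<odot> g \<oplus> t) \<longleftrightarrow> (c (v + Suc N), t) \<in> cell_map v ` unit_cells v"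
proof
  assume pres: "presents (c \<odot> g \<oplus> t)"
  have hM: "c \<odot> g \<oplus> t \<in> carrier M" using ct by simp
  obtain q where q: "ext_pair p G M (c \<odot> g \<oplus> t) q" using presents_ext[OF hM pres] .
  obtain w u s where u: "u \<in> punit" "s \<in> tors" "c \<odot> g \<oplus> t = (pw w \<boxtimes> u) \<odot> g \<oplus> s"
      "p ^ k = p ^ w * card tors"
    using ext_line[OF q] .
  have "w = v" using u(4) v card_tors_pos p_gt_1 by simp
  note uc = punit_carrier[OF u(1)]
  have c: "c = pw v \<boxtimes> u"
    using split_unique(1)[OF ct(1) _ ct(2) u(2,3)] uc \<open>w = v\<close> by simp
  obtain u' where u': "u' \<in> punit" "u' \<boxtimes> u = \<one>\<^bsub>Zp p\<^esub>" using punit_inverse[OF u(1)] .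
  note u'c = punit_carrier[OF u'(1)]
  define s' where "s' = u' \<odot> t"
  have s': "s' \<in> tors" using u'c ct(2) tors_smult by (simp add: s'_def)
  have us': "u \<odot> s' = t"
    unfolding s'_def using smult_assoc1[OF uc u'c tM[OF ct(2)]] u'(2) Zp.m_comm[OF uc u'c] ct(2) by simp
  have "u \<odot> line v s' = c \<odot> g \<oplus> t" using line_smult[OF uc s'] us' c by simp
  hence "presents (line v s')" using presents_unit[OF u(1), of "line v s'"] pres s' by simp
  moreover have "\<not> int p dvd u (Suc N)"
  proof -
    have "u (Suc N) mod int p = u 1" using Zp_nth_mod[OF uc, of 1 "Suc N"] by simp
    thus ?thesis using u(1) by (auto simp: punit_def dvd_eq_mod_eq_0)
  qed
  moreover have b: "0 \<le> u (Suc N)" "u (Suc N) < int p ^ Suc N"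
    using uc unfolding Zp_carrier_iff by blast+
  ultimately have "(u (Suc N), s') \<in> unit_cells v" using s' by (simp add: unit_cells_def)
  moreover have "padic_of_int p (u (Suc N)) \<odot> s' = t"
    using smult_tors_eq[OF padic_of_int_closed uc _ s', of "u (Suc N)"] padic_of_int_nth[OF b] us'
      by simp
  hence "cell_map v (u (Suc N), s') = (c (v + Suc N), t)"
    unfolding cell_map_def using pw_mult_nth[OF uc, of v "Suc N"] c by simp
  ultimately show "(c (v + Suc N), t) \<in> cell_map v ` unit_cells v" by (metis image_eqI)
next
  assume "(c (v + Suc N), t) \<in> cell_map v ` unit_cells v"
  then obtain b s where bs: "0 \<le> b" "b < int p ^ Suc N" "\<not> int p dvd b" "s \<in> tors" "presents (line v s)"
    "c (v + Suc N) = int p ^ v * b" "t = padic_of_int p b \<odot> s"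
    unfolding cell_map_def unit_cells_def by auto
  have "c v = 0" using Zp_nth_mod[OF ct(1), of v "v + Suc N"] bs(6) by simp
  then obtain u where u: "u \<in> carrier (Zp p)" "c = pw v \<boxtimes> u" using Zp_pw_dvd[OF ct(1)] by blast
  have "int p ^ v * u (Suc N) = int p ^ v * b"
    using pw_mult_nth[OF u(1), of v "Suc N"] u(2) bs(6) by simp
  hence ub: "u (Suc N) = b" by simp
  have "u 1 = b mod int p" using Zp_nth_mod[OF u(1), of 1 "Suc N"] ub by simp
  hence up: "u \<in> punit" using u(1) bs(3) by (auto simp: punit_def dvd_eq_mod_eq_0)
  have "u \<odot> s = t"
    unfolding bs(7) using smult_tors_eq[OF u(1) padic_of_int_closed _ bs(4), of b] ub
        padic_of_int_nth[OF bs(1,2)] by simp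
  hence "c \<odot> g \<oplus> t = u \<odot> line v s" using line_smult[OF u(1) bs(4)] u(2) by simp
  thus "presents (c \<odot> g \<oplus> t)" using presents_unit[OF up, of "line v s"] bs(4,5) by simp
qed

lemma cell_map_inj: "inj_on (cell_map v) (unit_cells v)"
proof (rule inj_onI, clarify)
  fix b s b' s' assume x: "(b, s) \<in> unit_cells v" "(b', s') \<in> unit_cells v"
    and eq: "cell_map v (b, s) = cell_map v (b', s')"
  have b: "b = b'" using eq by (simp add: cell_map_def)
  have "padic_of_int p b \<in> punit" using x(1) by (intro padic_of_int_unit) (simp add: unit_cells_def)
  hence "inj_on (\<lambda>x. padic_of_int p b \<odot> x) (carrier M)" using smult_bij by (simp add: bij_betw_def)
  moreover have "padic_of_int p b \<odot> s = padic_of_int p b \<odot> s'" using eq b by (simp add: cell_map_def)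
  moreover have "s \<in> carrier M" "s' \<in> carrier M" using x by (auto simp: unit_cells_def)
  ultimately show "b = b' \<and> s = s'" using b by (simp add: inj_on_def)
qed

lemma cell_map_cells: "cell_map v ` unit_cells v \<subseteq> cells (v + Suc N)"
proof
  fix w assume "w \<in> cell_map v ` unit_cells v"
  then obtain b s where bs: "0 \<le> b" "b < int p ^ Suc N" "s \<in> tors"
      "w = (int p ^ v * b, padic_of_int p b \<odot> s)"
    unfolding cell_map_def unit_cells_def by auto
  have "int p ^ v * b < int p ^ v * int p ^ Suc N"
    using bs(2) q_pos[of v] by (simp only: mult_less_cancel_left_pos)
  hence "int p ^ v * b < int p ^ (v + Suc N)" by (simp only: power_add)
  thus "w \<in> cells (v + Suc N)" using bs tors_smult by (simp add: cells_def)
qed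

lemma presents_level:
  assumes v: "p ^ k = p ^ v * card tors"
  shows "{h \<in> carrier M. presents h} = level (v + Suc N) (cell_map v ` unit_cells v)"
proof (rule set_eq_splitI)
  fix c t assume ct: "c \<in> carrier (Zp p)" "t \<in> tors"
  have "c \<odot> g \<oplus> t \<in> {h \<in> carrier M. presents h} \<longleftrightarrow> presents (c \<odot> g \<oplus> t)" using ct by simp
  thus "c \<odot> g \<oplus> t \<in> {h \<in> carrier M. presents h}
      \<longleftrightarrow> c \<odot> g \<oplus> t \<in> level (v + Suc N) (cell_map v ` unit_cells v)"
    unfolding level_iff[OF ct] presents_iff_cell[OF v ct] .
qed (use level_carrier in auto)

text \<open>Guards against the default measure 0 of a nonmeasurable set; needed for the disjoint
  events in \<open>sum_prob_d_le_1\<close>.\<close>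

lemma presents_sets: "{h \<in> carrier M. presents h} \<in> sets (haar p M)"
proof (cases "\<exists>v. p ^ k = p ^ v * card tors")
  case True
  then obtain v where v: "p ^ k = p ^ v * card tors" by blast
  have "level (v + Suc N) (cell_map v ` unit_cells v) \<in> gens"
    by (intro level_gens cell_map_cells) simp
  thus ?thesis
    using haar_uniform_on_cells unfolding presents_level[OF v] uniform_on_cells_def
    by (auto intro: sigma_sets.Basic)
next
  case False
  hence "{h \<in> carrier M. presents h} = {}" by (intro presents_empty) blast
  thus ?thesis by (simp only: sets.empty_sets)
qed

text \<open>At level v + N + 1, (p^(N+1) - p^N) |S| of the p^(v+N+1) |T| cells consist of elements
  presenting G, where S is the set of admissible s; the auxiliary N cancels.\<close>

lemma prob_d_value:
  assumes v: "p ^ k = p ^ v * card tors"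
  shows "prob_d p M G = real (card {s \<in> tors. presents (line v s)}) * (1 - 1 / real p) / real (p ^ k)"
proof -
  let ?S = "{s \<in> tors. presents (line v s)}"
  have p_pos: "p > 0" using p_gt_1 by simp
  have "card (cell_map v ` unit_cells v) = card (unit_cells v)" by (rule card_image[OF cell_map_inj])
  also have "\<dots> = (p ^ Suc N - p ^ N) * card ?S"
    unfolding unit_cells_def card_cartesian_product card_nonmultiples[OF p_pos] ..
  finally have "card (cell_map v ` unit_cells v) = (p ^ Suc N - p ^ N) * card ?S" .
  moreover have "p ^ N \<le> p ^ Suc N" using p_gt_1 by simp
  ultimately have c: "real (card (cell_map v ` unit_cells v))
      = (real p ^ Suc N - real p ^ N) * real (card ?S)"
    by (simp add: of_nat_diff del: power_Suc)
  have "prob_d p M G = real (card (cell_map v ` unit_cells v)) / (real p ^ (v + Suc N) * real (card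
      tors))"
    unfolding prob_d_eq presents_level[OF v]
    by (rule uniform_on_cells_level[OF haar_uniform_on_cells _ cell_map_cells]) simp
  also have "\<dots> = real (card ?S) * (1 - 1 / real p) / (real p ^ v * real (card tors))"
  proof -
    have 1: "(real p ^ Suc N - real p ^ N) * real (card ?S)
        = real p ^ N * ((real p - 1) * real (card ?S))"
      by (simp add: algebra_simps)
    have 2: "real p ^ (v + Suc N) * real (card tors)
        = real p ^ N * (real p * (real p ^ v * real (card tors)))"
      by (simp add: power_add)
    have "(real p - 1) / real p = 1 - 1 / real p" using p_pos by (simp add: field_simps)
    hence "((real p - 1) * real (card ?S)) / (real p * (real p ^ v * real (card tors))) =
        real (card ?S) * (1 - 1 / real p) / (real p ^ v * real (card tors))"
      by (metis (no_types, lifting) times_divide_times_eq mult.commute times_divide_eq_right)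
    thus ?thesis unfolding c 1 2 using p_pos by simp
  qed
  also have "real p ^ v * real (card tors) = real (p ^ k)" unfolding v by simp
  finally show ?thesis .
qed

lemma prob_d_zero:
  assumes "\<And>v. p ^ k \<noteq> p ^ v * card tors"
  shows "prob_d p M G = 0"
  unfolding prob_d_eq presents_empty[OF assms] by simp

lemma card_auto_pos: "card (auto G) > 0"
  using finite_auto G.id_in_auto by (auto simp: card_gt_0_iff)

theorem detailed_balance:
  assumes c: "c0 p = (1 - 1 / real p) * c1 p"
  shows "mu0 p G * prob_dstar p G M = mu1 p M * prob_d p M G"
proof (cases "\<exists>v. p ^ k = p ^ v * card tors")
  \<comment> \<open>No v satisfies p^v |T| = |G|, so both transition probabilities are 0.\<close>
  case False
  thus ?thesis
    using prob_d_zero realized_empty prob_dstar_eq[OF Zp_module_axioms] by simp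
next
  case True
  then obtain v where v: "p ^ k = p ^ v * card tors" by blast
  let ?S = "{s \<in> tors. presents (line v s)}"
  have count: "real (card (realized M)) * (real (card tors) * real (card (auto tors_group))) =
      real (card ?S) * real (card (auto G))"
    using arg_cong[OF realized_count[OF v], of real] unfolding presents_def[symmetric]
    by (simp only: of_nat_mult)
  have "finite (auto tors_group)" "auto tors_group \<noteq> {}"
  proof -
    show "finite (auto tors_group)" by (rule finite_auto_tors)
    have "group tors_group"
      using tors_submodule M.a_group group.subgroup_imp_group submodule.axioms(1) by blast
    thus "auto tors_group \<noteq> {}" using group.id_in_auto by blast
  qed
  hence pos: "real (card (auto tors_group)) > 0" "real (card tors) > 0" "real (card (auto G)) > 0"
      "real (p ^ k) > 0"
    using card_tors_pos card_auto_pos p_gt_1 by (simp_all add: card_gt_0_iff)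
  have "mu0 p G * prob_dstar p G M =
      c0 p / real (card (auto G)) * (real (card (realized M)) / real (p ^ k))"
    unfolding mu0_def prob_dstar_eq[OF Zp_module_axioms] ..
  also have "real (card (realized M)) =
      real (card ?S) * real (card (auto G)) / (real (card tors) * real (card (auto tors_group)))"
    using count pos by (simp add: field_simps)
  also have "c0 p / real (card (auto G)) *
      (real (card ?S) * real (card (auto G)) / (real (card tors) * real (card (auto tors_group))) /
          real (p ^ k)) =
    c1 p / (real (card tors) * real (card (auto tors_group))) *
      (real (card ?S) * (1 - 1 / real p) / real (p ^ k))"
    unfolding c using pos(3) by simp
  also have "\<dots> = mu1 p M * prob_d p M G"
    unfolding mu1_def prob_d_value[OF v] Let_def ..
  finally show ?thesis .
qed

end

section \<open>The constants, positivity and row sums\<close>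

context padic_prime
begin

lemma c1_pos: "c1 p > 0" and c0_c1: "c0 p = (1 - 1 / real p) * c1 p"
proof -
  define f where "f i = 1 - 1 / real p ^ (i + 1)" for i :: nat
  have pos: "f i > 0" for i
  proof -
    have "1 < real p ^ (i + 1)" using p_gt_1 by (intro one_less_power) auto
    thus ?thesis by (simp add: f_def)
  qed
  have "summable (\<lambda>i. (1 / real p) ^ (i + 1))"
    using p_gt_1 by (intro summable_ignore_initial_segment summable_geometric) simp
  hence "summable (\<lambda>i. norm (f i - 1))" by (simp add: f_def power_divide)
  hence conv: "convergent_prod f"
    by (intro abs_convergent_prod_imp_convergent_prod summable_imp_abs_convergent_prod)
  hence conv': "convergent_prod (\<lambda>i. f (Suc i))" by simp
  have c1: "c1 p = prodinf (\<lambda>i. f (Suc i))" by (simp add: c1_def f_def)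
  have "(\<lambda>n. \<Prod>i\<le>n. f (Suc i)) \<longlonglongrightarrow> c1 p"
    unfolding c1 by (rule convergent_prod_LIMSEQ[OF conv'])
  hence "0 \<le> c1 p" by (rule LIMSEQ_le_const) (intro exI[of _ 0] allI impI prod_nonneg less_imp_le pos)
  moreover have "c1 p \<noteq> 0" unfolding c1 using prodinf_nonzero[OF conv'] pos by (metis less_irrefl)
  ultimately show "c1 p > 0" by simp
  have "(\<lambda>i. f (Suc i)) has_prod c1 p" unfolding c1 using conv' by (rule convergent_prod_has_prod)
  \<comment> \<open>The product for \<open>c0\<close> has one more factor in front than that for
    \<open>c1\<close>, namely f 0 = 1 - 1/p.\<close>
  hence "f has_prod (c1 p * f 0)" by (rule has_prod_Suc_imp)
  hence "prodinf f = c1 p * f 0" by (rule has_prod_unique[symmetric])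
  moreover have "c0 p = prodinf f" by (simp add: c0_def f_def[abs_def])
  ultimately show "c0 p = (1 - 1 / real p) * c1 p" by (simp add: f_def)
qed

lemma p_group_exists:
  assumes "finite_abelian_p_group p G"
  obtains k where "p_group p G k"
proof -
  have G: "comm_group G" "finite (carrier G)" using assms by (auto simp: finite_abelian_p_group_def)
  obtain k where "order G = p ^ k" using assms by (auto simp: finite_abelian_p_group_def)
  thus ?thesis
    using that[of k] p_group.intro[OF padic_prime_axioms G(1)] G(2) by (simp add: p_group_axioms_def)
qed

lemma split_module_exists:
  assumes "fg_Zp_module_rank1 p M"
  obtains g N where "split_module p M g N"
proof -
  have "Module.module (Zp p) M" "finitely_generated_module (Zp p) M" "has_rank (Zp p) M 1"
    using assms by (auto simp: fg_Zp_module_rank1_def)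
  thus ?thesis
    using Zp_module.rank1_split[OF Zp_module.intro[OF padic_prime_axioms]] that by blast
qed

lemma balance:
  assumes G: "finite_abelian_p_group p G" and M: "fg_Zp_module_rank1 p M"
  shows "mu0 p G * prob_dstar p G M = mu1 p M * prob_d p M G"
proof -
  obtain k where k: "p_group p G k" using p_group_exists[OF G] .
  obtain g N where s: "split_module p M g N" using split_module_exists[OF M] .
  have "split_p_group p M g N G k" using s k by (rule split_p_group.intro)
  thus ?thesis using c0_c1 by (rule split_p_group.detailed_balance)
qed

lemma mu0_pos:
  assumes "finite_abelian_p_group p G"
  shows "mu0 p G > 0"
proof -
  obtain k where "p_group p G k" using p_group_exists[OF assms] .
  then interpret p_group p G k .
  have "card (auto G) > 0" using finite_auto G.id_in_auto by (auto simp: card_gt_0_iff)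
  moreover have "c0 p > 0" unfolding c0_c1 using c1_pos p_gt_1 by simp
  ultimately show ?thesis by (simp add: mu0_def)
qed

lemma mu1_pos:
  assumes "fg_Zp_module_rank1 p M"
  shows "mu1 p M > 0"
proof -
  obtain g N where "split_module p M g N" using split_module_exists[OF assms] .
  then interpret split_module p M g N .
  have "group tors_group"
    using tors_submodule M.a_group group.subgroup_imp_group submodule.axioms(1) by blast
  hence "auto tors_group \<noteq> {}" using group.id_in_auto by blast
  hence "card (auto tors_group) > 0" using finite_auto_tors by (simp add: card_gt_0_iff)
  thus ?thesis using c1_pos card_tors_pos by (simp add: mu1_def Let_def)
qed

text \<open>A character realized on two modules makes them isomorphic by \<open>ext_iso\<close>, so
  pairwise non-isomorphic modules realize disjoint sets among the |G| characters.\<close>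

lemma sum_prob_dstar_le_1:
  fixes M :: "'i \<Rightarrow> (padic, 'b) module"
  assumes G: "finite_abelian_p_group p G" and S: "finite S"
    and M: "\<And>i. i \<in> S \<Longrightarrow> fg_Zp_module_rank1 p (M i)"
    and noniso: "\<And>i j. i \<in> S \<Longrightarrow> j \<in> S \<Longrightarrow> mod_isomorphic (Zp p) (M i) (M j) \<Longrightarrow> i = j"
  shows "(\<Sum>i\<in>S. prob_dstar p G (M i)) \<le> 1"
proof -
  obtain k where "p_group p G k" using p_group_exists[OF G] .
  then interpret p_group p G k .
  have Z: "Zp_module p (M i)" if "i \<in> S" for i
    using M[OF that] Zp_module.intro[OF padic_prime_axioms] by (auto simp: fg_Zp_module_rank1_def)
  have fin: "finite (realized (M i))" for i
    using finite_CH by (rule finite_subset[rotated]) (auto simp: realized_def)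
  have "disjoint_family_on (\<lambda>i. realized (M i)) S"
    unfolding disjoint_family_on_def
  proof (intro ballI impI)
    fix i j assume ij: "i \<in> S" "j \<in> S" "i \<noteq> j"
    have False if x: "\<xi> \<in> realized (M i)" "\<xi> \<in> realized (M j)" for \<xi>
    proof -
      obtain h q where "ext_pair p G (M i) h q" "is_char p k (M i) h q \<xi>"
        using x(1) by (auto simp: realized_def)
      moreover obtain h' q' where "ext_pair p G (M j) h' q'" "is_char p k (M j) h' q' \<xi>"
        using x(2) by (auto simp: realized_def)
      ultimately have "mod_isomorphic (Zp p) (M i) (M j)"
        unfolding mod_isomorphic_def using ext_iso[OF Z[OF ij(1)] Z[OF ij(2)]] by blast
      thus False using noniso ij by blast
    qed
    thus "realized (M i) \<inter> realized (M j) = {}" by blast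
  qed
  hence "(\<Sum>i\<in>S. card (realized (M i))) = card (\<Union>i\<in>S. realized (M i))"
    using card_UN_disjoint'[of "\<lambda>i. realized (M i)" S] fin S by simp
  also have "\<dots> \<le> card CH" by (rule card_mono[OF finite_CH]) (auto simp: realized_def)
  finally have "(\<Sum>i\<in>S. card (realized (M i))) \<le> p ^ k" using card_charsG by simp
  hence "real (\<Sum>i\<in>S. card (realized (M i))) \<le> real (p ^ k)" by (rule of_nat_mono)
  moreover have "(\<Sum>i\<in>S. prob_dstar p G (M i)) = real (\<Sum>i\<in>S. card (realized (M i))) / real (p ^ k)"
    using prob_dstar_eq[OF Z] by (simp add: sum_divide_distrib)
  ultimately show ?thesis using p_gt_1 by simp
qed

text \<open>Pairwise non-isomorphic groups are presented by disjoint measurable sets of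
  elements.\<close>

lemma sum_prob_d_le_1:
  fixes G :: "'i \<Rightarrow> 'g monoid"
  assumes M: "fg_Zp_module_rank1 p M" and S: "finite S"
    and G: "\<And>i. i \<in> S \<Longrightarrow> finite_abelian_p_group p (G i)"
    and noniso: "\<And>i j. i \<in> S \<Longrightarrow> j \<in> S \<Longrightarrow> G i \<cong> G j \<Longrightarrow> i = j"
  shows "(\<Sum>i\<in>S. prob_d p M (G i)) \<le> 1"
proof -
  obtain g N where s: "split_module p M g N" using split_module_exists[OF M] .
  interpret split_module p M g N by (rule s)
  define A where "A i = {h \<in> carrier M. (add_monoid M Mod cyc h) \<cong> G i}" for i
  interpret H: prob_space "haar p M" using haar_uniform_on_cells by (simp add: uniform_on_cells_def)
  have A: "A i \<in> sets (haar p M) \<and> prob_d p M (G i) = measure (haar p M) (A i)" if i: "i \<in> S" for i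
  proof -
    obtain k where "p_group p (G i) k" using p_group_exists[OF G[OF i]] .
    then interpret split_p_group p M g N "G i" k by (intro split_p_group.intro s)
    show ?thesis using presents_sets prob_d_eq unfolding presents_def A_def by blast
  qed
  have "disjoint_family_on A S"
    unfolding disjoint_family_on_def
  proof (intro ballI impI)
    fix i j assume ij: "i \<in> S" "j \<in> S" "i \<noteq> j"
    have False if h: "h \<in> A i" "h \<in> A j" for h
    proof -
      have hM: "h \<in> carrier M" using h by (simp add: A_def)
      have "subgroup (cyc h) (add_monoid M)" using cyc_submodule[OF hM] by (rule submodule.axioms(1))
      hence "cyc h \<lhd> add_monoid M" using comm_group.normal_iff_subgroup[OF M.a_comm_group] by blast
      hence "group (add_monoid M Mod cyc h)" by (rule normal.factorgroup_is_group)
      hence "G i \<cong> (add_monoid M Mod cyc h)" using h(1) group.iso_sym by (auto simp: A_def)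
      hence "G i \<cong> G j" using h(2) iso_trans by (auto simp: A_def)
      thus False using noniso ij by blast
    qed
    thus "A i \<inter> A j = {}" by blast
  qed
  hence "(\<Sum>i\<in>S. measure (haar p M) (A i)) = measure (haar p M) (\<Union>i\<in>S. A i)"
    using A S by (intro H.finite_measure_finite_Union[symmetric]) auto
  also have "\<dots> \<le> 1" by (rule H.prob_le_1)
  finally show ?thesis using A by simp
qed

end

section \<open>Adjointness\<close>

lemma mod_isomorphic_refl: "mod_isomorphic R M M"
  unfolding mod_isomorphic_def mod_hom_def by (intro bexI[of _ "\<lambda>x. x"]) (auto simp: bij_betw_def)

lemma mod_isomorphic_sym: "Module.module R M \<Longrightarrow> mod_isomorphic R M M' \<Longrightarrow> mod_isomorphic R M' M"
  unfolding mod_isomorphic_def using mod_hom_inv_into by blast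

lemma mod_isomorphic_trans:
  assumes "mod_isomorphic R M M'" "mod_isomorphic R M' M''"
  shows "mod_isomorphic R M M''"
proof -
  obtain f f' where f: "f \<in> mod_hom R M M'" "bij_betw f (carrier M) (carrier M')"
    and f': "f' \<in> mod_hom R M' M''" "bij_betw f' (carrier M') (carrier M'')"
    using assms unfolding mod_isomorphic_def by blast
  have "f' \<circ> f \<in> mod_hom R M M''" using f(1) f'(1) by (auto simp: mod_hom_def Pi_iff)
  moreover have "bij_betw (f' \<circ> f) (carrier M) (carrier M'')" using f(2) f'(2) by (rule bij_betw_trans)
  ultimately show ?thesis unfolding mod_isomorphic_def by blast
qed

text \<open>R is required to be an equivalence only on the objects satisfying P, since symmetry of
  isomorphism uses the group or module axioms.\<close>

lemma rep_quotient:
  assumes refl: "\<And>a. P a \<Longrightarrow> R a a"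
    and sym: "\<And>a b. P a \<Longrightarrow> P b \<Longrightarrow> R a b \<Longrightarrow> R b a"
    and trans: "\<And>a b c. P a \<Longrightarrow> P b \<Longrightarrow> P c \<Longrightarrow> R a b \<Longrightarrow> R b c \<Longrightarrow> R a c"
    and x: "x \<in> {a. P a} // {(a, b). P a \<and> P b \<and> R a b}"
  shows "P (rep x)"
    and "y \<in> {a. P a} // {(a, b). P a \<and> P b \<and> R a b} \<Longrightarrow> R (rep x) (rep y) \<Longrightarrow> x = y"
proof -
  have cls: "P (rep z) \<and> z = {b. P b \<and> R (rep z) b}"
    if z: "z \<in> {a. P a} // {(a, b). P a \<and> P b \<and> R a b}" for z
  proof -
    obtain a where "a \<in> {a. P a}" "z = {(a, b). P a \<and> P b \<and> R a b} `` {a}"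
      using z by (rule quotientE)
    hence a: "P a" "z = {b. P b \<and> R a b}" by auto
    have "rep z \<in> z" unfolding rep_def by (rule someI[of _ a]) (use a refl in simp)
    hence r: "P (rep z)" "R a (rep z)" using a by auto
    moreover have "R a b \<longleftrightarrow> R (rep z) b" if "P b" for b
      using a r sym trans that by blast
    ultimately show ?thesis using a by auto
  qed
  show "P (rep x)" using cls[OF x] by blast
  show "x = y" if y: "y \<in> {a. P a} // {(a, b). P a \<and> P b \<and> R a b}" and xy: "R (rep x) (rep y)"
  proof -
    have "R (rep x) b \<longleftrightarrow> R (rep y) b" if "P b" for b
      using cls[OF x] cls[OF y] xy sym trans that by blast
    hence "{b. P b \<and> R (rep x) b} = {b. P b \<and> R (rep y) b}" by blast
    thus ?thesis using cls[OF x] cls[OF y] by simp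
  qed
qed

lemma X0_rep: "x \<in> X0 p \<Longrightarrow> finite_abelian_p_group p (rep x)"
  and X0_eq: "x \<in> X0 p \<Longrightarrow> x' \<in> X0 p \<Longrightarrow> rep x \<cong> rep x' \<Longrightarrow> x = x'"
proof -
  have sym: "G' \<cong> G" if "finite_abelian_p_group p G" "G \<cong> G'" for G G' :: "nat monoid"
    using that group.iso_sym by (auto simp: finite_abelian_p_group_def comm_group_def)
  show "x \<in> X0 p \<Longrightarrow> finite_abelian_p_group p (rep x)"
    unfolding X0_def by (rule rep_quotient(1)[where R = is_iso]) (auto intro: sym iso_trans)
  show "x \<in> X0 p \<Longrightarrow> x' \<in> X0 p \<Longrightarrow> rep x \<cong> rep x' \<Longrightarrow> x = x'"
    unfolding X0_def by (rule rep_quotient(2)[where R = is_iso]) (auto intro: sym iso_trans)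
qed

lemma X1_rep: "y \<in> X1 p \<Longrightarrow> fg_Zp_module_rank1 p (rep y)"
  and X1_eq: "y \<in> X1 p \<Longrightarrow> y' \<in> X1 p \<Longrightarrow> mod_isomorphic (Zp p) (rep y) (rep y') \<Longrightarrow> y = y'"
proof -
  have sym: "mod_isomorphic (Zp p) M' M"
    if "fg_Zp_module_rank1 p M" "mod_isomorphic (Zp p) M M'" for M M' :: "(padic, padic) module"
    using that mod_isomorphic_sym by (auto simp: fg_Zp_module_rank1_def)
  show "y \<in> X1 p \<Longrightarrow> fg_Zp_module_rank1 p (rep y)"
    unfolding X1_def
    by (rule rep_quotient(1)[where R = "mod_isomorphic (Zp p)"])
      (auto intro: sym mod_isomorphic_trans mod_isomorphic_refl)
  show "y \<in> X1 p \<Longrightarrow> y' \<in> X1 p \<Longrightarrow> mod_isomorphic (Zp p) (rep y) (rep y') \<Longrightarrow> y = y'"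
    unfolding X1_def
    by (rule rep_quotient(2)[where R = "mod_isomorphic (Zp p)"])
      (auto intro: sym mod_isomorphic_trans mod_isomorphic_refl)
qed

text \<open>A finite set of pairs sits in a finite rectangle, over which the sum is at most the
  total of w because each row of P sums to at most 1.\<close>

lemma summable_weighted_kernel:
  fixes w :: "'x \<Rightarrow> real" and P :: "'x \<Rightarrow> 'y \<Rightarrow> real"
  assumes w: "w summable_on X" "\<And>x. x \<in> X \<Longrightarrow> w x \<ge> 0"
    and P: "\<And>x y. x \<in> X \<Longrightarrow> y \<in> Y \<Longrightarrow> P x y \<ge> 0"
    and row: "\<And>x F. x \<in> X \<Longrightarrow> finite F \<Longrightarrow> F \<subseteq> Y \<Longrightarrow> (\<Sum>y\<in>F. P x y) \<le> 1"
  shows "(\<lambda>(x, y). w x * P x y) summable_on (X \<times> Y)"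
proof (rule nonneg_bdd_above_summable_on)
  show "0 \<le> (case z of (x, y) \<Rightarrow> w x * P x y)" if "z \<in> X \<times> Y" for z
    using that w P by auto
  show "bdd_above (sum (\<lambda>(x, y). w x * P x y) ` {F. F \<subseteq> X \<times> Y \<and> finite F})"
  proof (rule bdd_aboveI2)
    fix F assume "F \<in> {F. F \<subseteq> X \<times> Y \<and> finite F}"
    hence F: "F \<subseteq> X \<times> Y" "finite F" by auto
    let ?A = "fst ` F" and ?B = "snd ` F"
    have AB: "?A \<subseteq> X" "?B \<subseteq> Y" "finite ?A" "finite ?B" using F by auto
    have "(\<Sum>(x, y)\<in>F. w x * P x y) \<le> (\<Sum>(x, y)\<in>?A \<times> ?B. w x * P x y)"
    proof (rule sum_mono2)
      show "F \<subseteq> ?A \<times> ?B" by (auto intro: rev_image_eqI)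
      show "0 \<le> (case z of (x, y) \<Rightarrow> w x * P x y)" if "z \<in> ?A \<times> ?B - F" for z
      proof -
        obtain x y where z: "z = (x, y)" by (cases z)
        hence "x \<in> X" "y \<in> Y" using that AB by auto
        thus ?thesis using w P z by simp
      qed
    qed (use AB in simp)
    also have "\<dots> = (\<Sum>x\<in>?A. w x * (\<Sum>y\<in>?B. P x y))"
      by (simp add: sum.cartesian_product[symmetric] sum_distrib_left)
    also have "\<dots> \<le> (\<Sum>x\<in>?A. w x * 1)"
      using AB w row by (intro sum_mono mult_left_mono) auto
    also have "\<dots> \<le> infsum w X"
      using finite_sum_le_infsum[OF w(1) AB(3,1)] w(2) by simp
    finally show "(\<Sum>(x, y)\<in>F. w x * P x y) \<le> infsum w X" .
  qed
qed

lemma adjoint_of_balance: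
  fixes ma \<nu>0 :: "'x \<Rightarrow> real" and mb \<nu>1 :: "'y \<Rightarrow> real"
  assumes ma: "\<And>x. x \<in> X \<Longrightarrow> ma x > 0" and mb: "\<And>y. y \<in> Y \<Longrightarrow> mb y > 0"
    and P: "\<And>x y. x \<in> X \<Longrightarrow> y \<in> Y \<Longrightarrow> P x y \<ge> 0" and Q: "\<And>x y. x \<in> X \<Longrightarrow> y \<in> Y \<Longrightarrow> Q y x \<ge> 0"
    and bal: "\<And>x y. x \<in> X \<Longrightarrow> y \<in> Y \<Longrightarrow> ma x * P x y = mb y * Q y x"
    and rowP: "\<And>x F. x \<in> X \<Longrightarrow> finite F \<Longrightarrow> F \<subseteq> Y \<Longrightarrow> (\<Sum>y\<in>F. P x y) \<le> 1"
    and rowQ: "\<And>y F. y \<in> Y \<Longrightarrow> finite F \<Longrightarrow> F \<subseteq> X \<Longrightarrow> (\<Sum>x\<in>F. Q y x) \<le> 1"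
    and sq0: "square_summable_on X ma \<nu>0" and sq1: "square_summable_on Y mb \<nu>1"
  shows "(\<lambda>y. \<nu>1 y * apply_operator X P \<nu>0 y / mb y) summable_on Y"
    and "(\<lambda>x. apply_operator Y Q \<nu>1 x * \<nu>0 x / ma x) summable_on X"
    and "inner_on Y mb \<nu>1 (apply_operator X P \<nu>0) = inner_on X ma (apply_operator Y Q \<nu>1) \<nu>0"
proof -
  \<comment> \<open>Summing f over x first gives the pairing on Y. Balance rewrites
    \<open>P x y / mb y\<close> as \<open>Q y x / ma x\<close>, so summing over y first gives the
    pairing on X.\<close>
  define f where "f x y = \<nu>0 x * \<nu>1 y * P x y / mb y" for x y
  have PQ: "P x y / mb y = Q y x / ma x" if "x \<in> X" "y \<in> Y" for x y
    using bal[OF that] ma[OF that(1)] mb[OF that(2)] by (simp add: field_simps)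
  have s0: "(\<lambda>(x, y). (\<nu>0 x * \<nu>0 x / ma x) * P x y) summable_on (X \<times> Y)"
    using sq0 ma P rowP unfolding square_summable_on_def
    by (intro summable_weighted_kernel) (auto simp: less_imp_le)
  have "(\<lambda>(y, x). (\<nu>1 y * \<nu>1 y / mb y) * Q y x) summable_on (Y \<times> X)"
    using sq1 mb Q rowQ unfolding square_summable_on_def
    by (intro summable_weighted_kernel) (auto simp: less_imp_le)
  hence s1: "(\<lambda>(x, y). (\<nu>1 y * \<nu>1 y / mb y) * Q y x) summable_on (X \<times> Y)"
    using summable_on_swap[of "\<lambda>(y, x). (\<nu>1 y * \<nu>1 y / mb y) * Q y x" Y X] by simp
  have "(\<lambda>z. (case z of (x, y) \<Rightarrow> (\<nu>0 x * \<nu>0 x / ma x) * P x y) + (case z of (x, y) \<Rightarrow> (\<nu>1 y * \<nu>1 y /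
      mb y) * Q y x))
      summable_on (X \<times> Y)" using s0 s1 by (rule summable_on_add)
  hence "(\<lambda>z. norm (case z of (x, y) \<Rightarrow> f x y)) summable_on (X \<times> Y)"
  proof (rule Infinite_Sum.abs_summable_on_comparison_test')
    fix z assume "z \<in> X \<times> Y"
    then obtain x y where z: "z = (x, y)" "x \<in> X" "y \<in> Y" by blast
    note pos = ma[OF z(2)] mb[OF z(3)] and a = P[OF z(2,3)]
    \<comment> \<open>With the common weight t = ma P = mb Q, the absolute value of the term is u v
      t, and the two summable majorants are u^2 t and v^2 t.\<close>
    define u where "u = \<bar>\<nu>0 x\<bar> / ma x"
    define v where "v = \<bar>\<nu>1 y\<bar> / mb y"
    define t where "t = ma x * P x y"
    have t: "t \<ge> 0" "t = mb y * Q y x"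
      using mult_nonneg_nonneg[OF less_imp_le[OF pos(1)] a] bal[OF z(2,3)] by (simp_all add: t_def)
    have uv: "u \<ge> 0" "v \<ge> 0" using pos by (auto simp: u_def v_def)
    have "u * v \<le> u * u + v * v"
      using mult_nonneg_nonneg[OF uv] sum_squares_bound[of u v]
      unfolding power2_eq_square mult.assoc by linarith
    hence "u * v * t \<le> (u * u + v * v) * t" using t(1) by (rule mult_right_mono)
    moreover have "\<bar>f x y\<bar> = u * v * t"
      using pos a by (simp add: f_def u_def v_def t_def abs_mult)
    moreover have "u * u * t = (\<nu>0 x * \<nu>0 x / ma x) * P x y"
      using pos by (simp add: u_def t_def abs_mult[symmetric])
    moreover have "v * v * t = (\<nu>1 y * \<nu>1 y / mb y) * Q y x"
      unfolding t(2) using pos by (simp add: v_def abs_mult[symmetric])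
    ultimately show "norm (case z of (x, y) \<Rightarrow> f x y) \<le>
        (case z of (x, y) \<Rightarrow> (\<nu>0 x * \<nu>0 x / ma x) * P x y) + (case z of (x, y) \<Rightarrow> (\<nu>1 y * \<nu>1 y / mb y)
            * Q y x)"
      unfolding z(1) by (simp add: distrib_right)
  qed
  hence f: "(\<lambda>(x, y). f x y) summable_on (X \<times> Y)" by (rule abs_summable_summable)
  hence f': "(\<lambda>(y, x). f x y) summable_on (Y \<times> X)"
    using summable_on_swap[of "\<lambda>(x, y). f x y" X Y] by simp
  have fY: "infsum (\<lambda>x. f x y) X = \<nu>1 y * apply_operator X P \<nu>0 y / mb y" for y
  proof -
    have "(\<lambda>x. f x y) = (\<lambda>x. (\<nu>1 y / mb y) * (\<nu>0 x * P x y))" by (auto simp: f_def)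
    thus ?thesis unfolding apply_operator_def by (simp only: infsum_cmult_right') simp
  qed
  have fX: "infsum (\<lambda>y. f x y) Y = apply_operator Y Q \<nu>1 x * \<nu>0 x / ma x" if x: "x \<in> X" for x
  proof -
    have "infsum (\<lambda>y. f x y) Y = infsum (\<lambda>y. (\<nu>0 x / ma x) * (\<nu>1 y * Q y x)) Y"
    proof (rule infsum_cong)
      fix y assume y: "y \<in> Y"
      have "f x y = \<nu>0 x * \<nu>1 y * (P x y / mb y)" by (simp add: f_def)
      thus "f x y = (\<nu>0 x / ma x) * (\<nu>1 y * Q y x)" using PQ[OF x y] by simp
    qed
    also have "\<dots> = (\<nu>0 x / ma x) * apply_operator Y Q \<nu>1 x"
      unfolding apply_operator_def by (rule infsum_cmult_right')
    finally show ?thesis by simp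
  qed
  show "(\<lambda>y. \<nu>1 y * apply_operator X P \<nu>0 y / mb y) summable_on Y"
    using summable_on_Sigma_banach[OF f'] unfolding fY .
  show "(\<lambda>x. apply_operator Y Q \<nu>1 x * \<nu>0 x / ma x) summable_on X"
    using summable_on_Sigma_banach[OF f] summable_on_cong[of X, OF fX] by simp
  show "inner_on Y mb \<nu>1 (apply_operator X P \<nu>0) = inner_on X ma (apply_operator Y Q \<nu>1) \<nu>0"
  proof -
    have "inner_on X ma (apply_operator Y Q \<nu>1) \<nu>0 = infsum (\<lambda>x. infsum (\<lambda>y. f x y) Y) X"
      unfolding inner_on_def using fX by (intro infsum_cong) simp
    also have "\<dots> = infsum (\<lambda>y. infsum (\<lambda>x. f x y) X) Y" using f by (rule infsum_swap_banach)
    also have "\<dots> = inner_on Y mb \<nu>1 (apply_operator X P \<nu>0)" unfolding inner_on_def fY ..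
    finally show ?thesis by simp
  qed
qed

text \<open>The summability clauses give content to the equality: \<open>infsum\<close> of a
  divergent family is 0 by default. The balance is stated for arbitrary element types, so that it
  does not depend on the types chosen for the isomorphism classes.\<close>

theorem theorem0p2:
  fixes p :: nat
  assumes "prime p"
  shows
    "(\<forall>\<nu>0 \<nu>1.
        signed_measure_on (X0 p) \<nu>0 \<and> square_summable_on (X0 p) (mu0_class p) \<nu>0 \<and>
        signed_measure_on (X1 p) \<nu>1 \<and> square_summable_on (X1 p) (mu1_class p) \<nu>1 \<longrightarrow>
        (\<lambda>y. \<nu>1 y * dstar_op p \<nu>0 y / mu1_class p y) summable_on X1 p \<and>
        (\<lambda>x. d_op p \<nu>1 x * \<nu>0 x / mu0_class p x) summable_on X0 p \<and>
        inner_on (X1 p) (mu1_class p) \<nu>1 (dstar_op p \<nu>0) =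
        inner_on (X0 p) (mu0_class p) (d_op p \<nu>1) \<nu>0)
     \<and>
     (\<forall>(G :: 'a monoid) (H :: (padic, 'b) module).
        finite_abelian_p_group p G \<and> fg_Zp_module_rank1 p H \<longrightarrow>
        mu0 p G * prob_dstar p G H = mu1 p H * prob_d p H G)"
proof -
  interpret padic_prime p by standard (rule assms)
  have "(\<lambda>y. \<nu>1 y * dstar_op p \<nu>0 y / mu1_class p y) summable_on X1 p \<and>
      (\<lambda>x. d_op p \<nu>1 x * \<nu>0 x / mu0_class p x) summable_on X0 p \<and>
      inner_on (X1 p) (mu1_class p) \<nu>1 (dstar_op p \<nu>0) = inner_on (X0 p) (mu0_class p) (d_op p \<nu>1) \<nu>0"
    if sq: "square_summable_on (X0 p) (mu0_class p) \<nu>0" "square_summable_on (X1 p) (mu1_class p) \<nu>1"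
        for \<nu>0 \<nu>1
  proof -
    have m0: "mu0_class p x > 0" if "x \<in> X0 p" for x
      using mu0_pos[OF X0_rep[OF that]] by (simp add: mu0_class_def)
    have m1: "mu1_class p y > 0" if "y \<in> X1 p" for y
      using mu1_pos[OF X1_rep[OF that]] by (simp add: mu1_class_def)
    have bal: "mu0_class p x * prob_dstar p (rep x) (rep y) = mu1_class p y * prob_d p (rep y) (rep x)"
      if "x \<in> X0 p" "y \<in> X1 p" for x y
      using balance[OF X0_rep[OF that(1)] X1_rep[OF that(2)]] by (simp add: mu0_class_def mu1_class_def)
    have nn: "prob_dstar p (rep x) (rep y) \<ge> 0" "prob_d p (rep y) (rep x) \<ge> 0"
      for x :: "nat monoid set" and y :: "(padic, padic) module set"
      by (simp_all add: prob_dstar_def prob_d_def)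
    have rowP: "(\<Sum>y\<in>F. prob_dstar p (rep x) (rep y)) \<le> 1"
      if x: "x \<in> X0 p" and F: "finite F" "F \<subseteq> X1 p" for x F
    proof (rule sum_prob_dstar_le_1[OF X0_rep[OF x] F(1)])
      show "fg_Zp_module_rank1 p (rep y)" if "y \<in> F" for y using X1_rep[of y p] F that by blast
      show "y = y'" if "y \<in> F" "y' \<in> F" "mod_isomorphic (Zp p) (rep y) (rep y')" for y y'
        using X1_eq[of y p y'] F that by blast
    qed
    have rowQ: "(\<Sum>x\<in>F. prob_d p (rep y) (rep x)) \<le> 1"
      if y: "y \<in> X1 p" and F: "finite F" "F \<subseteq> X0 p" for y F
    proof (rule sum_prob_d_le_1[OF X1_rep[OF y] F(1)])
      show "finite_abelian_p_group p (rep x)" if "x \<in> F" for x using X0_rep[of x p] F that by blast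
      show "x = x'" if "x \<in> F" "x' \<in> F" "rep x \<cong> rep x'" for x x'
        using X0_eq[of x p x'] F that by blast
    qed
    note adj = adjoint_of_balance[where X = "X0 p" and Y = "X1 p" and ma = "mu0_class p"
        and mb = "mu1_class p"
        and P = "\<lambda>x y. prob_dstar p (rep x) (rep y)" and Q = "\<lambda>y x. prob_d p (rep y) (rep x)",
        OF m0 m1 nn bal rowP rowQ sq]
    show ?thesis unfolding dstar_op_def d_op_def using adj by blast
  qed
  thus ?thesis using balance by blast
qed

end
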